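(* Let $\sigma$ be a partition of the set of all primes, let $G$ be a finite group which is a $\sigma$-full group of Sylow type, write $\sigma(G)=\{\sigma_1,\dots,\sigma_t\}$, and let $\mathcal{H}=\{H_1,\dots,H_t\}$ be a complete Hall $\sigma$-set of $G$ such that $H_i$ is a nilpotent $\sigma_i$-subgroup for all $i=1,\dots,t$. Suppose that for every $\sigma_i\in\sigma(G)$ such that $H_i$ is non-cyclic, every maximal subgroup of $H_i$ has a $\sigma_i$-sylowizer in $G$ that is $c$-permutable in $G$ with every member of $\mathcal{H}$. Then $G$ is supersoluble.
   Context: All groups are finite. $\sigma=\{\sigma_i\mid i\in I\}$ is a partition of the set $\mathbb{P}$ of all primes, i.e. $\mathbb{P}=\bigcup_{i\in I}\sigma_i$ and $\sigma_i\cap\sigma_j=\emptyset$ for $i\neq j$. For a finite group $G$, $\pi(G)$ is the set of primes dividing $|G|$ and $\sigma(G)=\{\sigma_i\mid \sigma_i\cap\pi(G)\neq\emptyset\}$. For a set of primes $\pi$, a $\pi$-number is a positive integer all of whose prime divisors lie in $\pi$; a $\pi$-subgroup is a subgroup whose order is a $\pi$-number; a Hall $\pi$-subgroup of $G$ is a $\pi$-subgroup whose index in $G$ is divisible by no prime in $\pi$. Complete Hall $\sigma$-set of $G$: a set of subgroups consisting of exactly one Hall $\sigma_i$-subgroup of $G$ for each $\sigma_i\in\sigma(G)$ (up to including the trivial subgroup); here $H_i$ is the Hall $\sigma_i$-subgroup. $G$ is $\sigma$-full of Sylow type if every subgroup $E$ of $G$ is a $D_{\sigma_i}$-group for every $\sigma_i\in\sigma(E)$,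 i.e. $E$ has a Hall $\sigma_i$-subgroup, any two Hall $\sigma_i$-subgroups of $E$ are conjugate in $E$, and every $\sigma_i$-subgroup of $E$ is contained in a Hall $\sigma_i$-subgroup of $E$. A $\sigma_i$-sylowizer of a $\sigma_i$-subgroup $R$ in $G$ is a subgroup $S$ of $G$ that is maximal (with respect to inclusion) among the subgroups of $G$ having $R$ as a Hall $\sigma_i$-subgroup. Two subgroups $H$ and $T$ of $G$ are $c$-permutable (conditionally permutable) in $G$ if there exists $x\in G$ such that $HT^x=T^xH$, where $T^x=x^{-1}Tx$. *)

theory Defs
  imports "HOL-Algebra.Algebra" "HOL-Library.Disjoint_Sets"
begin

text \<open>
  A subgroup \<open>H\<close> of \<open>G\<close>, regarded as a group in its own right, is \<open>G\<lparr>carrier := H\<rparr>\<close>.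
  A partition \<open>\<sigma>\<close> of the set of all primes is a set of nonempty sets of primes, so a class
  \<open>\<sigma>\<^sub>i\<close> is an element \<open>\<pi> \<in> \<sigma>\<close> and the index set is \<open>\<sigma>\<close> itself.
\<close>

definition prime_partition :: "nat set set \<Rightarrow> bool" where
  "prime_partition \<sigma> \<longleftrightarrow> partition_on {p. Factorial_Ring.prime p} \<sigma>"

definition pi_number :: "nat set \<Rightarrow> nat \<Rightarrow> bool" where
  "pi_number \<pi> n \<longleftrightarrow> n > 0 \<and> prime_factors n \<subseteq> \<pi>"

definition pi_subgroup :: "('a, 'b) monoid_scheme \<Rightarrow> nat set \<Rightarrow> 'a set \<Rightarrow> bool" where
  "pi_subgroup G \<pi> H \<longleftrightarrow> subgroup H G \<and> pi_number \<pi> (card H)"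

definition hall_subgroup :: "('a, 'b) monoid_scheme \<Rightarrow> nat set \<Rightarrow> 'a set \<Rightarrow> bool" where
  "hall_subgroup G \<pi> H \<longleftrightarrow>
     pi_subgroup G \<pi> H \<and>
     (\<forall>p\<in>\<pi>. Factorial_Ring.prime p \<longrightarrow> \<not> p dvd card (rcosets\<^bsub>G\<^esub> H))"

definition sigma_of :: "nat set set \<Rightarrow> ('a, 'b) monoid_scheme \<Rightarrow> nat set set" where
  "sigma_of \<sigma> G = {\<pi> \<in> \<sigma>. \<pi> \<inter> prime_factors (order G) \<noteq> {}}"

text \<open>The trivial subgroup is allowed, but not required, as a member.\<close>

definition complete_hall_set ::
  "nat set set \<Rightarrow> ('a, 'b) monoid_scheme \<Rightarrow> 'a set set \<Rightarrow> bool" where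
  "complete_hall_set \<sigma> G \<H> \<longleftrightarrow>
     (\<forall>H\<in>\<H>. H = {\<one>\<^bsub>G\<^esub>} \<or> (\<exists>\<pi>\<in>sigma_of \<sigma> G. hall_subgroup G \<pi> H)) \<and>
     (\<forall>\<pi>\<in>sigma_of \<sigma> G. \<exists>!H. H \<in> \<H> \<and> hall_subgroup G \<pi> H)"

definition conj_set :: "('a, 'b) monoid_scheme \<Rightarrow> 'a set \<Rightarrow> 'a \<Rightarrow> 'a set" where
  "conj_set G T x = (inv\<^bsub>G\<^esub> x <#\<^bsub>G\<^esub> T) #>\<^bsub>G\<^esub> x"

definition D_group :: "('a, 'b) monoid_scheme \<Rightarrow> nat set \<Rightarrow> bool" where
  "D_group G \<pi> \<longleftrightarrow>
     (\<exists>H. hall_subgroup G \<pi> H) \<and>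
     (\<forall>H K. hall_subgroup G \<pi> H \<and> hall_subgroup G \<pi> K \<longrightarrow>
        (\<exists>x\<in>carrier G. K = conj_set G H x)) \<and>
     (\<forall>L. pi_subgroup G \<pi> L \<longrightarrow> (\<exists>H. hall_subgroup G \<pi> H \<and> L \<subseteq> H))"

definition sigma_full_sylow_type :: "nat set set \<Rightarrow> ('a, 'b) monoid_scheme \<Rightarrow> bool" where
  "sigma_full_sylow_type \<sigma> G \<longleftrightarrow>
     (\<forall>E. subgroup E G \<longrightarrow>
        (\<forall>\<pi>\<in>sigma_of \<sigma> (G\<lparr>carrier := E\<rparr>). D_group (G\<lparr>carrier := E\<rparr>) \<pi>))"

definition sylowizer ::
  "('a, 'b) monoid_scheme \<Rightarrow> nat set \<Rightarrow> 'a set \<Rightarrow> 'a set \<Rightarrow> bool" where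
  "sylowizer G \<pi> R S \<longleftrightarrow>
     subgroup S G \<and> hall_subgroup (G\<lparr>carrier := S\<rparr>) \<pi> R \<and>
     (\<forall>T. subgroup T G \<and> hall_subgroup (G\<lparr>carrier := T\<rparr>) \<pi> R \<and> S \<subseteq> T \<longrightarrow> T = S)"

definition c_permutable :: "('a, 'b) monoid_scheme \<Rightarrow> 'a set \<Rightarrow> 'a set \<Rightarrow> bool" where
  "c_permutable G H T \<longleftrightarrow>
     (\<exists>x\<in>carrier G. H <#>\<^bsub>G\<^esub> conj_set G T x = conj_set G T x <#>\<^bsub>G\<^esub> H)"

definition maximal_subgroup :: "('a, 'b) monoid_scheme \<Rightarrow> 'a set \<Rightarrow> bool" where
  "maximal_subgroup G M \<longleftrightarrow>
     subgroup M G \<and> M \<noteq> carrier G \<and>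
     (\<forall>K. subgroup K G \<and> M \<subseteq> K \<longrightarrow> K = M \<or> K = carrier G)"

definition commutator_subgroup ::
  "('a, 'b) monoid_scheme \<Rightarrow> 'a set \<Rightarrow> 'a set \<Rightarrow> 'a set" where
  "commutator_subgroup G H K =
     generate G {h \<otimes>\<^bsub>G\<^esub> k \<otimes>\<^bsub>G\<^esub> inv\<^bsub>G\<^esub> h \<otimes>\<^bsub>G\<^esub> inv\<^bsub>G\<^esub> k | h k. h \<in> H \<and> k \<in> K}"

text \<open>The lower central series of \<open>G\<close> reaches the trivial subgroup.\<close>

definition nilpotent_group :: "('a, 'b) monoid_scheme \<Rightarrow> bool" where
  "nilpotent_group G \<longleftrightarrow>
     (\<exists>n. ((\<lambda>N. commutator_subgroup G N (carrier G)) ^^ n) (carrier G) = {\<one>\<^bsub>G\<^esub>})"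

text \<open>A finite series of subgroups, all normal in the whole group \<open>G\<close>, with cyclic factors.\<close>

definition supersoluble :: "('a, 'b) monoid_scheme \<Rightarrow> bool" where
  "supersoluble G \<longleftrightarrow>
     (\<exists>(n::nat) N. N 0 = {\<one>\<^bsub>G\<^esub>} \<and> N n = carrier G \<and> (\<forall>i\<le>n. N i \<lhd> G) \<and>
        (\<forall>i<n. N i \<subseteq> N (Suc i) \<and>
           cyclic_group ((G\<lparr>carrier := N (Suc i)\<rparr>) Mod (N i))))"

end

theory Submission
  imports Defs "HOL-Number_Theory.Residue_Primitive_Roots"
begin

text \<open>
  A sylowizer \<open>S\<close> of a subgroup \<open>M\<close> of prime index \<open>q\<close> in \<open>H\<^sub>i\<close> that is c-permutable with
  \<open>H\<^sub>j\<close>, \<open>j \<noteq> i\<close>, contains a conjugate of \<open>H\<^sub>j\<close>: the product of the two is a subgroup in which \<open>M\<close>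
  is still a Hall \<open>\<sigma>\<^sub>i\<close>-subgroup, so maximality applies. Hence \<open>S\<close> has index \<open>q\<close> in \<open>G\<close>. Since
  \<open>H\<^sub>i\<close> is nilpotent, this yields a condition on Sylow subgroups alone: each Sylow \<open>q\<close>-subgroup \<open>P\<close>
  is cyclic, or every subgroup of index \<open>q\<close> in \<open>P\<close> lies in a subgroup of index \<open>q\<close> in \<open>G\<close>.

  For the smallest prime this gives a normal complement of \<open>P\<close>, by transfer if \<open>P\<close> is cyclic and
  by a special case of Tate's theorem otherwise; so \<open>G\<close> has a Sylow tower. Let \<open>A\<close> be a proper
  normal subgroup and \<open>q\<close> the largest prime dividing its index. Then \<open>AP/A\<close> is normal in \<open>G/A\<close>, and
  so are all its subgroups of index \<open>q\<close>. Therefore \<open>G\<close> acts on a minimal normal subgroup inside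
  \<open>AP/A\<close> through an abelian group of exponent dividing \<open>q - 1\<close>, which makes it cyclic of order \<open>q\<close>.
\<close>

section \<open>Actions of \<open>p\<close>-groups\<close>

text \<open>The hypothesis speaks of maximal subgroups of the Hall subgroups, the argument of Sylow
  subgroups. Nilpotency is the bridge: if Q has index q in the Sylow q-subgroup of a Hall subgroup
  and N is the normal complement of that Sylow subgroup, then NQ is a maximal subgroup of the Hall
  subgroup. The exponent q - 1 matters because x^(q-1) - 1 has q - 1 distinct roots modulo q, so
  every g has an eigenvector in a minimal normal subgroup of exponent q. As the actions commute, the
  eigenspace is invariant under G, hence everything; so every subgroup of the minimal normal
  subgroup is normal. Only the quotients of order q of a normal Sylow subgroup Q are under control.
  An element that acts trivially on all of them still centralises a minimal normal subgroup inside
  Q: its q'-part centralises Q by coprime action, and its q-part lies in Q. The condition on Sylow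
  subgroups is not carried over to G/A. Subgroups of index q in AP/A are lifted to G instead and
  treated there.\<close>

lemma p_group_fixed_points:
  fixes P (structure)
  assumes "group P" "order P = p ^ n" "Factorial_Ring.prime (p::nat)" "finite E"
    and cl: "\<And>g x. g \<in> carrier P \<Longrightarrow> x \<in> E \<Longrightarrow> a g x \<in> E"
    and one: "\<And>x. x \<in> E \<Longrightarrow> a \<one>\<^bsub>P\<^esub> x = x"
    and mul: "\<And>g h x. g \<in> carrier P \<Longrightarrow> h \<in> carrier P \<Longrightarrow> x \<in> E \<Longrightarrow> a (g \<otimes>\<^bsub>P\<^esub> h) x = a g (a h x)"
  shows "p dvd card E \<longleftrightarrow> p dvd card {x \<in> E. \<forall>g\<in>carrier P. a g x = x}"
proof -
  interpret group P by fact
  \<comment> \<open>\<open>Bij E\<close> consists of extensional maps, so the action has to be cut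
    off outside E.\<close>
  define \<phi> where "\<phi> = (\<lambda>g. restrict (a g) E)"
  have bij: "\<phi> g \<in> Bij E" if g: "g \<in> carrier P" for g
  proof -
    have "bij_betw (a g) E E"
    proof (rule bij_betwI[where g = "a (inv g)"])
      show "a (inv g) (a g x) = x" if "x \<in> E" for x
        using mul[of "inv g" g x] one[OF that] g that by simp
      show "a g (a (inv g) x) = x" if "x \<in> E" for x
        using mul[of g "inv g" x] one[OF that] g that by simp
    qed (use cl g in auto)
    then have "bij_betw (\<phi> g) E E" unfolding \<phi>_def by (simp only: bij_betw_restrict_eq)
    then show ?thesis by (simp add: Bij_def \<phi>_def)
  qed
  interpret group_action P E \<phi>
  proof (intro group_action.intro group_hom.intro group_hom_axioms.intro)
    show "\<phi> \<in> hom P (BijGroup E)"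
    proof (rule homI)
      show "\<phi> g \<in> carrier (BijGroup E)" if "g \<in> carrier P" for g
        using bij[OF that] by (simp add: BijGroup_def)
      show "\<phi> (g \<otimes> h) = \<phi> g \<otimes>\<^bsub>BijGroup E\<^esub> \<phi> h" if "g \<in> carrier P" "h \<in> carrier P" for g h
      proof
        show "\<phi> (g \<otimes> h) x = (\<phi> g \<otimes>\<^bsub>BijGroup E\<^esub> \<phi> h) x" for x
          using bij[OF that(1)] bij[OF that(2)] mul[OF that] cl[OF that(2)]
          by (simp add: BijGroup_def compose_def \<phi>_def)
      qed
    qed
  qed (simp_all add: group_BijGroup is_group)
  define F where "F = {x \<in> E. \<forall>g\<in>carrier P. a g x = x}"
  have orbF: "orbit P \<phi> x = {x}" if "x \<in> F" for x
  proof -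
    have "x \<in> E" "\<forall>g\<in>carrier P. a g x = x" using that by (auto simp: F_def)
    then have "\<phi> g x = x" if "g \<in> carrier P" for g using that by (simp add: \<phi>_def)
    then show ?thesis by (auto simp: orbit_def intro!: exI[of _ \<one>])
  qed
  \<comment> \<open>The size of an orbit divides p^n, and size 1 would make x a fixed point.\<close>
  have dvd: "p dvd card (orbit P \<phi> x)" if "x \<in> E - F" for x
  proof -
    have "card (orbit P \<phi> x) * card (stabilizer P \<phi> x) = p ^ n"
      using orbit_stabilizer_theorem[of x] that assms(2) by simp
    then have "card (orbit P \<phi> x) dvd p ^ n" by (metis dvd_triv_left)
    then obtain i where i: "card (orbit P \<phi> x) = p ^ i"
      using assms(3) divides_primepow_nat by blast
    have "i \<noteq> 0"
    proof
      assume "i = 0"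
      then obtain y where "orbit P \<phi> x = {y}" using i by (auto simp: card_1_singleton_iff)
      then have "orbit P \<phi> x = {x}" using orbit_refl[of x] that by auto
      then have "a g x = x" if "g \<in> carrier P" for g
        using that \<open>x \<in> E - F\<close> by (auto simp: orbit_def \<phi>_def)
      then show False using \<open>x \<in> E - F\<close> by (auto simp: F_def)
    qed
    then show ?thesis using i by simp
  qed
  have "card E = (\<Sum>U\<in>orbits P E \<phi>. card U)"
    using disjoint_sum[OF \<open>finite E\<close>, of "\<lambda>_. 1::nat"] by simp
  also have "orbits P E \<phi> = (\<lambda>x. {x}) ` F \<union> (orbit P \<phi> ` (E - F))"
  proof -
    have "orbits P E \<phi> = orbit P \<phi> ` F \<union> orbit P \<phi> ` (E - F)"
      by (auto simp: orbits_def F_def)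
    also have "orbit P \<phi> ` F = (\<lambda>x. {x}) ` F" using orbF by (auto simp: image_iff)
    finally show ?thesis .
  qed
  also have "(\<Sum>U\<in>\<dots>. card U) = (\<Sum>U\<in>(\<lambda>x. {x}) ` F. card U) + (\<Sum>U\<in>orbit P \<phi> ` (E - F). card U)"
  proof (rule sum.union_disjoint)
    show "finite ((\<lambda>x. {x}) ` F)" using \<open>finite E\<close> by (auto simp: F_def)
    show "finite (orbit P \<phi> ` (E - F))" using \<open>finite E\<close> by auto
    have False if "x \<in> F" "y \<in> E - F" "{x} = orbit P \<phi> y" for x y
    proof -
      have "y \<in> {x}" using orbit_refl[of y] that by auto
      then show False using that by auto
    qed
    then show "(\<lambda>x. {x}) ` F \<inter> orbit P \<phi> ` (E - F) = {}" by blast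
  qed
  also have "(\<Sum>U\<in>(\<lambda>x. {x}) ` F. card U) = card F"
    by (subst sum.reindex) (auto simp: inj_on_def)
  finally have "card E = card F + (\<Sum>U\<in>orbit P \<phi> ` (E - F). card U)" .
  moreover have "p dvd (\<Sum>U\<in>orbit P \<phi> ` (E - F). card U)"
    by (rule dvd_sum) (use dvd in auto)
  ultimately show ?thesis unfolding F_def[symmetric]
    by (simp add: dvd_add_left_iff)
qed

text \<open>The iterates of f form an action of the cyclic group of order r, so the count for
  p-groups applies. It serves two purposes: counting the fixed cosets modulo p in the transfer, and
  producing a fixed element in a coprime action.\<close>

lemma prime_order_permutation_fixed_points:
  assumes "finite E" "Factorial_Ring.prime (r::nat)" "f ` E \<subseteq> E" "\<And>x. x \<in> E \<Longrightarrow> (f ^^ r) x = x"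
  shows "r dvd card E \<longleftrightarrow> r dvd card {x \<in> E. f x = x}"
proof -
  let ?Z = "integer_mod_group r"
  have r1: "r > 1" using assms(2) prime_gt_1_nat by auto
  have c: "carrier ?Z = {0..<int r}" using r1 by (simp add: carrier_integer_mod_group)
  have cl: "(f ^^ k) x \<in> E" if "x \<in> E" for k x
    using that assms(3) by (induction k) auto
  have md: "(f ^^ (k mod r)) x = (f ^^ k) x" if x: "x \<in> E" for k x
    using funpow_mod_eq[OF assms(4)[OF x]] by simp
  have "r dvd card E \<longleftrightarrow> r dvd card {x \<in> E. \<forall>g\<in>carrier ?Z. (f ^^ nat g) x = x}"
  proof (rule p_group_fixed_points[where n=1])
    show "order ?Z = r ^ 1" using r1 by (simp add: order_def c)
    fix g h x assume g: "g \<in> carrier ?Z" "h \<in> carrier ?Z" "x \<in> E"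
    have "nat ((g + h) mod int r) = (nat g + nat h) mod r"
      using g c by (simp add: nat_mod_as_int)
    then show "(f ^^ nat (g \<otimes>\<^bsub>?Z\<^esub> h)) x = (f ^^ nat g) ((f ^^ nat h) x)"
      using md[OF g(3)] by (simp add: funpow_add)
  qed (use assms cl in auto)
  also have "{x \<in> E. \<forall>g\<in>carrier ?Z. (f ^^ nat g) x = x} = {x \<in> E. f x = x}"
  proof -
    have "(f ^^ k) x = x" if "f x = x" for k x using that by (induction k) auto
    moreover have "1 \<in> carrier ?Z" using r1 c by auto
    ultimately show ?thesis by (force dest: bspec[where x = "1::int"])
  qed
  finally show ?thesis .
qed

section \<open>Products of subgroups, and central elements modulo a subgroup\<close>

context group
begin

lemma inv_mult_cancel:
  assumes "x \<in> carrier G" "y \<in> carrier G"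
  shows "x \<otimes> (inv x \<otimes> y) = y" "inv x \<otimes> (x \<otimes> y) = y"
  using assms by (simp_all add: m_assoc[symmetric])

lemma card_subgroup_dvd:
  assumes "subgroup H G" "subgroup K G" "H \<subseteq> K"
  shows "card H dvd card K"
proof -
  interpret K: group "G\<lparr>carrier := K\<rparr>" by (rule subgroup_imp_group) fact
  have "card (rcosets\<^bsub>G\<lparr>carrier := K\<rparr>\<^esub> H) * card H = card K"
    using K.lagrange[of H] subgroup_incl[OF assms] by (simp add: order_def)
  then show ?thesis by (metis dvd_triv_right)
qed

text \<open>The fibre of (h, k) -> hk over ab consists of the pairs (ad, d^-1 b) with d in H
  \<inter> K, so all fibres have the same size.\<close>

lemma card_set_mult:
  assumes "finite (carrier G)" "subgroup H G" "subgroup K G"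
  shows "card (H <#> K) * card (H \<inter> K) = card H * card K"
proof -
  interpret H: subgroup H G by fact
  interpret K: subgroup K G by fact
  have fin: "finite H" "finite K" using assms(1) H.subset K.subset finite_subset by auto
  have im: "(\<lambda>(h,k). h \<otimes> k) ` (H \<times> K) = H <#> K" by (auto simp: set_mult_def)
  have fib: "card {z \<in> H \<times> K. (case z of (h,k) \<Rightarrow> h \<otimes> k) = y} = card (H \<inter> K)" if "y \<in> H <#> K" for y
  proof -
    obtain a b where ab: "a \<in> H" "b \<in> K" "y = a \<otimes> b" using \<open>y \<in> H <#> K\<close> by (auto simp: set_mult_def)
    have "bij_betw (\<lambda>d. (a \<otimes> d, inv d \<otimes> b)) (H \<inter> K) {z \<in> H \<times> K. (case z of (h,k) \<Rightarrow> h \<otimes> k) = y}"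
    proof (rule bij_betwI[where g = "\<lambda>(h,k). inv a \<otimes> h"])
      show "(\<lambda>d. (a \<otimes> d, inv d \<otimes> b)) \<in> H \<inter> K \<rightarrow> {z \<in> H \<times> K. (case z of (h,k) \<Rightarrow> h \<otimes> k) = y}"
      proof
        fix d assume d: "d \<in> H \<inter> K"
        then have "a \<otimes> d \<otimes> (inv d \<otimes> b) = a \<otimes> b"
          using ab by (simp add: m_assoc inv_mult_cancel H.mem_carrier K.mem_carrier)
        then show "(a \<otimes> d, inv d \<otimes> b) \<in> {z \<in> H \<times> K. (case z of (h,k) \<Rightarrow> h \<otimes> k) = y}"
          using ab d by (simp add: H.mem_carrier K.mem_carrier)
      qed
      show "(\<lambda>(h, k). inv a \<otimes> h) \<in> {z \<in> H \<times> K. (case z of (h, k) \<Rightarrow> h \<otimes> k) = y} \<rightarrow> H \<inter> K"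
      proof
        fix z assume z: "z \<in> {z \<in> H \<times> K. (case z of (h, k) \<Rightarrow> h \<otimes> k) = y}"
        then obtain h k where h: "z = (h,k)" "h \<in> H" "k \<in> K" "h \<otimes> k = a \<otimes> b" using z ab by fast
        then have "inv a \<otimes> h = b \<otimes> inv k"
        proof -
          have c: "a \<in> carrier G" "b \<in> carrier G" "h \<in> carrier G" "k \<in> carrier G"
            using h ab H.mem_carrier K.mem_carrier by auto
          have "b = inv a \<otimes> h \<otimes> k" using h(4) c inv_solve_left by (simp add: m_assoc)
          then show ?thesis using c by (simp add: m_assoc)
        qed
        then show "(case z of (h, k) \<Rightarrow> inv a \<otimes> h) \<in> H \<inter> K"
          using h ab by (simp, metis H.m_closed H.m_inv_closed K.m_closed K.m_inv_closed)
      qed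
      show "(case (a \<otimes> d, inv d \<otimes> b) of (h, k) \<Rightarrow> inv a \<otimes> h) = d" if "d \<in> H \<inter> K" for d
        using that ab by (simp add: m_assoc[symmetric] H.mem_carrier)
      show "(a \<otimes> (case z of (h, k) \<Rightarrow> inv a \<otimes> h), inv (case z of (h, k) \<Rightarrow> inv a \<otimes> h) \<otimes> b) = z"
        if zz: "z \<in> {z \<in> H \<times> K. (case z of (h, k) \<Rightarrow> h \<otimes> k) = y}" for z
      proof -
        obtain h k where z: "z = (h,k)" "h \<in> H" "k \<in> K" "h \<otimes> k = a \<otimes> b" using zz ab by auto
        have "a \<otimes> (inv a \<otimes> h) = h" using z ab by (simp add: m_assoc[symmetric] H.mem_carrier)
        moreover have "inv (inv a \<otimes> h) \<otimes> b = inv h \<otimes> (a \<otimes> b)"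
          using z ab by (simp add: inv_mult_group m_assoc H.mem_carrier K.mem_carrier)
        moreover have "\<dots> = k" using z(2,3) unfolding z(4)[symmetric] 
          by (simp add: m_assoc[symmetric] H.mem_carrier K.mem_carrier)
        ultimately show ?thesis using z by simp
      qed
    qed
    from bij_betw_same_card[OF this] show ?thesis by (rule sym)
  qed
  have "card H * card K = (\<Sum>z\<in>H \<times> K. 1)" by (simp add: card_cartesian_product)
  also have "\<dots> = (\<Sum>y\<in>H <#> K. \<Sum>z | z \<in> H \<times> K \<and> (case z of (h,k) \<Rightarrow> h \<otimes> k) = y. 1)"
    by (rule sum.group[symmetric]) (use fin im in \<open>auto simp: set_mult_def\<close>)
  also have "\<dots> = (\<Sum>y\<in>H <#> K. card (H \<inter> K))"
    by (rule sum.cong) (use fib in auto)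
  finally show ?thesis by simp
qed

text \<open>Invariance of L is asked for a single x and its inverse, because L will in general be
  normalised by a p-subgroup and not by the whole group.\<close>

lemma conj_image_rcoset:
  assumes "L \<subseteq> carrier G" "\<And>l. l \<in> L \<Longrightarrow> x \<otimes> l \<otimes> inv x \<in> L" "\<And>l. l \<in> L \<Longrightarrow> inv x \<otimes> l \<otimes> x \<in> L"
    "x \<in> carrier G" "z \<in> carrier G"
  shows "(\<lambda>c. x \<otimes> c \<otimes> inv x) ` (L #> z) = L #> (x \<otimes> z \<otimes> inv x)"
proof -
  have 1: "x \<otimes> (l \<otimes> z) \<otimes> inv x = (x \<otimes> l \<otimes> inv x) \<otimes> (x \<otimes> z \<otimes> inv x)" if "l \<in> L" for l
    using assms that by (simp add: m_assoc subset_eq) (simp add: m_assoc[symmetric])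
  have 2: "l = x \<otimes> (inv x \<otimes> l \<otimes> x) \<otimes> inv x" if "l \<in> L" for l
    using assms that by (simp add: m_assoc subset_eq) (simp add: m_assoc[symmetric])
  show ?thesis
  proof
    show "(\<lambda>c. x \<otimes> c \<otimes> inv x) ` (L #> z) \<subseteq> L #> (x \<otimes> z \<otimes> inv x)"
      using assms(2) 1 by (auto simp: r_coset_def)
    show "L #> (x \<otimes> z \<otimes> inv x) \<subseteq> (\<lambda>c. x \<otimes> c \<otimes> inv x) ` (L #> z)"
    proof
      fix y assume "y \<in> L #> (x \<otimes> z \<otimes> inv x)"
      then obtain l where l: "l \<in> L" "y = l \<otimes> (x \<otimes> z \<otimes> inv x)" by (auto simp: r_coset_def)
      then have "y = x \<otimes> ((inv x \<otimes> l \<otimes> x) \<otimes> z) \<otimes> inv x"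
        using 1[OF assms(3)[OF l(1)]] 2[OF l(1), symmetric] by simp
      then show "y \<in> (\<lambda>c. x \<otimes> c \<otimes> inv x) ` (L #> z)"
        using assms(3)[OF l(1)] by (auto simp: r_coset_def)
    qed
  qed
qed

lemma rcoset_eq_iff:
  assumes "subgroup L G" "x \<in> carrier G" "y \<in> carrier G"
  shows "L #> x = L #> y \<longleftrightarrow> x \<otimes> inv y \<in> L"
proof -
  have "L #> x = L #> y \<longleftrightarrow> x \<in> L #> y"
    using repr_independence[of x L y] rcos_self[of x L] assms by auto
  also have "\<dots> \<longleftrightarrow> x \<otimes> inv y \<in> L" using assms by (simp add: subgroup.rcos_module[OF assms(1) is_group])
  finally show ?thesis .
qed

text \<open>P permutes the cosets of L in D by conjugation. Their number is a power of p greater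
  than 1, so the number of fixed cosets is divisible by p, and L is not the only one.\<close>

lemma p_group_central_element_mod:
  assumes "finite (carrier G)" "Factorial_Ring.prime p" "subgroup P G" "card P = p ^ n"
    and "subgroup D G" "card D = p ^ k" "subgroup L G" "L \<subset> D"
    and PD: "\<And>x d. x \<in> P \<Longrightarrow> d \<in> D \<Longrightarrow> x \<otimes> d \<otimes> inv x \<in> D"
    and PL: "\<And>x d. x \<in> P \<Longrightarrow> d \<in> L \<Longrightarrow> x \<otimes> d \<otimes> inv x \<in> L"
  obtains z where "z \<in> D - L" "\<And>x. x \<in> P \<Longrightarrow> x \<otimes> z \<otimes> inv x \<otimes> inv z \<in> L"
proof -
  interpret P: subgroup P G by fact
  interpret D: subgroup D G by fact
  interpret L: subgroup L G by fact
  define a where "a = (\<lambda>x C. (\<lambda>c. x \<otimes> c \<otimes> inv x) ` C)"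
  have a: "a x (L #> z) = L #> (x \<otimes> z \<otimes> inv x)" if "x \<in> P" "z \<in> D" for x z
    unfolding a_def
  proof (rule conj_image_rcoset)
    show "inv x \<otimes> l \<otimes> x \<in> L" if "l \<in> L" for l using PL[of "inv x" l] \<open>x \<in> P\<close> that by simp
  qed (use that PL L.subset in \<open>auto simp: P.mem_carrier D.mem_carrier\<close>)
  define E where "E = (\<lambda>z. L #> z) ` D"
  have finD: "finite D" using assms(1) D.subset finite_subset by blast
  then have "finite E" unfolding E_def by simp
  have cE: "card E * card L = p ^ k"
  proof -
    interpret DG: group "G\<lparr>carrier := D\<rparr>" by (rule subgroup_imp_group) fact
    have "rcosets\<^bsub>G\<lparr>carrier := D\<rparr>\<^esub> L = E" by (auto simp: RCOSETS_def E_def r_coset_def)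
    then show ?thesis
      using DG.lagrange[of L] subgroup_incl[OF assms(7,5)] assms(6,8) by (auto simp: order_def)
  qed
  then have "card E dvd p ^ k" by (metis dvd_triv_left)
  then obtain i where i: "card E = p ^ i" using assms(2) divides_primepow_nat by blast
  have "card L < p ^ k" using psubset_card_mono[OF finD assms(8)] assms(6) by simp
  then have "i \<noteq> 0" using cE i by (cases "i = 0") auto
  then have pE: "p dvd card E" using i by simp
  have "p dvd card E \<longleftrightarrow> p dvd card {C \<in> E. \<forall>g\<in>carrier (G\<lparr>carrier := P\<rparr>). a g C = C}"
  proof (rule p_group_fixed_points[where n = n])
    show "group (G\<lparr>carrier := P\<rparr>)" by (rule subgroup_imp_group) fact
    show "order (G\<lparr>carrier := P\<rparr>) = p ^ n" using assms by (simp add: order_def)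
    fix g x assume gx: "g \<in> carrier (G\<lparr>carrier := P\<rparr>)" "x \<in> E"
    show "a g x \<in> E" using gx PD by (auto simp: E_def a)
  next
    fix x assume "x \<in> E" then show "a \<one>\<^bsub>G\<lparr>carrier := P\<rparr>\<^esub> x = x"
      by (auto simp: E_def a D.mem_carrier)
  next
    fix g h x assume gx: "g \<in> carrier (G\<lparr>carrier := P\<rparr>)" "h \<in> carrier (G\<lparr>carrier := P\<rparr>)" "x \<in> E"
    then show "a (g \<otimes>\<^bsub>G\<lparr>carrier := P\<rparr>\<^esub> h) x = a g (a h x)"
      using PD by (auto simp: E_def a D.mem_carrier P.mem_carrier m_assoc inv_mult_group)
  qed fact+
  then have pF: "p dvd card {C \<in> E. \<forall>g\<in>P. a g C = C}" (is "p dvd card ?F") using pE by simp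
  have LF: "L \<in> ?F"
  proof -
    have "L = L #> \<one>" using L.subset by simp
    then have "L \<in> E" unfolding E_def using D.one_closed by blast
    moreover have "a x L = L" if "x \<in> P" for x
      using a[OF that D.one_closed] that P.mem_carrier L.subset by simp
    ultimately show ?thesis by blast
  qed
  have "\<not> ?F \<subseteq> {L}"
  proof
    assume "?F \<subseteq> {L}" then have "?F = {L}" using LF by blast
    then show False using pF assms(2) by (metis card_1_singleton_iff One_nat_def not_prime_unit)
  qed
  then obtain z where z: "z \<in> D" "L #> z \<noteq> L" "\<forall>x\<in>P. a x (L #> z) = L #> z"
    by (auto simp: E_def)
  show thesis
  proof
    show "z \<in> D - L" using z coset_join2[of z L] assms(7) D.mem_carrier by auto
    show "x \<otimes> z \<otimes> inv x \<otimes> inv z \<in> L" if "x \<in> P" for x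
    proof -
      have "L #> (x \<otimes> z \<otimes> inv x) = L #> z" using z a[of x z] that by simp
      then show ?thesis using that z P.mem_carrier D.mem_carrier
        by (subst (asm) rcoset_eq_iff) (use assms(7) in auto)
    qed
  qed
qed

end

lemma obtain_maximal_set:
  assumes "finite F" "A \<in> F"
  obtains M where "M \<in> F" "A \<subseteq> M" "\<And>Y. Y \<in> F \<Longrightarrow> M \<subseteq> Y \<Longrightarrow> Y = M"
  using finite_has_maximal2[OF assms] by metis

section \<open>Subgroups of smallest prime index and maximal subgroups of p-groups\<close>

context group
begin

text \<open>In a finite group the inverse of x is the power of x with exponent |G| - 1.\<close>

lemma finite_subgroupI:
  assumes "finite (carrier G)" "H \<subseteq> carrier G" "\<one> \<in> H" "\<And>x y. x \<in> H \<Longrightarrow> y \<in> H \<Longrightarrow> x \<otimes> y \<in> H"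
  shows "subgroup H G"
proof (rule subgroupI)
  show "inv x \<in> H" if "x \<in> H" for x
  proof -
    have x: "x \<in> carrier G" using that assms(2) by auto
    have pw: "x [^] k \<in> H" for k :: nat using that assms(3,4) by (induction k) auto
    have "order G > 0" using assms(1) by (simp add: order_gt_0_iff_finite)
    then have "x [^] (order G - 1) \<otimes> x = \<one>"
      using pow_order_eq_1[OF x] by (metis Suc_diff_1 nat_pow_Suc)
    then have "inv x = x [^] (order G - 1)" using x by (simp add: inv_equality)
    then show ?thesis using pw by simp
  qed
qed (use assms in auto)

lemma subgroup_set_mult:
  assumes "subgroup A G" "subgroup B G" "\<And>a b. a \<in> A \<Longrightarrow> b \<in> B \<Longrightarrow> b \<otimes> a \<otimes> inv b \<in> A"
  shows "subgroup (A <#> B) G"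
proof (rule subgroupI)
  interpret A: subgroup A G by fact
  interpret B: subgroup B G by fact
  show "A <#> B \<subseteq> carrier G" using A.subset B.subset by (rule set_mult_closed)
  show "A <#> B \<noteq> {}" using A.one_closed B.one_closed unfolding set_mult_def by blast
  fix x assume "x \<in> A <#> B"
  then obtain a b where ab: "x = a \<otimes> b" "a \<in> A" "b \<in> B" by (auto simp: set_mult_def)
  have "inv x = (inv b \<otimes> inv a \<otimes> inv (inv b)) \<otimes> inv b"
    using ab by (simp add: inv_mult_group m_assoc A.mem_carrier B.mem_carrier)
  moreover have "inv b \<otimes> inv a \<otimes> inv (inv b) \<in> A" using ab assms(3) by blast
  ultimately show "inv x \<in> A <#> B" using ab unfolding set_mult_def by blast
  fix y assume "y \<in> A <#> B"
  then obtain c d where cd: "y = c \<otimes> d" "c \<in> A" "d \<in> B" by (auto simp: set_mult_def)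
  have "x \<otimes> y = (a \<otimes> (b \<otimes> c \<otimes> inv b)) \<otimes> (b \<otimes> d)"
    using ab cd by (simp add: m_assoc inv_mult_cancel A.mem_carrier B.mem_carrier)
  moreover have "a \<otimes> (b \<otimes> c \<otimes> inv b) \<in> A" using ab cd assms(3) by blast
  ultimately show "x \<otimes> y \<in> A <#> B" using ab cd unfolding set_mult_def by blast
qed

lemma set_mult_upper:
  assumes "subgroup A G" "subgroup B G"
  shows "A \<subseteq> A <#> B" "B \<subseteq> A <#> B"
proof -
  interpret A: subgroup A G by fact
  interpret B: subgroup B G by fact
  have "a = a \<otimes> \<one>" if "a \<in> A" for a using that A.mem_carrier by simp
  then show "A \<subseteq> A <#> B" unfolding set_mult_def using B.one_closed by blast
  have "b = \<one> \<otimes> b" if "b \<in> B" for b using that B.mem_carrier by simp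
  then show "B \<subseteq> A <#> B" unfolding set_mult_def using A.one_closed by blast
qed

lemma set_mult_least:
  assumes "subgroup C G" "A \<subseteq> C" "B \<subseteq> C"
  shows "A <#> B \<subseteq> C"
  using assms subgroup.m_closed[OF assms(1)] by (auto simp: set_mult_def)

lemma subgroup_card_pos:
  assumes "finite (carrier G)" "subgroup H G"
  shows "card H > 0" "finite H"
  using assms subgroup.one_closed[OF assms(2)] finite_subset[OF subgroup.subset[OF assms(2)]]
  by (auto simp: card_gt_0_iff)

lemma subgroup_nat_pow_closed: "subgroup H G \<Longrightarrow> x \<in> H \<Longrightarrow> x [^] (k::nat) \<in> H"
  by (induction k) (auto intro: subgroup.m_closed subgroup.one_closed)

lemma pow_card_subgroup:
  assumes "finite (carrier G)" "subgroup H G" "x \<in> H"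
  shows "x [^] card H = \<one>"
proof -
  interpret H: group "G\<lparr>carrier := H\<rparr>" by (rule subgroup_imp_group) fact
  show ?thesis using H.pow_order_eq_1[of x] assms(3) nat_pow_consistent by (simp add: order_def)
qed

lemma subgroup_conj_image:
  assumes "subgroup S G" "x \<in> carrier G"
  shows "subgroup ((\<lambda>s. x \<otimes> s \<otimes> inv x) ` S) G" "card ((\<lambda>s. x \<otimes> s \<otimes> inv x) ` S) = card S"
proof -
  interpret S: subgroup S G by fact
  show "subgroup ((\<lambda>s. x \<otimes> s \<otimes> inv x) ` S) G"
  proof (rule subgroupI)
    show "(\<lambda>s. x \<otimes> s \<otimes> inv x) ` S \<noteq> {}" using S.one_closed by blast
    show "(\<lambda>s. x \<otimes> s \<otimes> inv x) ` S \<subseteq> carrier G" using assms S.mem_carrier by auto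
    fix a assume "a \<in> (\<lambda>s. x \<otimes> s \<otimes> inv x) ` S"
    then obtain s where s: "a = x \<otimes> s \<otimes> inv x" "s \<in> S" by auto
    have "inv a = x \<otimes> inv s \<otimes> inv x" using s assms(2) S.mem_carrier by (simp add: inv_mult_group m_assoc)
    then show "inv a \<in> (\<lambda>s. x \<otimes> s \<otimes> inv x) ` S" using s by auto
    fix b assume "b \<in> (\<lambda>s. x \<otimes> s \<otimes> inv x) ` S"
    then obtain t where t: "b = x \<otimes> t \<otimes> inv x" "t \<in> S" by auto
    have "a \<otimes> b = x \<otimes> (s \<otimes> t) \<otimes> inv x"
      using s t assms(2) S.mem_carrier by (simp add: inv_mult_cancel m_assoc)
    then show "a \<otimes> b \<in> (\<lambda>s. x \<otimes> s \<otimes> inv x) ` S" using s t by auto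
  qed
  have "inj_on (\<lambda>s. x \<otimes> s \<otimes> inv x) S"
    using assms S.mem_carrier by (auto simp: inj_on_def)
  then show "card ((\<lambda>s. x \<otimes> s \<otimes> inv x) ` S) = card S" by (rule card_image)
qed

text \<open>For a conjugate T of S the order of ST is d|S| with d = |S : S \<inter> T|. Since ST is
  not all of G, d < p; as d divides |G| and p is the smallest prime divisor, d = 1 and T =
  S.\<close>

lemma smallest_prime_index_normal:
  assumes "finite (carrier G)" "subgroup S G" "Factorial_Ring.prime p" "order G = p * card S"
    and "\<And>r. Factorial_Ring.prime r \<Longrightarrow> r dvd order G \<Longrightarrow> p \<le> r"
  shows "S \<lhd> G"
proof -
  interpret S: subgroup S G by fact
  have "x \<otimes> s \<otimes> inv x \<in> S" if x: "x \<in> carrier G" and s: "s \<in> S" for x s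
  proof (cases "x \<in> S")
    case True then show ?thesis using s by simp
  next
    case False
    define T where "T = (\<lambda>s. x \<otimes> s \<otimes> inv x) ` S"
    have T: "subgroup T G" "card T = card S" using subgroup_conj_image[OF assms(2) x] by (auto simp: T_def)
    have ST: "subgroup (S \<inter> T) G" using assms(2) T(1) by (rule subgroups_Inter_pair)
    have pos: "card (S \<inter> T) > 0" "card S > 0" using subgroup_card_pos(1)[OF assms(1)] ST assms(2) by auto
    have "card (S \<inter> T) dvd card S" using ST assms(2) by (rule card_subgroup_dvd) auto
    then obtain d where d: "card S = card (S \<inter> T) * d" by (auto elim: dvdE)
    have "card (S <#> T) * card (S \<inter> T) = card S * card S"
      using card_set_mult[OF assms(1,2) T(1)] T by simp
    also have "\<dots> = (d * card S) * card (S \<inter> T)" by (subst (1) d) simp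
    finally have cST: "card (S <#> T) = d * card S" using pos by simp
    have STG: "S <#> T \<subseteq> carrier G" using S.subset subgroup.subset[OF T(1)] by (rule set_mult_closed)
    \<comment> \<open>The product of S with a conjugate by x never contains x^-1 unless x lies in
      S.\<close>
    have "S <#> T \<noteq> carrier G"
    proof
      assume "S <#> T = carrier G"
      then have "inv x \<in> S <#> T" using x by simp
      then obtain a b where ab: "inv x = a \<otimes> (x \<otimes> b \<otimes> inv x)" "a \<in> S" "b \<in> S"
        by (auto simp: set_mult_def T_def)
      have "\<one> = (a \<otimes> (x \<otimes> b \<otimes> inv x)) \<otimes> x" using ab(1) x by (metis l_inv)
      also have "\<dots> = a \<otimes> (x \<otimes> b)" using ab(2,3) x S.mem_carrier by (simp add: m_assoc)
      finally have one: "a \<otimes> (x \<otimes> b) = \<one>" by simp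
      have "x = inv a \<otimes> (a \<otimes> (x \<otimes> b)) \<otimes> inv b"
        using ab(2,3) x S.mem_carrier by (simp add: inv_mult_cancel m_assoc)
      also have "\<dots> = inv a \<otimes> inv b" unfolding one using ab(2) S.mem_carrier by simp
      finally have "x \<in> S" using ab(2,3) by simp
      then show False using False by simp
    qed
    then have "card (S <#> T) < order G" unfolding order_def
      using STG assms(1) by (simp add: psubset_card_mono psubsetI)
    then have "d < p" using cST assms(4) pos by simp
    moreover have "d dvd order G" using d assms(4) by (metis dvd_mult dvd_triv_right)
    ultimately have "d = 1" using assms(5)
      by (metis dvd_trans leD le_trans dvd_imp_le prime_factor_nat d mult_is_0 pos(2) neq0_conv)
    then have "S \<inter> T = S" using d subgroup_card_pos[OF assms(1,2)] 
      by (metis card_subset_eq inf_le1 mult.right_neutral)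
    then have "T = S" using T(2) subgroup_card_pos[OF assms(1) T(1)] by (metis card_subset_eq inf_le2)
    then show ?thesis using s by (auto simp: T_def)
  qed
  then show ?thesis using assms(2) by (simp add: normal_inv_iff)
qed

text \<open>This is the part of D that P centralises modulo L. With [x, z] = x z x^-1 z^-1, closure
  under products comes from [x, zw] = [x, z] z[x, w]z^-1, where the conjugate stays in L because z
  lies in D and so in P.\<close>

lemma central_mod_subgroup:
  assumes "finite (carrier G)" "subgroup P G" "subgroup D G" "subgroup L G" "D \<subseteq> P"
    and PL: "\<And>x d. x \<in> P \<Longrightarrow> d \<in> L \<Longrightarrow> x \<otimes> d \<otimes> inv x \<in> L"
  shows "subgroup {z \<in> D. \<forall>x\<in>P. x \<otimes> z \<otimes> inv x \<otimes> inv z \<in> L} G"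
proof (rule finite_subgroupI)
  interpret P: subgroup P G by fact
  interpret D: subgroup D G by fact
  interpret L: subgroup L G by fact
  fix z w assume z: "z \<in> {z \<in> D. \<forall>x\<in>P. x \<otimes> z \<otimes> inv x \<otimes> inv z \<in> L}" "w \<in> {z \<in> D. \<forall>x\<in>P. x \<otimes> z \<otimes> inv x \<otimes> inv z \<in> L}"
  have "x \<otimes> (z \<otimes> w) \<otimes> inv x \<otimes> inv (z \<otimes> w) \<in> L" if "x \<in> P" for x
  proof -
    have "x \<otimes> (z \<otimes> w) \<otimes> inv x \<otimes> inv (z \<otimes> w) =
      (x \<otimes> z \<otimes> inv x \<otimes> inv z) \<otimes> (z \<otimes> (x \<otimes> w \<otimes> inv x \<otimes> inv w) \<otimes> inv z)"
      using z that by (simp add: m_assoc inv_mult_cancel inv_mult_group P.mem_carrier D.mem_carrier)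
    also have "\<dots> \<in> L"
    proof (rule L.m_closed)
      show "x \<otimes> z \<otimes> inv x \<otimes> inv z \<in> L" using z that by blast
      show "z \<otimes> (x \<otimes> w \<otimes> inv x \<otimes> inv w) \<otimes> inv z \<in> L"
        by (rule PL) (use z that assms(5) in blast)+
    qed
    finally show ?thesis .
  qed
  then show "z \<otimes> w \<in> {z \<in> D. \<forall>x\<in>P. x \<otimes> z \<otimes> inv x \<otimes> inv z \<in> L}" using z by auto
qed (use assms subgroup.subset subgroup.one_closed subgroup.mem_carrier[OF assms(2)] in auto)

text \<open>Maximal subgroups of a p-group have index p. Let M be maximal above U and L maximal
  among the subgroups of M that Q normalises. An element z that is central modulo L and has its p-th
  power in L lies outside M; so M<z> = Q, and |<z> : M \<inter> <z>| divides p.\<close>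

lemma p_subgroup_below_index_p:
  assumes "finite (carrier G)" "Factorial_Ring.prime p" "subgroup Q G" "card Q = p ^ n"
    and "subgroup U G" "U \<subset> Q"
  obtains M where "subgroup M G" "U \<subseteq> M" "M \<subseteq> Q" "card Q = p * card M"
proof -
  interpret Q: subgroup Q G by fact
  have finQ: "finite Q" using subgroup_card_pos assms(1,3) by blast
  let ?S = "{Y. subgroup Y G \<and> Y \<subset> Q}"
  have "finite ?S" using finQ by (rule_tac finite_subset[of _ "Pow Q"]) auto
  moreover have "U \<in> ?S" using assms(5,6) by blast
  ultimately obtain M where M0: "M \<in> ?S" "U \<subseteq> M" and Mm: "\<And>Y. Y \<in> ?S \<Longrightarrow> M \<subseteq> Y \<Longrightarrow> Y = M"
    by (rule obtain_maximal_set) blast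
  then have M: "subgroup M G" "M \<subset> Q" "U \<subseteq> M" by simp_all
  have Mmax: "Y = M" if "subgroup Y G" "Y \<subset> Q" "M \<subseteq> Y" for Y using Mm[of Y] that by simp
  let ?L = "{Y. subgroup Y G \<and> Y \<subseteq> M \<and> (\<forall>x\<in>Q. \<forall>y\<in>Y. x \<otimes> y \<otimes> inv x \<in> Y)}"
  have "finite ?L" using finQ M by (rule_tac finite_subset[of _ "Pow Q"]) auto
  moreover have "{\<one>} \<in> ?L" using subgroup.one_closed[OF M(1)] triv_subgroup Q.mem_carrier by auto
  ultimately obtain L where L0: "L \<in> ?L" and Lm: "\<And>Y. Y \<in> ?L \<Longrightarrow> L \<subseteq> Y \<Longrightarrow> Y = L"
    by (rule obtain_maximal_set) blast
  then have L: "subgroup L G" "L \<subseteq> M" "\<And>x y. x \<in> Q \<Longrightarrow> y \<in> L \<Longrightarrow> x \<otimes> y \<otimes> inv x \<in> L"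
    by simp_all
  have Lmax: "L = Y" if "subgroup Y G" "Y \<subseteq> M" "\<And>x y. x \<in> Q \<Longrightarrow> y \<in> Y \<Longrightarrow> x \<otimes> y \<otimes> inv x \<in> Y" "L \<subseteq> Y" for Y
    using Lm[of Y] that by simp
  interpret L: subgroup L G by fact
  interpret M: subgroup M G by fact
  have LQ: "L \<subset> Q" using L M by auto
  define C where "C = {z \<in> Q. \<forall>x\<in>Q. x \<otimes> z \<otimes> inv x \<otimes> inv z \<in> L}"
  have C: "subgroup C G" unfolding C_def
    by (rule central_mod_subgroup) (use assms L in auto)
  obtain z0 where "z0 \<in> Q - L" "\<And>x. x \<in> Q \<Longrightarrow> x \<otimes> z0 \<otimes> inv x \<otimes> inv z0 \<in> L"
    by (rule p_group_central_element_mod[OF assms(1,2,3,4,3,4) L(1) LQ]) (use L(3) in auto)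
  then have z0: "z0 \<in> C - L" by (simp add: C_def)
  have z0c: "z0 \<in> Q" "z0 \<in> carrier G" using z0 Q.mem_carrier by (auto simp: C_def)
  have "z0 [^] (p ^ n) \<in> L" using pow_card_subgroup[OF assms(1,3) z0c(1)] assms(4) L.one_closed by simp
  moreover have "z0 [^] (p ^ 0) \<notin> L" using z0 z0c by simp
  \<comment> \<open>The last term of z0, z0^p, z0^(p^2), ... that lies outside L is still central
    modulo L, and its p-th power is in L.\<close>
  ultimately obtain k where k: "z0 [^] (p ^ k) \<notin> L" "z0 [^] (p ^ Suc k) \<in> L"
    using ex_least_nat_less[of "\<lambda>k. z0 [^] (p ^ k) \<in> L" n] by auto
  define z where "z = z0 [^] (p ^ k)"
  have z: "z \<in> C" "z \<notin> L" "z [^] p \<in> L"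
    using k subgroup_nat_pow_closed[OF C, of z0] z0 z0c by (auto simp: z_def nat_pow_pow mult.commute)
  have zQ: "z \<in> Q" "z \<in> carrier G" using z(1) Q.mem_carrier by (auto simp: C_def)
  define Z where "Z = generate G {z}"
  have Z: "subgroup Z G" unfolding Z_def using zQ by (intro generate_is_subgroup) auto
  have ZC: "Z \<subseteq> C" unfolding Z_def by (rule generate_subgroup_incl) (use z C in auto)
  have ZQ: "Z \<subseteq> Q" using ZC by (auto simp: C_def)
  have LZ: "subgroup (L <#> Z) G"
    by (rule subgroup_set_mult) (use L Z ZQ in auto)
  have LZn: "x \<otimes> y \<otimes> inv x \<in> L <#> Z" if xy: "x \<in> Q" "y \<in> L <#> Z" for x y
  proof -
    obtain l w where lw: "y = l \<otimes> w" "l \<in> L" "w \<in> Z" using xy by (auto simp: set_mult_def)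
    have c: "x \<in> carrier G" "l \<in> carrier G" "w \<in> carrier G"
      using xy lw ZQ Q.mem_carrier L.mem_carrier by auto
    have "x \<otimes> y \<otimes> inv x = ((x \<otimes> l \<otimes> inv x) \<otimes> (x \<otimes> w \<otimes> inv x \<otimes> inv w)) \<otimes> w"
      using lw c by (simp add: m_assoc inv_mult_cancel)
    moreover have "(x \<otimes> l \<otimes> inv x) \<otimes> (x \<otimes> w \<otimes> inv x \<otimes> inv w) \<in> L"
      using lw ZC xy L(3) by (rule_tac L.m_closed) (auto simp: C_def)
    ultimately show ?thesis using lw unfolding set_mult_def by blast
  qed
  \<comment> \<open>If z were in M, then L<z> would be a larger subgroup of M normalised by Q,
    against the choice of L.\<close>
  have "z \<notin> M"
  proof
    assume "z \<in> M"
    then have "Z \<subseteq> M" unfolding Z_def by (intro generate_subgroup_incl) (use M in auto)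
    then have "L <#> Z \<subseteq> M" using L by (intro set_mult_least) (use M in auto)
    then have "L = L <#> Z" using Lmax[OF LZ] LZn set_mult_upper(1)[OF L(1) Z] by blast
    moreover have "z \<in> L <#> Z" using set_mult_upper(2)[OF L(1) Z] unfolding Z_def by (auto intro: generate.incl)
    ultimately show False using z by auto
  qed
  have MZ: "subgroup (M <#> Z) G"
  proof (rule subgroup_set_mult)
    fix a b assume ab: "a \<in> M" "b \<in> Z"
    have c: "a \<in> carrier G" "b \<in> carrier G" using ab ZQ Q.mem_carrier M.mem_carrier by auto
    have "inv (a \<otimes> b \<otimes> inv a \<otimes> inv b) \<in> L" using ab ZC M by (intro L.m_inv_closed) (auto simp: C_def)
    moreover have "b \<otimes> a \<otimes> inv b = inv (a \<otimes> b \<otimes> inv a \<otimes> inv b) \<otimes> a"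
      using c by (simp add: m_assoc inv_mult_group)
    ultimately show "b \<otimes> a \<otimes> inv b \<in> M" using L(2) ab by (metis M.m_closed subsetD)
  qed (use M Z in auto)
  have "M <#> Z \<subseteq> Q" using M ZQ by (intro set_mult_least) (use assms in auto)
  moreover have "z \<in> M <#> Z" using set_mult_upper(2)[OF M(1) Z] unfolding Z_def by (auto intro: generate.incl)
  ultimately have MZQ: "M <#> Z = Q"
    using Mmax[OF MZ] \<open>z \<notin> M\<close> set_mult_upper(1)[OF M(1) Z] by blast
  have card1: "card Q * card (M \<inter> Z) = card M * card Z"
    using card_set_mult[OF assms(1) M(1) Z] MZQ by simp
  \<comment> \<open>The subgroup generated by z^p lies in both M and <z>, and its index in <z>
    divides p. This bounds the order of M \<inter> <z> from below.\<close>
  define W where "W = generate G {z [^] p}"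
  have W: "subgroup W G" unfolding W_def using zQ by (intro generate_is_subgroup) auto
  have WM: "W \<subseteq> M \<inter> Z" unfolding W_def
  proof (rule generate_subgroup_incl)
    show "subgroup (M \<inter> Z) G" using M(1) Z by (rule subgroups_Inter_pair)
    have "z \<in> Z" by (auto simp: Z_def intro: generate.incl)
    then show "{z [^] p} \<subseteq> M \<inter> Z" using z(3) L(2) subgroup_nat_pow_closed[OF Z] by auto
  qed
  have "card W dvd card (M \<inter> Z)" 
    using W WM subgroups_Inter_pair[OF M(1) Z] by (intro card_subgroup_dvd) auto
  have oz: "ord z = card Z" "ord (z [^] p) = card W" using generate_pow_card[OF zQ(2)] generate_pow_card[of "z [^] p"] zQ by (auto simp: Z_def W_def)
  have "card Z dvd p * card W" 
  proof -
    have "z [^] (p * card W) = \<one>" using pow_ord_eq_1[of "z [^] p"] zQ oz by (simp add: nat_pow_pow)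
    then show ?thesis using pow_eq_id[OF zQ(2)] oz by simp
  qed
  then have "card Z dvd p * card (M \<inter> Z)" using \<open>card W dvd _\<close> by (meson dvd_trans mult_dvd_mono dvd_refl)
  then have "card M * card Z dvd card M * (p * card (M \<inter> Z))" by simp
  then have "card Q * card (M \<inter> Z) dvd (p * card M) * card (M \<inter> Z)" using card1 by (simp add: ac_simps)
  then have d1: "card Q dvd p * card M" 
    using subgroup_card_pos(1)[OF assms(1) subgroups_Inter_pair[OF M(1) Z]] by (simp add: nat_mult_dvd_cancel_disj del: card_gt_0_iff card_eq_0_iff)
  have "card M dvd card Q" using M assms(3) by (intro card_subgroup_dvd) auto
  then obtain e where e: "card Q = card M * e" by (auto elim: dvdE)
  then have "e dvd p" using d1 subgroup_card_pos(1)[OF assms(1) M(1)] by (metis mult.commute nat_mult_dvd_cancel1)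
  moreover have "e \<noteq> 1" using e psubset_card_mono[OF finQ M(2)] by auto
  ultimately have "e = p" using assms(2) by (auto simp: prime_nat_iff)
  then show thesis using that[of M] M e by auto
qed

end

section \<open>Transfer and normal complements of Sylow subgroups\<close>

lemma (in monoid) nat_pow_cong:
  assumes "x \<in> carrier G" "x [^] (c::nat) = \<one>" "[i = j] (mod c)"
  shows "x [^] i = x [^] j"
proof -
  have *: "x [^] k = x [^] (k mod c)" for k :: nat
  proof -
    have "x [^] k = x [^] (c * (k div c) + k mod c)" by simp
    also have "\<dots> = (x [^] c) [^] (k div c) \<otimes> x [^] (k mod c)"
      using assms(1) by (simp only: nat_pow_mult nat_pow_pow)
    also have "\<dots> = x [^] (k mod c)" using assms(1,2) by simp
    finally show ?thesis .
  qed
  show ?thesis using *[of i] *[of j] assms(3) by (simp add: cong_def)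
qed

text \<open>In the product over \<Omega> the shift by \<open>act h\<close> in the cocycle identity
  disappears, because an injective self-map of the finite set \<Omega> only permutes the factors.
  With \<Omega> the cosets of P and w the cocycle of a transversal this is the transfer.\<close>

lemma transfer_hom:
  assumes "group G" "comm_group A" "finite \<Omega>"
    and act: "\<And>g. g \<in> carrier G \<Longrightarrow> act g ` \<Omega> \<subseteq> \<Omega>" "\<And>g. g \<in> carrier G \<Longrightarrow> inj_on (act g) \<Omega>"
    and w: "\<And>g \<omega>. g \<in> carrier G \<Longrightarrow> \<omega> \<in> \<Omega> \<Longrightarrow> w g \<omega> \<in> carrier A"
    and coc: "\<And>g h \<omega>. g \<in> carrier G \<Longrightarrow> h \<in> carrier G \<Longrightarrow> \<omega> \<in> \<Omega> \<Longrightarrow>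
       w (g \<otimes>\<^bsub>G\<^esub> h) \<omega> = w g (act h \<omega>) \<otimes>\<^bsub>A\<^esub> w h \<omega>"
  shows "(\<lambda>g. finprod A (w g) \<Omega>) \<in> hom G A"
proof (rule homI)
  interpret G: group G by fact
  interpret A: comm_group A by fact
  show "finprod A (w g) \<Omega> \<in> carrier A" if "g \<in> carrier G" for g
    using w that by (intro A.finprod_closed) auto
  fix g h assume gh: "g \<in> carrier G" "h \<in> carrier G"
  have im: "act h ` \<Omega> = \<Omega>" using act[OF gh(2)] assms(3) by (rule_tac endo_inj_surj) auto
  have "finprod A (w (g \<otimes>\<^bsub>G\<^esub> h)) \<Omega> = finprod A (\<lambda>\<omega>. w g (act h \<omega>) \<otimes>\<^bsub>A\<^esub> w h \<omega>) \<Omega>"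
    using gh w coc act(1)[OF gh(2)] by (intro A.finprod_cong') (auto simp: image_subset_iff)
  also have "\<dots> = finprod A (\<lambda>\<omega>. w g (act h \<omega>)) \<Omega> \<otimes>\<^bsub>A\<^esub> finprod A (w h) \<Omega>"
    using gh w act(1)[OF gh(2)] by (intro A.finprod_multf) (auto simp: image_subset_iff)
  also have "finprod A (\<lambda>\<omega>. w g (act h \<omega>)) \<Omega> = finprod A (w g) (act h ` \<Omega>)"
    using gh w im act(2)[OF gh(2)] by (intro A.finprod_reindex[symmetric]) auto
  finally show "finprod A (w (g \<otimes>\<^bsub>G\<^esub> h)) \<Omega> = finprod A (w g) \<Omega> \<otimes>\<^bsub>A\<^esub> finprod A (w h) \<Omega>"
    by (simp add: im)
qed

text \<open>
  If \<open>z g \<omega> = u(g)\<^sup>-\<^sup>1 w(g, \<omega>)\<close> is central with \<open>u(g) = w(g, \<omega>0)\<close>, the required homomorphism is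
  \<open>u(g) (\<Prod>\<omega>. z g \<omega>)\<^sup>m\<close>, where \<open>m\<close> inverts \<open>|\<Omega>|\<close> modulo \<open>|Z|\<close>; it does not depend on \<open>\<omega>0\<close>.
\<close>

lemma cocycle_average:
  fixes G (structure) and B (structure)
  assumes "group G" "group B" "finite \<Omega>" "\<omega>0 \<in> \<Omega>"
    and Z: "subgroup Z B" "finite Z" "\<And>z b. z \<in> Z \<Longrightarrow> b \<in> carrier B \<Longrightarrow> z \<otimes>\<^bsub>B\<^esub> b = b \<otimes>\<^bsub>B\<^esub> z"
    and co: "coprime (card \<Omega>) (card Z)"
    and act: "\<And>g. g \<in> carrier G \<Longrightarrow> act g ` \<Omega> \<subseteq> \<Omega>" "\<And>g. g \<in> carrier G \<Longrightarrow> inj_on (act g) \<Omega>"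
    and w: "\<And>g \<omega>. g \<in> carrier G \<Longrightarrow> \<omega> \<in> \<Omega> \<Longrightarrow> w g \<omega> \<in> carrier B"
    and coc: "\<And>g h \<omega>. g \<in> carrier G \<Longrightarrow> h \<in> carrier G \<Longrightarrow> \<omega> \<in> \<Omega> \<Longrightarrow>
       w (g \<otimes>\<^bsub>G\<^esub> h) \<omega> = w g (act h \<omega>) \<otimes>\<^bsub>B\<^esub> w h \<omega>"
    and rat: "\<And>g \<omega>. g \<in> carrier G \<Longrightarrow> \<omega> \<in> \<Omega> \<Longrightarrow> inv\<^bsub>B\<^esub> (w g \<omega>0) \<otimes>\<^bsub>B\<^esub> w g \<omega> \<in> Z"
  obtains \<phi> where "\<phi> \<in> hom G B" "\<And>g. g \<in> carrier G \<Longrightarrow> inv\<^bsub>B\<^esub> (w g \<omega>0) \<otimes>\<^bsub>B\<^esub> \<phi> g \<in> Z"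
proof -
  interpret G: group G by fact
  interpret B: group B by fact
  interpret Z: subgroup Z B by fact
  define A where "A = B\<lparr>carrier := Z\<rparr>"
  interpret A: group A unfolding A_def by (rule B.subgroup_imp_group) fact
  have Am[simp]: "x \<otimes>\<^bsub>A\<^esub> y = x \<otimes>\<^bsub>B\<^esub> y" "carrier A = Z" "\<one>\<^bsub>A\<^esub> = \<one>\<^bsub>B\<^esub>" for x y by (simp_all add: A_def)
  interpret A: comm_group A
    by (rule A.group_comm_groupI) (use Z(3) Z.mem_carrier in auto)
  have "\<exists>m. [card \<Omega> * m = Suc 0] (mod card Z)" using co by (rule cong_solve_coprime_nat)
  then obtain m where m: "[card \<Omega> * m = Suc 0] (mod card Z)" by blast
  define u where "u g = w g \<omega>0" for g
  define z where "z g \<omega> = inv\<^bsub>B\<^esub> (u g) \<otimes>\<^bsub>B\<^esub> w g \<omega>" for g \<omega>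
  define \<zeta> where "\<zeta> g = finprod A (z g) \<Omega>" for g
  define \<phi> where "\<phi> g = u g \<otimes>\<^bsub>B\<^esub> \<zeta> g [^]\<^bsub>A\<^esub> m" for g
  have u: "u g \<in> carrier B" if "g \<in> carrier G" for g using w assms(4) that by (simp add: u_def)
  have z: "z g \<omega> \<in> Z" if "g \<in> carrier G" "\<omega> \<in> \<Omega>" for g \<omega> using rat that by (simp add: z_def u_def)
  have wz: "w g \<omega> = u g \<otimes>\<^bsub>B\<^esub> z g \<omega>" if "g \<in> carrier G" "\<omega> \<in> \<Omega>" for g \<omega>
    using that u w by (simp add: z_def B.inv_mult_cancel)
  have \<zeta>: "\<zeta> g \<in> Z" if "g \<in> carrier G" for g
    using A.finprod_closed[of "z g" \<Omega>] z that by (auto simp: \<zeta>_def)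
  have \<zeta>m: "\<zeta> g [^]\<^bsub>A\<^esub> m \<in> Z" if "g \<in> carrier G" for g
    using A.nat_pow_closed[of "\<zeta> g" m] \<zeta>[OF that] by simp
  have "\<phi> \<in> hom G B"
  proof (rule homI)
    show "\<phi> g \<in> carrier B" if "g \<in> carrier G" for g
      using u[OF that] \<zeta>m[OF that] Z.mem_carrier by (auto simp: \<phi>_def)
    fix g h assume gh: "g \<in> carrier G" "h \<in> carrier G"
    have ah: "act h \<omega> \<in> \<Omega>" if "\<omega> \<in> \<Omega>" for \<omega> using act(1)[OF gh(2)] that by auto
    \<comment> \<open>The central element \<open>a\<close> is the defect of u as a homomorphism:
      u(gh) = u(g) u(h) a.\<close>
    define a where "a = z g (act h \<omega>0)"
    have a: "a \<in> Z" unfolding a_def using z gh ah assms(4) by simp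
    have wgh: "w (g \<otimes>\<^bsub>G\<^esub> h) \<omega> = (u g \<otimes>\<^bsub>B\<^esub> u h) \<otimes>\<^bsub>B\<^esub> (z g (act h \<omega>) \<otimes>\<^bsub>B\<^esub> z h \<omega>)" if "\<omega> \<in> \<Omega>" for \<omega>
    proof -
      have zz: "z g (act h \<omega>) \<in> Z" "z h \<omega> \<in> Z" using z gh ah that by auto
      have "w (g \<otimes>\<^bsub>G\<^esub> h) \<omega> = u g \<otimes>\<^bsub>B\<^esub> z g (act h \<omega>) \<otimes>\<^bsub>B\<^esub> (u h \<otimes>\<^bsub>B\<^esub> z h \<omega>)"
        using coc[OF gh that] wz[OF gh(1) ah[OF that]] wz[OF gh(2) that] by simp
      also have "\<dots> = u g \<otimes>\<^bsub>B\<^esub> ((z g (act h \<omega>) \<otimes>\<^bsub>B\<^esub> u h) \<otimes>\<^bsub>B\<^esub> z h \<omega>)"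
        using u gh zz Z.mem_carrier by (simp add: B.m_assoc)
      also have "z g (act h \<omega>) \<otimes>\<^bsub>B\<^esub> u h = u h \<otimes>\<^bsub>B\<^esub> z g (act h \<omega>)" using Z(3) zz u gh by blast
      finally show ?thesis using u gh zz Z.mem_carrier by (simp add: B.m_assoc)
    qed
    have "z h \<omega>0 = \<one>\<^bsub>B\<^esub>" using u gh by (simp add: z_def u_def[symmetric])
    then have ugh: "u (g \<otimes>\<^bsub>G\<^esub> h) = u g \<otimes>\<^bsub>B\<^esub> u h \<otimes>\<^bsub>B\<^esub> a"
      using wgh[OF assms(4)] a Z.mem_carrier by (simp add: u_def[symmetric] a_def)
    have zgh: "z (g \<otimes>\<^bsub>G\<^esub> h) \<omega> = inv\<^bsub>A\<^esub> a \<otimes>\<^bsub>A\<^esub> (z g (act h \<omega>) \<otimes>\<^bsub>A\<^esub> z h \<omega>)" if "\<omega> \<in> \<Omega>" for \<omega>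
    proof -
      have zz: "z g (act h \<omega>) \<in> Z" "z h \<omega> \<in> Z" using z gh ah that by auto
      have "inv\<^bsub>A\<^esub> a = inv\<^bsub>B\<^esub> a" unfolding A_def using a assms(5) by (simp add: B.m_inv_consistent)
      then show ?thesis
        using zz a u gh Z.mem_carrier unfolding z_def[of "g \<otimes>\<^bsub>G\<^esub> h"] ugh wgh[OF that]
        by (simp add: B.inv_mult_group B.m_assoc B.inv_mult_cancel)
    qed
    have im: "act h ` \<Omega> = \<Omega>" using act[OF gh(2)] assms(3) by (rule_tac endo_inj_surj) auto
    have ia: "inv\<^bsub>A\<^esub> a \<in> carrier A" using a A.inv_closed[of a] by simp
    have "\<zeta> (g \<otimes>\<^bsub>G\<^esub> h) = finprod A (\<lambda>\<omega>. inv\<^bsub>A\<^esub> a \<otimes>\<^bsub>A\<^esub> (z g (act h \<omega>) \<otimes>\<^bsub>A\<^esub> z h \<omega>)) \<Omega>"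
      unfolding \<zeta>_def using gh z ah zgh ia by (intro A.finprod_cong') auto
    also have "\<dots> = finprod A (\<lambda>\<omega>. inv\<^bsub>A\<^esub> a) \<Omega> \<otimes>\<^bsub>A\<^esub> finprod A (\<lambda>\<omega>. z g (act h \<omega>) \<otimes>\<^bsub>A\<^esub> z h \<omega>) \<Omega>"
      using gh z ah ia by (intro A.finprod_multf) auto
    also have "finprod A (\<lambda>\<omega>. inv\<^bsub>A\<^esub> a) \<Omega> = inv\<^bsub>A\<^esub> a [^]\<^bsub>A\<^esub> card \<Omega>" using ia by (rule A.finprod_const)
    also have "finprod A (\<lambda>\<omega>. z g (act h \<omega>) \<otimes>\<^bsub>A\<^esub> z h \<omega>) \<Omega> = finprod A (\<lambda>\<omega>. z g (act h \<omega>)) \<Omega> \<otimes>\<^bsub>A\<^esub> \<zeta> h"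
      unfolding \<zeta>_def using gh z ah by (intro A.finprod_multf) auto
    also have "finprod A (\<lambda>\<omega>. z g (act h \<omega>)) \<Omega> = finprod A (z g) (act h ` \<Omega>)"
      using gh z im act(2)[OF gh(2)] by (intro A.finprod_reindex[symmetric]) auto
    also have "\<dots> = \<zeta> g" by (simp add: im \<zeta>_def)
    finally have \<zeta>gh: "\<zeta> (g \<otimes>\<^bsub>G\<^esub> h) = inv\<^bsub>A\<^esub> a [^]\<^bsub>A\<^esub> card \<Omega> \<otimes>\<^bsub>A\<^esub> (\<zeta> g \<otimes>\<^bsub>A\<^esub> \<zeta> h)" .
    \<comment> \<open>The product over \<Omega> contributes the inverse of \<open>a\<close> once for
      each element of \<Omega>. The m-th power turns this into a single factor, which cancels the
      defect of u.\<close>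
    have "inv\<^bsub>A\<^esub> a [^]\<^bsub>A\<^esub> (card \<Omega> * m) = inv\<^bsub>A\<^esub> a [^]\<^bsub>A\<^esub> Suc 0"
    proof (rule A.nat_pow_cong)
      show "inv\<^bsub>A\<^esub> a [^]\<^bsub>A\<^esub> card Z = \<one>\<^bsub>A\<^esub>" using A.pow_order_eq_1[OF ia] by (simp add: order_def)
    qed (use m ia in auto)
    then have ip: "(inv\<^bsub>A\<^esub> a [^]\<^bsub>A\<^esub> card \<Omega>) [^]\<^bsub>A\<^esub> m = inv\<^bsub>A\<^esub> a" using ia by (simp add: A.nat_pow_pow del: Am)
    have "\<zeta> (g \<otimes>\<^bsub>G\<^esub> h) [^]\<^bsub>A\<^esub> m = inv\<^bsub>A\<^esub> a \<otimes>\<^bsub>A\<^esub> (\<zeta> g [^]\<^bsub>A\<^esub> m \<otimes>\<^bsub>A\<^esub> \<zeta> h [^]\<^bsub>A\<^esub> m)"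
    proof -
      have c: "\<zeta> g \<in> carrier A" "\<zeta> h \<in> carrier A" using \<zeta> gh by auto
      show ?thesis unfolding \<zeta>gh using c ia by (simp add: A.nat_pow_distrib ip del: Am)
    qed
    then have "\<phi> (g \<otimes>\<^bsub>G\<^esub> h) = u g \<otimes>\<^bsub>B\<^esub> u h \<otimes>\<^bsub>B\<^esub> a \<otimes>\<^bsub>B\<^esub> (inv\<^bsub>A\<^esub> a \<otimes>\<^bsub>B\<^esub> (\<zeta> g [^]\<^bsub>A\<^esub> m \<otimes>\<^bsub>B\<^esub> \<zeta> h [^]\<^bsub>A\<^esub> m))"
      by (simp add: \<phi>_def ugh)
    also have "inv\<^bsub>A\<^esub> a = inv\<^bsub>B\<^esub> a" unfolding A_def using a assms(5) by (simp add: B.m_inv_consistent)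
    also have "u g \<otimes>\<^bsub>B\<^esub> u h \<otimes>\<^bsub>B\<^esub> a \<otimes>\<^bsub>B\<^esub> (inv\<^bsub>B\<^esub> a \<otimes>\<^bsub>B\<^esub> (\<zeta> g [^]\<^bsub>A\<^esub> m \<otimes>\<^bsub>B\<^esub> \<zeta> h [^]\<^bsub>A\<^esub> m))
      = u g \<otimes>\<^bsub>B\<^esub> (u h \<otimes>\<^bsub>B\<^esub> \<zeta> g [^]\<^bsub>A\<^esub> m) \<otimes>\<^bsub>B\<^esub> \<zeta> h [^]\<^bsub>A\<^esub> m"
      using u gh a \<zeta>m Z.mem_carrier by (simp add: B.m_assoc B.inv_mult_cancel)
    also have "u h \<otimes>\<^bsub>B\<^esub> \<zeta> g [^]\<^bsub>A\<^esub> m = \<zeta> g [^]\<^bsub>A\<^esub> m \<otimes>\<^bsub>B\<^esub> u h" using Z(3) \<zeta>m u gh by metis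
    finally show "\<phi> (g \<otimes>\<^bsub>G\<^esub> h) = \<phi> g \<otimes>\<^bsub>B\<^esub> \<phi> h"
      using u gh \<zeta>m Z.mem_carrier by (simp add: \<phi>_def B.m_assoc)
  qed
  moreover have "inv\<^bsub>B\<^esub> (w g \<omega>0) \<otimes>\<^bsub>B\<^esub> \<phi> g \<in> Z" if "g \<in> carrier G" for g
    using u[OF that] \<zeta>m[OF that] Z.mem_carrier by (simp add: \<phi>_def u_def[symmetric] B.inv_mult_cancel)
  ultimately show thesis using that by blast
qed

context group
begin

lemma lcoset_action:
  assumes "finite (carrier G)" "subgroup P G"
  shows "finite (lcosets P)" "g \<in> carrier G \<Longrightarrow> (\<lambda>\<omega>. g <# \<omega>) ` (lcosets P) \<subseteq> lcosets P"
    "g \<in> carrier G \<Longrightarrow> inj_on (\<lambda>\<omega>. g <# \<omega>) (lcosets P)"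
    "g \<in> carrier G \<Longrightarrow> h \<in> carrier G \<Longrightarrow> \<omega> \<in> lcosets P \<Longrightarrow> (g \<otimes> h) <# \<omega> = g <# (h <# \<omega>)"
    "\<omega> \<in> lcosets P \<Longrightarrow> \<one> <# \<omega> = \<omega>"
    "\<omega> \<in> lcosets P \<Longrightarrow> \<omega> \<subseteq> carrier G" 
    "\<omega> \<in> lcosets P \<Longrightarrow> x \<in> \<omega> \<Longrightarrow> y \<in> \<omega> \<Longrightarrow> inv x \<otimes> y \<in> P"
proof -
  interpret P: subgroup P G by fact
  show sub: "\<omega> \<in> lcosets P \<Longrightarrow> \<omega> \<subseteq> carrier G" for \<omega>
    by (rule P.lcosets_carrier[OF is_group])
  show "finite (lcosets P)" using assms(1) by (auto simp: LCOSETS_def)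
  show "g \<in> carrier G \<Longrightarrow> (\<lambda>\<omega>. g <# \<omega>) ` (lcosets P) \<subseteq> lcosets P"
    using P.subset by (auto simp: LCOSETS_def lcos_m_assoc)
  show mul: "g \<in> carrier G \<Longrightarrow> h \<in> carrier G \<Longrightarrow> \<omega> \<in> lcosets P \<Longrightarrow> (g \<otimes> h) <# \<omega> = g <# (h <# \<omega>)" for g h \<omega>
    using sub by (simp add: lcos_m_assoc)
  show one: "\<omega> \<in> lcosets P \<Longrightarrow> \<one> <# \<omega> = \<omega>" for \<omega>
    using sub by (simp add: lcos_mult_one)
  show "g \<in> carrier G \<Longrightarrow> inj_on (\<lambda>\<omega>. g <# \<omega>) (lcosets P)"
    by (rule inj_on_inverseI[where g = "\<lambda>\<omega>. inv g <# \<omega>"]) (simp add: mul[symmetric] one)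
  show "inv x \<otimes> y \<in> P" if xy: "\<omega> \<in> lcosets P" "x \<in> \<omega>" "y \<in> \<omega>"
  proof -
    obtain a where a: "a \<in> carrier G" "\<omega> = a <# P" using xy(1) by (auto simp: LCOSETS_def)
    then obtain b c where bc: "b \<in> P" "c \<in> P" "x = a \<otimes> b" "y = a \<otimes> c" using xy(2,3) by (auto simp: l_coset_def)
    have "inv x \<otimes> y = inv b \<otimes> c"
      using bc a P.mem_carrier by (simp add: inv_mult_group m_assoc inv_mult_cancel)
    then show ?thesis using bc by simp
  qed
qed

end

text \<open>If a inverts n modulo p - 1, then Fermat's theorem gives k = k^(na) = 1 modulo p. The
  condition on n excludes the case p = 2, n = 0, where n and p - 1 are coprime and the conclusion
  may fail.\<close>

lemma prime_cong_1_if_coprime_exponent: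
  assumes "Factorial_Ring.prime (p::nat)" "[k ^ n = 1] (mod p)" "coprime n (p - 1)" "n \<noteq> 0"
  shows "[k = 1] (mod p)"
proof -
  have "\<not> p dvd k"
  proof
    assume "p dvd k"
    then have "p dvd k ^ n" using assms(4) by (simp add: dvd_trans[OF _ dvd_power])
    then have "[k ^ n = 0] (mod p)" by (simp add: cong_0_iff)
    then have "[1 = 0] (mod p)" using assms(2) by (metis cong_sym cong_trans)
    then show False using prime_gt_1_nat[OF assms(1)] by (simp add: cong_def)
  qed
  then have f: "[k ^ (p - 1) = 1] (mod p)" using assms(1) by (rule_tac fermat_theorem)
  obtain a b where ab: "n * a = (p - 1) * b + 1"
    using bezout_nat[OF assms(4), of "p - 1"] assms(3) by auto
  have "[k ^ (n * a) = 1] (mod p)" using cong_pow[OF assms(2), of a] by (simp add: power_mult)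
  moreover have "[k ^ (n * a) = k] (mod p)"
    using cong_mult[OF cong_pow[OF f, of b] cong_refl[of k]]
    unfolding ab by (simp only: power_add power_mult power_one_right power_one mult_1)
  ultimately show ?thesis by (metis cong_sym cong_trans)
qed

section \<open>Transfer into a cyclic Sylow subgroup\<close>

context group
begin

lemma nat_pow_eq_iff_cong:
  assumes "x \<in> carrier G"
  shows "x [^] (i::nat) = x [^] (j::nat) \<longleftrightarrow> [i = j] (mod ord x)"
proof -
  have "x [^] i = x [^] j \<longleftrightarrow> int (ord x) dvd int j - int i"
    using int_pow_eq[OF assms, of "int i" "int j"] by (simp add: int_pow_int)
  also have "\<dots> \<longleftrightarrow> [j = i] (mod ord x)" by (simp add: cong_int_iff[symmetric] cong_iff_dvd_diff)
  finally show ?thesis by (simp add: cong_sym_eq)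
qed

text \<open>The solutions of x^p = 1 in <a> are the powers of a^(p^(n-1)). They form a group of
  order p, which any nontrivial element generates: the exponent of y is p^(n-1) times a number that
  is invertible modulo p.\<close>

lemma cyclic_p_group_unique_prime_order:
  assumes "finite (carrier G)" "Factorial_Ring.prime p" "a \<in> carrier G" "ord a = p ^ n"
    and y: "y = a [^] (i::nat)" "y \<noteq> \<one>" "y [^] p = \<one>" 
    and x: "x = a [^] (j::nat)" "x [^] p = \<one>"
  obtains k :: nat where "x = y [^] k"
proof -
  have n: "n \<noteq> 0"
  proof
    assume "n = 0"
    then have "a = \<one>" using assms(3,4) ord_eq_1 by simp
    then show False using y by simp
  qed
  have pp: "p ^ n = p ^ (n-1) * p" using n by (metis power_minus_mult not_gr_zero)
  have "p ^ n dvd i * p" using y(1,3) assms(3,4) pow_eq_id by (simp add: nat_pow_pow)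
  then have "p ^ (n - 1) dvd i" using pp prime_gt_0_nat[OF assms(2)] by simp
  then obtain i' where i': "i = p ^ (n-1) * i'" by (auto elim: dvdE)
  have "p ^ n dvd j * p" using x(1,2) assms(3,4) pow_eq_id by (simp add: nat_pow_pow)
  then have "p ^ (n - 1) dvd j" using pp prime_gt_0_nat[OF assms(2)] by simp
  then obtain j' where j': "j = p ^ (n-1) * j'" by (auto elim: dvdE)
  have "\<not> p ^ n dvd i" using y(1,2) assms(3,4) pow_eq_id by simp
  then have "\<not> p dvd i'" using i' pp by auto
  then have "coprime i' p" using assms(2) prime_imp_coprime coprime_commute by blast
  then obtain s where s: "[i' * s = Suc 0] (mod p)" using cong_solve_coprime_nat by blast
  have "[i' * (s * j') = j'] (mod p)" using cong_mult[OF s cong_refl[of j']] by (simp add: mult.assoc)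
  then have "[p ^ (n-1) * (i' * (s * j')) = p ^ (n-1) * j'] (mod p ^ (n-1) * p)"
    by (simp add: cong_def flip: mult_mod_right)
  then have c: "[i * (s * j') = j] (mod p ^ n)" by (simp add: i' j' pp mult.assoc)
  have "a [^] (i * (s * j')) = a [^] j"
    by (rule nat_pow_cong[OF assms(3) _ c]) (use assms(3,4) pow_ord_eq_1 in metis)
  then have "x = y [^] (s * j')" using x(1) y(1) assms(3) by (simp add: nat_pow_pow)
  then show thesis by (rule that)
qed

lemma conj_nat_pow:
  assumes "x \<in> carrier G" "t \<in> carrier G"
  shows "inv t \<otimes> x [^] (k::nat) \<otimes> t = (inv t \<otimes> x \<otimes> t) [^] k"
proof (induction k)
  case (Suc k)
  have "inv t \<otimes> x [^] Suc k \<otimes> t = (inv t \<otimes> x [^] k \<otimes> t) \<otimes> (inv t \<otimes> x \<otimes> t)"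
    using assms by (simp add: m_assoc inv_mult_cancel)
  then show ?case using Suc by simp
qed (use assms in auto)

text \<open>Conjugating |G| times by t raises y to the power k^|G| and is trivial, so k^|G| = 1
  modulo p. Since |G| is coprime to p - 1, this forces k = 1 modulo p.\<close>

lemma power_conj_trivial:
  assumes "finite (carrier G)" "Factorial_Ring.prime p" "y \<in> carrier G" "y [^] p = \<one>" "y \<noteq> \<one>" "t \<in> carrier G"
    and "inv t \<otimes> y \<otimes> t = y [^] (k::nat)" "coprime (order G) (p - 1)"
  shows "inv t \<otimes> y \<otimes> t = y"
proof -
  have it: "inv (t [^] j) \<otimes> y \<otimes> t [^] j = y [^] (k ^ j)" for j :: nat
  proof (induction j)
    case (Suc j)
    have "inv (t [^] Suc j) \<otimes> y \<otimes> t [^] Suc j = inv t \<otimes> (inv (t [^] j) \<otimes> y \<otimes> t [^] j) \<otimes> t"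
      using assms(3,6) by (simp add: inv_mult_group m_assoc)
    also have "\<dots> = y [^] (k ^ Suc j)"
      unfolding Suc conj_nat_pow[OF assms(3,6)] using assms(3,7) by (simp add: nat_pow_pow mult.commute)
    finally show ?case .
  qed (use assms in auto)
  have oy: "ord y = p" using assms(2-5) pow_eq_id[of y p] ord_eq_1[of y] by (auto simp: prime_nat_iff)
  have "y [^] (k ^ order G) = y [^] (1::nat)"
    using it[of "order G"] assms(3,6) pow_order_eq_1[OF assms(6)] by simp
  then have "[k ^ order G = 1] (mod p)"
    using nat_pow_eq_iff_cong[OF assms(3), of "k ^ order G" 1] oy by metis
  moreover have "order G \<noteq> 0" using assms(1) order_gt_0_iff_finite by simp
  ultimately have "[k = 1] (mod p)" using assms(2,8) prime_cong_1_if_coprime_exponent by blast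
  then have "y [^] k = y [^] (1::nat)" using nat_pow_cong[OF assms(3,4)] by blast
  then show ?thesis using assms(3,7) by simp
qed

lemma p_element_prime_order_power:
  assumes "x \<in> carrier G" "x [^] ((p::nat) ^ n) = \<one>" "x \<noteq> \<one>"
  obtains k :: nat where "x [^] (p ^ k) \<noteq> \<one>" "(x [^] (p ^ k)) [^] p = \<one>"
proof -
  have "\<not> x [^] (p ^ 0) = \<one>" using assms by simp
  then obtain k where k: "k < n" "\<forall>i\<le>k. \<not> x [^] (p ^ i) = \<one>" "x [^] (p ^ Suc k) = \<one>"
    using ex_least_nat_less[of "\<lambda>k. x [^] (p ^ k) = \<one>" n] assms(2) by blast
  then show thesis using that[of k] assms(1) by (simp add: nat_pow_pow mult.commute)
qed

lemma cyclic_sylow_normal_complement: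
  assumes "finite (carrier G)" "Factorial_Ring.prime p" "subgroup P G" "card P = p ^ n"
    and "order G = p ^ n * m" "\<not> p dvd m"
    and a: "a \<in> P" "\<And>x. x \<in> P \<Longrightarrow> \<exists>k::nat. x = a [^] k"
    and co: "coprime (order G) (p - 1)"
  obtains N where "N \<lhd> G" "card N = m"
proof -
  interpret P: subgroup P G by fact
  have ac: "a \<in> carrier G" using a P.mem_carrier by auto
  have p0: "p > 0" using assms(2) prime_gt_0_nat by blast
  have "generate G {a} = P"
    using a generate_pow_on_finite_carrier[OF assms(1) ac] subgroup_nat_pow_closed[OF assms(3)] by auto
  then have oa: "ord a = p ^ n" using generate_pow_card[OF ac] assms(4) by simp
  define A where "A = G\<lparr>carrier := P\<rparr>"
  have Am[simp]: "x \<otimes>\<^bsub>A\<^esub> y = x \<otimes> y" "carrier A = P" "\<one>\<^bsub>A\<^esub> = \<one>" for x y by (simp_all add: A_def)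
  have Apow: "x [^]\<^bsub>A\<^esub> k = x [^] k" for x and k :: nat unfolding A_def by (rule nat_pow_consistent[symmetric])
  interpret A: group A unfolding A_def by (rule subgroup_imp_group) fact
  interpret A: comm_group A
  proof (rule A.group_comm_groupI)
    fix x y assume "x \<in> carrier A" "y \<in> carrier A"
    then have "x \<in> P" "y \<in> P" by simp_all
    then obtain i j :: nat where "x = a [^] i" "y = a [^] j" using a(2) by meson
    then show "x \<otimes>\<^bsub>A\<^esub> y = y \<otimes>\<^bsub>A\<^esub> x" using ac by (simp add: nat_pow_mult add.commute)
  qed
  let ?O = "lcosets P"
  note act = lcoset_action[OF assms(1,3)]
  have cO: "card ?O = m"
    using l_lagrange[OF assms(1,3)] assms(4,5) p0 by simp
  define \<kappa> where "\<kappa> \<omega> = (SOME x. x \<in> \<omega>)" for \<omega> :: "'a set"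
  have \<kappa>: "\<kappa> \<omega> \<in> \<omega>" "\<kappa> \<omega> \<in> carrier G" if w: "\<omega> \<in> ?O" for \<omega>
  proof -
    obtain b where "b \<in> carrier G" "\<omega> = b <# P" using w by (auto simp: LCOSETS_def)
    then have "b \<in> \<omega>" using lcos_self assms(3) by blast
    then show "\<kappa> \<omega> \<in> \<omega>" unfolding \<kappa>_def by (rule someI)
    then show "\<kappa> \<omega> \<in> carrier G" using act(6)[OF w] by auto
  qed
  \<comment> \<open>The defining equation is g \<kappa>(\<omega>) = \<kappa>(g\<omega>) w(g,
    \<omega>) for the transversal \<kappa>.\<close>
  define w where "w g \<omega> = inv (\<kappa> (g <# \<omega>)) \<otimes> g \<otimes> \<kappa> \<omega>" for g \<omega>
  have aO: "g <# \<omega> \<in> ?O" if "g \<in> carrier G" "\<omega> \<in> ?O" for g \<omega> using act(2)[OF that(1)] that(2) by auto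
  have wP: "w g \<omega> \<in> P" if g: "g \<in> carrier G" "\<omega> \<in> ?O" for g \<omega>
  proof -
    have "g \<otimes> \<kappa> \<omega> \<in> g <# \<omega>" using \<kappa>[OF g(2)] by (auto simp: l_coset_def)
    then have "inv (\<kappa> (g <# \<omega>)) \<otimes> (g \<otimes> \<kappa> \<omega>) \<in> P" using act(7)[OF aO[OF g] \<kappa>(1)[OF aO[OF g]]] by blast
    then show ?thesis using g \<kappa>[OF g(2)] \<kappa>[OF aO[OF g]] by (simp add: w_def m_assoc)
  qed
  have coc: "w (g \<otimes> h) \<omega> = w g (h <# \<omega>) \<otimes> w h \<omega>" if g: "g \<in> carrier G" "h \<in> carrier G" "\<omega> \<in> ?O" for g h \<omega>
    using g \<kappa>(2)[OF g(3)] \<kappa>(2)[OF aO[OF g(2,3)]] \<kappa>(2)[OF aO[OF g(1) aO[OF g(2,3)]]] act(4)[OF g]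
    by (simp add: w_def m_assoc inv_mult_cancel)
  have w1: "w \<one> \<omega> = \<one>" if "\<omega> \<in> ?O" for \<omega> using that act(5) \<kappa>(2) by (simp add: w_def)
  define V where "V g = finprod A (w g) ?O" for g
  have "V \<in> hom G A" unfolding V_def
    by (rule transfer_hom) (use act wP coc in \<open>auto simp: A.comm_group_axioms is_group\<close>)
  then interpret V: group_hom G A V
    by (simp add: group_hom_def group_hom_axioms_def is_group A.is_group)
  have Vne: "V y \<noteq> \<one>" if y: "y \<in> P" "y \<noteq> \<one>" "y [^] p = \<one>" for y
  proof -
    have yc: "y \<in> carrier G" using y P.mem_carrier by auto
    have oy: "ord y = p" using assms(2) y yc pow_eq_id[of y p] ord_eq_1[of y] by (auto simp: prime_nat_iff)
    define F where "F = {\<omega> \<in> ?O. y <# \<omega> = \<omega>}"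
    have it: "((\<lambda>\<omega>. y <# \<omega>) ^^ i) \<omega> = y [^] i <# \<omega>" if "\<omega> \<in> ?O" for i \<omega>
    proof (induction i)
      case (Suc i)
      have "y [^] Suc i = y \<otimes> y [^] i" using yc by (rule nat_pow_Suc2)
      then show ?case using Suc act(4)[OF yc _ that, of "y [^] i"] yc by simp
    qed (use act(5)[OF that] in simp)
    have "p dvd card ?O \<longleftrightarrow> p dvd card {\<omega> \<in> ?O. y <# \<omega> = \<omega>}"
      using act(1,2) yc y(3) it act(5) by (intro prime_order_permutation_fixed_points) (auto simp: assms(2))
    then have pF: "\<not> p dvd card F" using cO assms(6) by (simp add: F_def)
    \<comment> \<open>Cosets moved by y contribute nothing to V(y). The induction removes one orbit
      of length p at a time.\<close>
    have free: "finprod A (w y) E = \<one>"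
      if "finite E" "E \<subseteq> ?O - F" "(\<lambda>\<omega>. y <# \<omega>) ` E \<subseteq> E" for E
      using that
    proof (induction E rule: finite_psubset_induct)
      case (psubset E)
      show ?case
      proof (cases "E = {}")
        case False
        then obtain \<omega> where w: "\<omega> \<in> E" by blast
        then have wO: "\<omega> \<in> ?O" "\<omega> \<notin> F" using psubset by auto
        define U where "U = (\<lambda>i. y [^] i <# \<omega>) ` {..<p}"
        have inE: "y [^] (i::nat) <# \<omega> \<in> E" for i
        proof (induction i)
          case (Suc i)
          have "y [^] Suc i = y \<otimes> y [^] i" using yc by (rule nat_pow_Suc2)
          then have "y [^] Suc i <# \<omega> = y <# (y [^] i <# \<omega>)" using act(4)[OF yc _ wO(1), of "y [^] i"] yc by simp
          then show ?case using Suc psubset.prems(2) by auto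
        qed (use w act(5)[OF wO(1)] in simp)
        have UE: "U \<subseteq> E" using inE by (auto simp: U_def)
        have wU: "\<omega> \<in> U" unfolding U_def using act(5)[OF wO(1)] p0 by (intro image_eqI[of _ _ 0]) auto
        have inj: "inj_on (\<lambda>i. y [^] i <# \<omega>) {..<p}"
        proof (rule linorder_inj_onI')
          fix i j assume ij: "i \<in> {..<p}" "j \<in> {..<p}" "i < j"
          show "y [^] i <# \<omega> \<noteq> y [^] j <# \<omega>"
          proof
            assume eq: "y [^] i <# \<omega> = y [^] j <# \<omega>"
            define d where "d = j - i"
            have "y [^] j = y [^] i \<otimes> y [^] d" using yc ij by (simp add: nat_pow_mult d_def)
            then have "y [^] i <# \<omega> = y [^] i <# (y [^] d <# \<omega>)" using act(4)[OF _ _ wO(1), of "y [^] i" "y [^] d"] yc eq by simp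
            then have fx: "y [^] d <# \<omega> = \<omega>" using act(3)[of "y [^] i"] yc wO(1) aO[of "y [^] d" \<omega>]
              by (auto dest: inj_onD)
            have fxk: "y [^] (d * k) <# \<omega> = \<omega>" for k :: nat
            proof (induction k)
              case (Suc k)
              have "y [^] (d * Suc k) = y [^] d \<otimes> y [^] (d * k)" using yc by (simp add: nat_pow_mult)
              then show ?case using Suc act(4)[OF _ _ wO(1), of "y [^] d" "y [^] (d * k)"] yc fx by simp
            qed (use act(5)[OF wO(1)] in simp)
            \<comment> \<open>As d is prime to p, y is a power of y^d, so y would fix \<omega> as
              soon as y^d does.\<close>
            have "\<not> p dvd d" using ij by (auto simp: d_def dest!: dvd_imp_le)
            then have "coprime d p" using assms(2) prime_imp_coprime coprime_commute by blast
            then obtain s where "[d * s = Suc 0] (mod p)" using cong_solve_coprime_nat by blast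
            then have "y [^] (d * s) = y [^] Suc 0" using nat_pow_eq_iff_cong[OF yc, of "d * s" "Suc 0"] oy by metis
            then have "y <# \<omega> = \<omega>" using fxk[of s] yc by simp
            then show False using wO by (simp add: F_def)
          qed
        qed
        have "finprod A (w y) U = finprod A (\<lambda>i. w y (y [^] i <# \<omega>)) {..<p}"
          unfolding U_def by (rule A.finprod_reindex) (use inj wP yc inE psubset.prems(1) in auto)
        \<comment> \<open>Along an orbit the cocycle values telescope to w(y^k, \<omega>); at k = p
          this is w(1, \<omega>) = 1.\<close>
        also have "finprod A (\<lambda>i. w y (y [^] i <# \<omega>)) {..<k} = w (y [^] k) \<omega>" for k :: nat
        proof (induction k)
          case (Suc k)
          have mem: "w y (y [^] i <# \<omega>) \<in> P" for i :: nat using wP yc inE psubset.prems(1) by blast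
          have "finprod A (\<lambda>i. w y (y [^] i <# \<omega>)) {..<Suc k}
            = w y (y [^] k <# \<omega>) \<otimes> finprod A (\<lambda>i. w y (y [^] i <# \<omega>)) {..<k}"
            unfolding lessThan_Suc using mem by (subst A.finprod_insert) auto
          also have "\<dots> = w (y \<otimes> y [^] k) \<omega>" using Suc coc[OF yc _ wO(1), of "y [^] k"] yc by simp
          also have "y \<otimes> y [^] k = y [^] Suc k" using nat_pow_Suc2[OF yc, of k] by (rule sym)
          finally show ?case .
        qed (simp add: w1[OF wO(1)])
        also have "w (y [^] p) \<omega> = \<one>" using y(3) w1[OF wO(1)] by simp
        finally have fU: "finprod A (w y) U = \<one>" .
        have "finprod A (w y) (E - U) = \<one>"
        proof (rule psubset.IH)
          show "E - U \<subset> E" using UE wU by blast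
          show "(\<lambda>\<omega>. y <# \<omega>) ` (E - U) \<subseteq> E - U"
          proof (intro image_subsetI DiffI)
            fix \<xi> assume x: "\<xi> \<in> E - U"
            then have xO: "\<xi> \<in> ?O" using psubset.prems(1) by blast
            show "y <# \<xi> \<in> E" using x psubset.prems(2) by blast
            show "y <# \<xi> \<notin> U"
            proof
              assume "y <# \<xi> \<in> U"
              then obtain i :: nat where i: "y <# \<xi> = y [^] i <# \<omega>" unfolding U_def by blast
              have "y [^] (p - 1) \<otimes> y = \<one>" using y(3) p0 by (metis Suc_diff_1 nat_pow_Suc)
              then have "\<xi> = y [^] (p - 1) <# (y <# \<xi>)"
                using act(4)[OF _ yc xO, of "y [^] (p-1)"] act(5)[OF xO] yc by simp
              also have "\<dots> = y [^] (p - 1 + i) <# \<omega>"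
                unfolding i using act(4)[OF _ _ wO(1), of "y [^] (p - 1)" "y [^] i"] yc by (simp add: nat_pow_mult)
              also have "y [^] (p - 1 + i) = y [^] ((p - 1 + i) mod p)"
                by (rule nat_pow_cong[OF yc y(3)]) (simp add: cong_def)
              finally have "\<xi> \<in> U" unfolding U_def using p0 by auto
              then show False using x by blast
            qed
          qed
        qed (use psubset.prems in auto)
        moreover have "finprod A (w y) (U \<union> (E - U)) = finprod A (w y) U \<otimes>\<^bsub>A\<^esub> finprod A (w y) (E - U)"
        proof (rule A.finprod_Un_disjoint)
          have "w y \<in> E \<rightarrow> carrier A" using wP[OF yc] psubset.prems(1) by auto
          then show "w y \<in> U \<rightarrow> carrier A" "w y \<in> E - U \<rightarrow> carrier A" using UE by auto
        qed (use psubset.hyps finite_subset[OF UE] in auto)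
        moreover have "U \<union> (E - U) = E" using UE by blast
        ultimately show ?thesis using fU by simp
      qed (use A.finprod_empty in simp)
    qed
    have invF: "(\<lambda>\<omega>. y <# \<omega>) ` (?O - F) \<subseteq> ?O - F"
    proof (intro image_subsetI DiffI)
      fix \<omega> assume "\<omega> \<in> ?O - F"
      then show "y <# \<omega> \<in> ?O" using aO yc by blast
      show "y <# \<omega> \<notin> F"
        using \<open>\<omega> \<in> ?O - F\<close> act(3)[OF yc] aO[OF yc] by (auto simp: F_def dest: inj_onD)
    qed
    \<comment> \<open>A fixed coset contributes a conjugate of y inside P. It is a power of y
      because P is cyclic, and then equal to y because |G| is coprime to p - 1.\<close>
    have fixd: "w y \<omega> = y" if w: "\<omega> \<in> F" for \<omega>
    proof -
      have wO: "\<omega> \<in> ?O" "y <# \<omega> = \<omega>" using w by (auto simp: F_def)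
      define t where "t = \<kappa> \<omega>"
      have t: "t \<in> carrier G" "w y \<omega> = inv t \<otimes> y \<otimes> t" using \<kappa>(2)[OF wO(1)] wO by (auto simp: t_def w_def)
      have "(inv t \<otimes> y \<otimes> t) [^] p = \<one>" using conj_nat_pow[OF yc t(1), of p] y(3) t(1) by simp
      moreover have "inv t \<otimes> y \<otimes> t \<in> P" using wP[OF yc wO(1)] t by simp
      moreover obtain i :: nat where "y = a [^] i" using a y by blast
      moreover obtain j :: nat where "inv t \<otimes> y \<otimes> t = a [^] j" using a calculation(2) by blast
      ultimately obtain k :: nat where "inv t \<otimes> y \<otimes> t = y [^] k"
        using cyclic_p_group_unique_prime_order[OF assms(1,2) ac oa] y(2,3) by metis
      then show ?thesis using power_conj_trivial[OF assms(1,2) yc y(3,2) t(1) _ co] t(2) by simp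
    qed
    have "V y = finprod A (w y) (F \<union> (?O - F))" unfolding V_def by (rule arg_cong[where f = "finprod A (w y)"]) (auto simp: F_def)
    also have "\<dots> = finprod A (w y) F \<otimes>\<^bsub>A\<^esub> finprod A (w y) (?O - F)"
      by (rule A.finprod_Un_disjoint) (use act(1) wP yc in \<open>auto simp: F_def\<close>)
    also have "finprod A (w y) (?O - F) = \<one>" using act(1) invF by (intro free) auto
    also have "finprod A (w y) F = finprod A (\<lambda>_. y) F" using fixd y(1) by (intro A.finprod_cong') auto
    also have "\<dots> = y [^] card F" using A.finprod_const[of y F] y(1) by (simp add: Apow)
    finally have "V y = y [^] card F" using yc by simp
    then show ?thesis using pF pow_eq_id[OF yc] oy by simp
  qed
  define N where "N = kernel G A V"
  have N: "N \<lhd> G" unfolding N_def by (rule V.normal_kernel)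
  have Nmem: "x \<in> N \<longleftrightarrow> x \<in> carrier G \<and> V x = \<one>" for x by (simp only: N_def kernel_def mem_Collect_eq Am)
  interpret N: subgroup N G by (rule normal_imp_subgroup[OF N])
  \<comment> \<open>A nontrivial element of N \<inter> P would have a power of order p, which V does
    not kill.\<close>
  have NP: "N \<inter> P = {\<one>}"
  proof (rule ccontr)
    assume "N \<inter> P \<noteq> {\<one>}"
    then obtain x where x: "x \<in> N" "x \<in> P" "x \<noteq> \<one>" using N.one_closed P.one_closed by blast
    then have "x [^] (p ^ n) = \<one>" using pow_card_subgroup[OF assms(1,3)] assms(4) by metis
    then obtain k where k: "x [^] (p ^ k) \<noteq> \<one>" "(x [^] (p ^ k)) [^] p = \<one>"
      using p_element_prime_order_power x P.mem_carrier by metis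
    have "x [^] (p ^ k) \<in> P" "x [^] (p ^ k) \<in> N"
      using subgroup_nat_pow_closed x assms(3) N.subgroup_axioms by auto
    then show False using Vne k Nmem by blast
  qed
  have injV: "inj_on V P"
  proof (rule inj_onI)
    fix x y assume xy: "x \<in> P" "y \<in> P" "V x = V y"
    have c: "x \<in> carrier G" "y \<in> carrier G" using xy P.mem_carrier by auto
    have "V (x \<otimes> inv y) = \<one>" using xy c V.hom_closed by (simp add: A.r_inv[simplified] del: Am(1)) 
    then have "x \<otimes> inv y \<in> N \<inter> P" using xy c Nmem by simp
    then have "x \<otimes> inv y = \<one>" using NP by blast
    then show "x = y" using c by (metis inv_closed inv_equality inv_inv)
  qed
  have finP: "finite P" using subgroup_card_pos assms(1,3) by blast
  have VP: "V ` P = P" using injV finP V.hom_closed P.mem_carrier by (intro endo_inj_surj) auto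
  have "carrier G \<subseteq> N <#> P"
  proof
    fix x assume x: "x \<in> carrier G"
    then have "V x \<in> V ` P" using VP V.hom_closed by auto
    then obtain y where y: "y \<in> P" "V x = V y" by auto
    have c: "y \<in> carrier G" using y P.mem_carrier by auto
    have "V (x \<otimes> inv y) = \<one>" using y c x V.hom_closed by (simp add: A.r_inv[simplified] del: Am(1))
    then have "x \<otimes> inv y \<in> N" using c x Nmem by simp
    moreover have "x = (x \<otimes> inv y) \<otimes> y" using c x by (simp add: m_assoc)
    ultimately show "x \<in> N <#> P" using y unfolding set_mult_def by blast
  qed
  then have "N <#> P = carrier G" using set_mult_closed[OF N.subset P.subset] by blast
  then have "order G = card N * p ^ n"
    using card_set_mult[OF assms(1) N.subgroup_axioms assms(3)] NP assms(4) by (simp add: order_def)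
  then have "m * p ^ n = card N * p ^ n" using assms(5) by (simp only: mult.commute)
  then have "card N = m" using p0 by simp
  then show thesis using N that by blast
qed

section \<open>Normal complements from normal subgroups of index p: a special case of Tate's
  theorem\<close>

lemma set_mult_eq_carrier:
  assumes "finite (carrier G)" "subgroup K G" "subgroup P G" "subgroup (K <#> P) G"
    and "order G = card P * m" "m dvd card K" "coprime (card P) m"
  shows "K <#> P = carrier G"
proof -
  have "card P dvd card (K <#> P)" "card K dvd card (K <#> P)"
    using card_subgroup_dvd[OF assms(3,4)] card_subgroup_dvd[OF assms(2,4)] set_mult_upper[OF assms(2,3)] by auto
  then have "order G dvd card (K <#> P)" using assms(5,6,7) by (metis divides_mult dvd_trans)
  then have "order G \<le> card (K <#> P)" using subgroup_card_pos(1)[OF assms(1,4)] by (rule_tac dvd_imp_le)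
  then show ?thesis unfolding order_def
    by (rule_tac card_seteq[OF assms(1) subgroup.subset[OF assms(4)]])
qed

text \<open>
  Let \<open>K\<close> be the smallest normal subgroup of \<open>p\<close>-power index and \<open>D = K \<inter> P\<close>; the hypothesis puts
  \<open>D\<close> into the Frattini subgroup of \<open>P\<close>. If \<open>D \<noteq> 1\<close>, take \<open>L < D\<close> with \<open>D/L\<close> central in \<open>P/L\<close>.
  Averaging over the cosets of \<open>P\<close> (Gaschuetz) lifts \<open>G \<rightarrow> G/K = P/D\<close> to a homomorphism into
  \<open>P/L\<close>, which is onto because \<open>D\<close> is in the Frattini subgroup; its kernel would be smaller than \<open>K\<close>.
\<close>

lemma frattini_normal_complement:
  assumes "finite (carrier G)" "Factorial_Ring.prime p" "subgroup P G" "card P = p ^ n"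
    and "order G = p ^ n * m" "\<not> p dvd m"
    and hyp: "\<And>Q. subgroup Q G \<Longrightarrow> Q \<subseteq> P \<Longrightarrow> card P = p * card Q \<Longrightarrow>
      \<exists>S. S \<lhd> G \<and> Q \<subseteq> S \<and> order G = p * card S"
  obtains N where "N \<lhd> G" "card N = m"
proof -
  interpret P: subgroup P G by fact
  have p: "p > 1" using assms(2) prime_gt_1_nat by blast
  have pnm: "coprime (p ^ n) m"
    using assms(2,6) prime_imp_coprime coprime_power_left_iff by blast
  have finP: "finite P" using subgroup_card_pos assms(1,3) by blast
  \<comment> \<open>Since |G| = p^n m, divisibility of |K| by m says that the index of K is a power
    of p.\<close>
  define F where "F = {K. K \<lhd> G \<and> m dvd card K}"
  have "carrier G \<in> F" using assms(5) normal_self by (simp add: F_def order_def[symmetric])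
  then obtain K where K: "K \<in> F" and Kmin: "\<And>N. N \<in> F \<Longrightarrow> card K \<le> card N"
    using ex_has_least_nat[of "\<lambda>K. K \<in> F" _ card] by blast
  have Kn: "K \<lhd> G" "m dvd card K" using K by (auto simp: F_def)
  have Ks: "subgroup K G" using Kn normal_imp_subgroup by blast
  interpret K: subgroup K G by fact
  have Kc: "g \<otimes> k \<otimes> inv g \<in> K" if "g \<in> carrier G" "k \<in> K" for g k
    using Kn(1) that by (simp add: normal_inv_iff)
  have FG: "N <#> P = carrier G" if "N \<in> F" for N
  proof (rule set_mult_eq_carrier)
    show "subgroup (N <#> P) G" using that assms(3) mult_norm_subgroup by (auto simp: F_def)
  qed (use that assms pnm normal_imp_subgroup in \<open>auto simp: F_def\<close>)
  have KP: "K <#> P = carrier G" using FG K by blast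
  define D where "D = K \<inter> P"
  have D: "subgroup D G" unfolding D_def using Ks assms(3) by (rule subgroups_Inter_pair)
  interpret D: subgroup D G by fact
  have finD: "finite D" using finP by (simp add: D_def)
  have "card D dvd p ^ n" using card_subgroup_dvd[OF D assms(3)] assms(4) by (auto simp: D_def)
  then obtain k where k: "card D = p ^ k" using assms(2) divides_primepow_nat by blast
  \<comment> \<open>K \<inter> S is again normal of p-power index, so K lies in S by minimality. As
    S has index p it does not contain P; hence S \<inter> P = Q, and D lies in Q.\<close>
  have DQ: "D \<subseteq> Q" if Q: "subgroup Q G" "Q \<subseteq> P" "card P = p * card Q" for Q
  proof -
    obtain S where S: "S \<lhd> G" "Q \<subseteq> S" "order G = p * card S" using hyp[OF Q] by blast
    have Ss: "subgroup S G" using S normal_imp_subgroup by blast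
    have n0: "n \<noteq> 0"
    proof
      assume "n = 0" then have "p * card Q = 1" using Q(3) assms(4) by simp
      then show False using p by simp
    qed
    have KS: "K \<inter> S \<lhd> G" using Kn(1) S(1) by (rule normal_subgroup_intersect)
    have KSm: "subgroup (K <#> S) G" using Kn(1) Ss by (rule mult_norm_subgroup)
    have e: "card (K <#> S) * card (K \<inter> S) = card K * card S" by (rule card_set_mult[OF assms(1) Ks Ss])
    have "p * (p ^ (n - 1) * m) = p * card S" using S(3) assms(5) n0 by (simp add: power_eq_if mult.assoc)
    then have cS: "card S = p ^ (n - 1) * m" using p by simp
    obtain b where b: "card K = m * b" using Kn(2) by (auto elim: dvdE)
    have "m dvd card (K <#> S)"
      using Kn(2) card_subgroup_dvd[OF Ks KSm set_mult_upper(1)[OF Ks Ss]] dvd_trans by blast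
    then obtain c where c: "card (K <#> S) = m * c" by (auto elim: dvdE)
    have "card (K <#> S) dvd order G" unfolding order_def
      using card_subgroup_dvd[OF KSm subgroup_self] subgroup.subset[OF KSm] by blast
    moreover have m0: "m \<noteq> 0" using assms(6) by (metis dvd_0_right)
    ultimately have "c dvd p ^ n" using c assms(5) by (simp add: mult.commute)
    then have cm: "coprime m c" using pnm coprime_divisors[of c "p ^ n" m m] by (simp add: coprime_commute)
    have "m * (c * card (K \<inter> S)) = m * (b * card S)" using e b c by (simp add: mult.assoc)
    then have "c * card (K \<inter> S) = b * card S" using m0 by simp
    then have "m dvd c * card (K \<inter> S)" using cS by simp
    then have "m dvd card (K \<inter> S)" using cm coprime_dvd_mult_right_iff by blast
    then have "K \<inter> S \<in> F" using KS by (simp add: F_def)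
    then have "card K \<le> card (K \<inter> S)" by (rule Kmin)
    then have "K \<inter> S = K" using subgroup_card_pos(2)[OF assms(1) Ks] by (metis card_seteq inf_le1)
    then have KleS: "K \<subseteq> S" by blast
    have SP: "subgroup (S \<inter> P) G" using Ss assms(3) by (rule subgroups_Inter_pair)
    have "card Q dvd card (S \<inter> P)" using Q S by (intro card_subgroup_dvd SP) auto
    then obtain e where e: "card (S \<inter> P) = card Q * e" by (auto elim: dvdE)
    have "card (S \<inter> P) dvd card P" by (intro card_subgroup_dvd SP assms(3)) auto
    then have "card Q * e dvd card Q * p" using e Q(3) by (simp add: mult.commute)
    then have "e dvd p" using subgroup_card_pos(1)[OF assms(1) Q(1)] by (simp only: nat_mult_dvd_cancel1)
    then have "e = 1 \<or> e = p" using assms(2) by (auto simp: prime_nat_iff)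
    moreover have "e \<noteq> p"
    proof
      assume "e = p"
      then have "card (S \<inter> P) = card P" using e Q(3) by (simp add: mult.commute)
      then have "S \<inter> P = P" using finP by (metis card_subset_eq inf_le2)
      then have "p ^ n dvd p ^ (n - 1) * m"
        using card_subgroup_dvd[OF assms(3) Ss] assms(4) cS by auto
      then have "p ^ (n - 1) * p dvd p ^ (n - 1) * m" using n0 by (metis power_minus_mult not_gr_zero)
      then show False using assms(6) p by simp
    qed
    ultimately have "card Q = card (S \<inter> P)" using e by simp
    then have "Q = S \<inter> P" using finP Q S(2) by (intro card_subset_eq) auto
    then show ?thesis using KleS by (auto simp: D_def)
  qed
  have "D = {\<one>}"
  proof (rule ccontr)
    assume D1: "D \<noteq> {\<one>}"
    have PD: "x \<otimes> d \<otimes> inv x \<in> D" if "x \<in> P" "d \<in> D" for x d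
      using that Kc P.mem_carrier by (auto simp: D_def)
    let ?L = "{Y. subgroup Y G \<and> Y \<subset> D \<and> (\<forall>x\<in>P. \<forall>y\<in>Y. x \<otimes> y \<otimes> inv x \<in> Y)}"
    have "finite ?L" using finD by (rule_tac finite_subset[of _ "Pow D"]) auto
    moreover have "{\<one>} \<in> ?L" using D.one_closed D1 triv_subgroup P.mem_carrier by auto
    ultimately obtain L where L0: "L \<in> ?L" and Lm: "\<And>Y. Y \<in> ?L \<Longrightarrow> L \<subseteq> Y \<Longrightarrow> Y = L"
      by (rule obtain_maximal_set) blast
    then have L: "subgroup L G" "L \<subset> D" "\<And>x y. x \<in> P \<Longrightarrow> y \<in> L \<Longrightarrow> x \<otimes> y \<otimes> inv x \<in> L" by simp_all
    interpret L: subgroup L G by fact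
    define C where "C = {z \<in> D. \<forall>x\<in>P. x \<otimes> z \<otimes> inv x \<otimes> inv z \<in> L}"
    have C: "subgroup C G" unfolding C_def
      by (rule central_mod_subgroup) (use assms(1,3) L D in \<open>auto simp: D_def\<close>)
    have LC: "L \<subseteq> C"
    proof
      fix l assume l: "l \<in> L"
      have "x \<otimes> l \<otimes> inv x \<otimes> inv l \<in> L" if "x \<in> P" for x
        using L(3)[OF that l] l by simp
      then show "l \<in> C" using l L(2) by (auto simp: C_def)
    qed
    obtain z0 where "z0 \<in> D - L" "\<And>x. x \<in> P \<Longrightarrow> x \<otimes> z0 \<otimes> inv x \<otimes> inv z0 \<in> L"
      by (rule p_group_central_element_mod[OF assms(1,2,3,4) D k L(1,2)]) (use PD L(3) in auto)
    then have z0: "z0 \<in> C" "z0 \<notin> L" by (auto simp: C_def)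
    \<comment> \<open>C is normalised by P and larger than L, so by maximality of L it cannot be a
      proper subgroup of D.\<close>
    have CD: "C = D"
    proof (rule ccontr)
      assume "C \<noteq> D"
      moreover have "x \<otimes> z \<otimes> inv x \<in> C" if "x \<in> P" "z \<in> C" for x z
      proof -
        have "x \<otimes> z \<otimes> inv x = (x \<otimes> z \<otimes> inv x \<otimes> inv z) \<otimes> z"
          using that P.mem_carrier D.mem_carrier by (simp add: C_def m_assoc)
        moreover have "x \<otimes> z \<otimes> inv x \<otimes> inv z \<in> C" using that LC by (auto simp: C_def)
        ultimately show ?thesis using that(2) C by (metis subgroup.m_closed)
      qed
      ultimately have "C \<in> ?L" using C by (auto simp: C_def)
      then show False using Lm LC z0 by blast
    qed
    have central: "x \<otimes> d \<otimes> inv x \<otimes> inv d \<in> L" if "x \<in> P" "d \<in> D" for x d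
      using that CD by (auto simp: C_def)
    \<comment> \<open>L is known to be normalised by P only, so the quotient is formed inside
      P.\<close>
    define PP where "PP = G\<lparr>carrier := P\<rparr>"
    interpret PP: group PP unfolding PP_def by (rule subgroup_imp_group) fact
    have LP: "L \<subseteq> P" using L(2) by (auto simp: D_def)
    have LPP: "L \<lhd> PP"
      unfolding PP.normal_inv_iff
    proof (intro conjI ballI)
      show "subgroup L PP" unfolding PP_def by (rule subgroup_incl[OF L(1) assms(3) LP])
      show "x \<otimes>\<^bsub>PP\<^esub> h \<otimes>\<^bsub>PP\<^esub> inv\<^bsub>PP\<^esub> x \<in> L" if "x \<in> carrier PP" "h \<in> L" for x h
        using that L(3)[of x h] m_inv_consistent[OF assms(3), of x] by (simp add: PP_def)
    qed
    define B where "B = PP Mod L"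
    interpret B: group B unfolding B_def by (rule normal.factorgroup_is_group[OF LPP])
    define \<pi> where "\<pi> = (\<lambda>x. L #> x)"
    have \<pi>B: "\<pi> x \<in> carrier B" if "x \<in> P" for x
      using that by (auto simp: B_def \<pi>_def carrier_FactGroup PP_def)
    have \<pi>m: "\<pi> (x \<otimes> y) = \<pi> x \<otimes>\<^bsub>B\<^esub> \<pi> y" if "x \<in> P" "y \<in> P" for x y
      using normal.rcos_sum[OF LPP, of x y] that by (simp add: B_def \<pi>_def PP_def)
    have \<pi>surj: "\<exists>x\<in>P. b = \<pi> x" if "b \<in> carrier B" for b
      using that by (auto simp: B_def \<pi>_def carrier_FactGroup PP_def)
    have \<pi>h: "\<pi> \<in> hom PP B" using \<pi>B \<pi>m by (auto simp: hom_def PP_def)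
    then interpret \<pi>: group_hom PP B \<pi> by (simp add: group_hom_def group_hom_axioms_def PP.is_group B.is_group)
    have \<pi>eq: "\<pi> x = \<pi> y \<longleftrightarrow> x \<otimes> inv y \<in> L" if "x \<in> P" "y \<in> P" for x y
      using rcoset_eq_iff[OF L(1)] that P.mem_carrier by (simp add: \<pi>_def)
    have \<pi>one: "\<one>\<^bsub>B\<^esub> = \<pi> \<one>" using \<pi>.hom_one by (simp add: PP_def)
    have \<pi>inv: "inv\<^bsub>B\<^esub> (\<pi> x) = \<pi> (inv x)" if "x \<in> P" for x
      using \<pi>.hom_inv[of x] that m_inv_consistent[OF assms(3) that] by (simp add: PP_def)
    define Z where "Z = \<pi> ` D"
    have DPP: "subgroup D PP" unfolding PP_def by (rule subgroup_incl[OF D assms(3)]) (simp add: D_def)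
    have ZB: "subgroup Z B" unfolding Z_def using DPP by (rule \<pi>.subgroup_img_is_subgroup)
    have "card Z dvd p ^ n"
    proof -
      have "card Z dvd order B" unfolding order_def
        using B.card_subgroup_dvd[OF ZB B.subgroup_self] subgroup.subset[OF ZB] by blast
      also have "order B dvd p ^ n"
      proof -
        have "carrier B = rcosets\<^bsub>PP\<^esub> L" by (simp add: B_def FactGroup_def)
        then have "order B * card L = p ^ n"
          using PP.lagrange[OF normal_imp_subgroup[OF LPP]] assms(4) by (simp add: order_def PP_def)
        then show ?thesis by (metis dvd_triv_left)
      qed
      finally show ?thesis .
    qed
    then have coZ: "coprime m (card Z)" using pnm coprime_divisors[of "card Z" "p ^ n" m m] by (simp add: coprime_commute)
    have Zc: "z \<otimes>\<^bsub>B\<^esub> b = b \<otimes>\<^bsub>B\<^esub> z" if zb: "z \<in> Z" "b \<in> carrier B" for z b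
    proof -
      obtain d where d: "d \<in> D" "z = \<pi> d" using zb(1) by (auto simp: Z_def)
      obtain x where x: "x \<in> P" "b = \<pi> x" using \<pi>surj[OF zb(2)] by blast
      note dx = d x
      have dP: "d \<in> P" using dx by (simp add: D_def)
      have "(x \<otimes> d) \<otimes> inv (d \<otimes> x) = x \<otimes> d \<otimes> inv x \<otimes> inv d"
        using dx dP P.mem_carrier by (simp add: m_assoc inv_mult_group)
      then have "\<pi> (x \<otimes> d) = \<pi> (d \<otimes> x)" using \<pi>eq[of "x \<otimes> d" "d \<otimes> x"] central dx dP by simp
      then show ?thesis using \<pi>m dx dP by simp
    qed
    let ?O = "lcosets P"
    note act = lcoset_action[OF assms(1,3)]
    have cO: "card ?O = m" using l_lagrange[OF assms(1,3)] assms(4,5) p by simp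
    \<comment> \<open>Because KP = G, every coset of P has a representative in K. With this choice
      each cocycle value v(g, \<omega>) is congruent to g modulo K, so two values for the same g
      differ by an element of D.\<close>
    define \<kappa> where "\<kappa> \<omega> = (SOME x. x \<in> K \<and> x \<in> \<omega>)" for \<omega> :: "'a set"
    have \<kappa>: "\<kappa> \<omega> \<in> K" "\<kappa> \<omega> \<in> \<omega>" if w: "\<omega> \<in> ?O" for \<omega>
    proof -
      obtain b where b: "b \<in> carrier G" "\<omega> = b <# P" using w by (auto simp: LCOSETS_def)
      then have "b \<in> K <#> P" using KP by simp
      then obtain x y where xy: "b = x \<otimes> y" "x \<in> K" "y \<in> P" unfolding set_mult_def by blast
      then have "x = b \<otimes> inv y" using P.mem_carrier K.mem_carrier by (simp add: m_assoc)
      then have "x \<in> \<omega>" using xy b by (auto simp: l_coset_def)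
      then have "\<kappa> \<omega> \<in> K \<and> \<kappa> \<omega> \<in> \<omega>" unfolding \<kappa>_def using xy by (intro someI[of "\<lambda>x. x \<in> K \<and> x \<in> \<omega>"]) auto
      then show "\<kappa> \<omega> \<in> K" "\<kappa> \<omega> \<in> \<omega>" by auto
    qed
    have \<kappa>c: "\<kappa> \<omega> \<in> carrier G" if "\<omega> \<in> ?O" for \<omega> using \<kappa>(1)[OF that] K.mem_carrier by auto
    define v where "v g \<omega> = inv (\<kappa> (g <# \<omega>)) \<otimes> g \<otimes> \<kappa> \<omega>" for g \<omega>
    have aO: "g <# \<omega> \<in> ?O" if "g \<in> carrier G" "\<omega> \<in> ?O" for g \<omega> using act(2)[OF that(1)] that(2) by auto
    have vP: "v g \<omega> \<in> P" if g: "g \<in> carrier G" "\<omega> \<in> ?O" for g \<omega>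
    proof -
      have "g \<otimes> \<kappa> \<omega> \<in> g <# \<omega>" using \<kappa>[OF g(2)] by (auto simp: l_coset_def)
      then have "inv (\<kappa> (g <# \<omega>)) \<otimes> (g \<otimes> \<kappa> \<omega>) \<in> P" using act(7)[OF aO[OF g] \<kappa>(2)[OF aO[OF g]]] by blast
      then show ?thesis using g \<kappa>c[OF g(2)] \<kappa>c[OF aO[OF g]] by (simp add: v_def m_assoc)
    qed
    have vK: "v g \<omega> \<otimes> inv g \<in> K" if g: "g \<in> carrier G" "\<omega> \<in> ?O" for g \<omega>
    proof -
      have "v g \<omega> \<otimes> inv g = inv (\<kappa> (g <# \<omega>)) \<otimes> (g \<otimes> \<kappa> \<omega> \<otimes> inv g)"
        using g \<kappa>c[OF g(2)] \<kappa>c[OF aO[OF g]] by (simp add: v_def m_assoc)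
      then show ?thesis using Kc[OF g(1)] \<kappa>(1)[OF g(2)] \<kappa>(1)[OF aO[OF g]] by simp
    qed
    have coc: "v (g \<otimes> h) \<omega> = v g (h <# \<omega>) \<otimes> v h \<omega>" if g: "g \<in> carrier G" "h \<in> carrier G" "\<omega> \<in> ?O" for g h \<omega>
      using g \<kappa>c[OF g(3)] \<kappa>c[OF aO[OF g(2,3)]] \<kappa>c[OF aO[OF g(1) aO[OF g(2,3)]]] act(4)[OF g]
      by (simp add: v_def m_assoc inv_mult_cancel)
    have "P \<in> ?O" using lcos_mult_one[OF P.subset] by (auto simp: LCOSETS_def intro!: bexI[of _ \<one>])
    then obtain \<omega>0 where w0: "\<omega>0 \<in> ?O" by blast
    obtain \<phi> where \<phi>: "\<phi> \<in> hom G B"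
      "\<And>g. g \<in> carrier G \<Longrightarrow> inv\<^bsub>B\<^esub> (\<pi> (v g \<omega>0)) \<otimes>\<^bsub>B\<^esub> \<phi> g \<in> Z"
    proof (rule cocycle_average[of G B ?O \<omega>0 Z "l_coset G" "\<lambda>g \<omega>. \<pi> (v g \<omega>)"])
      show "finite Z" using finD by (simp add: Z_def)
      show "coprime (card ?O) (card Z)" using cO coZ by simp
      show "inv\<^bsub>B\<^esub> (\<pi> (v g \<omega>0)) \<otimes>\<^bsub>B\<^esub> \<pi> (v g \<omega>) \<in> Z" if g: "g \<in> carrier G" "\<omega> \<in> ?O" for g \<omega>
      proof -
        have c: "v g \<omega>0 \<in> P" "v g \<omega> \<in> P" "v g \<omega>0 \<in> carrier G" "v g \<omega> \<in> carrier G"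
          using vP g w0 P.mem_carrier by auto
        have "inv g \<otimes> (inv (v g \<omega>0 \<otimes> inv g) \<otimes> (v g \<omega> \<otimes> inv g)) \<otimes> inv (inv g) \<in> K"
          using vK g w0 by (intro Kc) auto
        moreover have "inv g \<otimes> (inv (v g \<omega>0 \<otimes> inv g) \<otimes> (v g \<omega> \<otimes> inv g)) \<otimes> inv (inv g) = inv (v g \<omega>0) \<otimes> v g \<omega>"
          using g c by (simp add: m_assoc inv_mult_group inv_mult_cancel)
        ultimately have "inv (v g \<omega>0) \<otimes> v g \<omega> \<in> D" using c by (simp add: D_def)
        moreover have "inv\<^bsub>B\<^esub> (\<pi> (v g \<omega>0)) \<otimes>\<^bsub>B\<^esub> \<pi> (v g \<omega>) = \<pi> (inv (v g \<omega>0) \<otimes> v g \<omega>)"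
          using c \<pi>inv \<pi>m by simp
        ultimately show ?thesis by (simp add: Z_def)
      qed
      show "\<And>z b. z \<in> Z \<Longrightarrow> b \<in> carrier B \<Longrightarrow> z \<otimes>\<^bsub>B\<^esub> b = b \<otimes>\<^bsub>B\<^esub> z" by (rule Zc)
    qed (use w0 act(1,2,3) ZB vP \<pi>B coc \<pi>m aO B.is_group is_group in auto)
    interpret \<phi>: group_hom G B \<phi> using \<phi>(1) by (simp add: group_hom_def group_hom_axioms_def B.is_group is_group)
    \<comment> \<open>This is what lifting G -> G/K means: the value at g is the coset of an element
      of P congruent to g modulo K.\<close>
    have star: "\<exists>y\<in>P. y \<otimes> inv g \<in> K \<and> \<phi> g = \<pi> y" if g: "g \<in> carrier G" for g
    proof -
      obtain d where d: "d \<in> D" "inv\<^bsub>B\<^esub> (\<pi> (v g \<omega>0)) \<otimes>\<^bsub>B\<^esub> \<phi> g = \<pi> d" using \<phi>(2)[OF g] by (auto simp: Z_def)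
      have vv: "v g \<omega>0 \<in> P" "v g \<omega>0 \<in> carrier G" using vP[OF g w0] P.mem_carrier by auto
      have dd: "d \<in> P" "d \<in> K" "d \<in> carrier G" using d P.mem_carrier by (auto simp: D_def)
      have "\<pi> (v g \<omega>0) \<otimes>\<^bsub>B\<^esub> (inv\<^bsub>B\<^esub> (\<pi> (v g \<omega>0)) \<otimes>\<^bsub>B\<^esub> \<phi> g) = \<phi> g"
        using B.inv_mult_cancel(1)[OF \<pi>B[OF vv(1)] \<phi>.hom_closed[OF g]] .
      then have 1: "\<phi> g = \<pi> (v g \<omega>0 \<otimes> d)" unfolding d(2) using \<pi>m vv dd by simp
      have "v g \<omega>0 \<otimes> d \<otimes> inv g = (v g \<omega>0 \<otimes> inv g) \<otimes> (g \<otimes> d \<otimes> inv g)"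
        using g vv dd by (simp add: m_assoc inv_mult_cancel)
      then have "v g \<omega>0 \<otimes> d \<otimes> inv g \<in> K" using vK[OF g w0] Kc[OF g dd(2)] by simp
      then show ?thesis using 1 vv dd by blast
    qed
    define N where "N = kernel G B \<phi>"
    have Nmem: "x \<in> N \<longleftrightarrow> x \<in> carrier G \<and> \<phi> x = \<pi> \<one>" for x by (simp only: N_def kernel_def mem_Collect_eq \<pi>one)
    have N: "N \<lhd> G" unfolding N_def by (rule \<phi>.normal_kernel)
    have Ns: "subgroup N G" using N normal_imp_subgroup by blast
    have LK: "L \<subseteq> K" using L(2) by (auto simp: D_def)
    have NK: "N \<subseteq> K"
    proof
      fix x assume x: "x \<in> N"
      then have xc: "x \<in> carrier G" "\<phi> x = \<pi> \<one>" using Nmem by auto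
      then obtain y where y: "y \<in> P" "y \<otimes> inv x \<in> K" "\<phi> x = \<pi> y" using star by blast
      then have "y \<otimes> inv \<one> \<in> L" using \<pi>eq[of y \<one>] xc by simp
      then have yK: "y \<in> K" using LK y P.mem_carrier by auto
      have "x = inv (y \<otimes> inv x) \<otimes> y" using xc y P.mem_carrier by (simp add: inv_mult_group m_assoc)
      then show "x \<in> K" using y(2) yK by (metis K.m_closed K.m_inv_closed)
    qed
    \<comment> \<open>U is the preimage of \<phi>(P) in P, and by \<open>star\<close> each y in P is
      congruent modulo D to an element of U. A proper U would lie in some Q of index p in P; Q also
      contains D, so it would contain all of P.\<close>
    define U where "U = {x \<in> P. \<pi> x \<in> \<phi> ` P}"
    have U: "subgroup U G"
    proof (rule finite_subgroupI)
      have "\<phi> \<one> = \<pi> \<one>" using \<phi>.hom_one \<pi>one by simp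
      then have "\<pi> \<one> \<in> \<phi> ` P" using P.one_closed by (metis imageI)
      then show "\<one> \<in> U" using P.one_closed by (simp add: U_def)
      fix x y assume xy: "x \<in> U" "y \<in> U"
      then obtain a b where ab: "a \<in> P" "b \<in> P" "\<pi> x = \<phi> a" "\<pi> y = \<phi> b" "x \<in> P" "y \<in> P" by (auto simp: U_def)
      then have "\<pi> (x \<otimes> y) = \<phi> (a \<otimes> b)" using \<pi>m P.mem_carrier by simp
      moreover have "a \<otimes> b \<in> P" "x \<otimes> y \<in> P" using ab by simp_all
      ultimately show "x \<otimes> y \<in> U" unfolding U_def by blast
    qed (use assms(1) P.subset in \<open>auto simp: U_def\<close>)
    have UP: "U = P"
    proof (rule ccontr)
      assume "U \<noteq> P"
      then have "U \<subset> P" by (auto simp: U_def)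
      then obtain Q where Q: "subgroup Q G" "U \<subseteq> Q" "Q \<subseteq> P" "card P = p * card Q"
        by (rule p_subgroup_below_index_p[OF assms(1,2,3,4) U])
      have "P \<subseteq> Q"
      proof
        fix y assume y: "y \<in> P"
        then have yc: "y \<in> carrier G" by simp
        obtain y' where y': "y' \<in> P" "y' \<otimes> inv y \<in> K" "\<phi> y = \<pi> y'" using star[OF yc] by blast
        then have "y' \<in> Q" using y Q(2) by (force simp: U_def)
        moreover have "y' \<otimes> inv y \<in> Q" using DQ[OF Q(1,3,4)] y' y by (auto simp: D_def)
        moreover have "y = inv (y' \<otimes> inv y) \<otimes> y'" using y' y P.mem_carrier by (simp add: inv_mult_group m_assoc)
        ultimately show "y \<in> Q" using Q(1) by (metis subgroup.m_closed subgroup.m_inv_closed)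
      qed
      then have "Q = P" using Q by blast
      then have "card P = p * card P" using Q(4) by simp
      then show False using subgroup_card_pos(1)[OF assms(1,3)] p by simp
    qed
    have NP: "N <#> P = carrier G"
    proof
      show "N <#> P \<subseteq> carrier G" using subgroup.subset[OF Ns] P.subset by (rule set_mult_closed)
      show "carrier G \<subseteq> N <#> P"
      proof
        fix g assume g: "g \<in> carrier G"
        then obtain y where y: "y \<in> P" "\<phi> g = \<pi> y" using star by blast
        then have "\<pi> y \<in> \<phi> ` P" using UP by (auto simp: U_def)
        then obtain x where x: "x \<in> P" "\<phi> g = \<phi> x" using y by auto
        have xc: "x \<in> carrier G" using x by simp
        have "\<phi> (g \<otimes> inv x) = \<phi> g \<otimes>\<^bsub>B\<^esub> inv\<^bsub>B\<^esub> \<phi> x" using g xc by simp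
        also have "\<dots> = \<one>\<^bsub>B\<^esub>" unfolding x(2) using xc by (intro B.r_inv \<phi>.hom_closed)
        finally have "g \<otimes> inv x \<in> N" using Nmem g xc \<pi>one by simp
        moreover have "g = (g \<otimes> inv x) \<otimes> x" using g xc by (simp add: m_assoc)
        ultimately show "g \<in> N <#> P" using x unfolding set_mult_def by blast
      qed
    qed
    have "p ^ n * (m * card (N \<inter> P)) = p ^ n * card N"
      using card_set_mult[OF assms(1) Ns assms(3)] assms(4,5) NP by (simp add: order_def[symmetric] ac_simps)
    then have "m * card (N \<inter> P) = card N" using p by simp
    then have "m dvd card N" by (metis dvd_triv_left)
    then have "N \<in> F" using N by (simp add: F_def)
    then have "card K \<le> card N" by (rule Kmin)
    then have "N = K" using NK subgroup_card_pos(2)[OF assms(1) Ks] by (metis card_seteq)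
    \<comment> \<open>The coset of d is \<phi>(y) with y in P. Congruence modulo K puts y into K =
      N, the kernel of \<phi>, so d would lie in L.\<close>
    obtain d where d: "d \<in> D" "d \<notin> L" using L(2) by blast
    then have dP: "d \<in> P" "d \<in> K" by (auto simp: D_def)
    then have "\<pi> d \<in> \<phi> ` P" using UP by (auto simp: U_def)
    then obtain y where y: "y \<in> P" "\<pi> d = \<phi> y" by auto
    have yc: "y \<in> carrier G" using y by simp
    then obtain y' where y': "y' \<in> P" "y' \<otimes> inv y \<in> K" "\<phi> y = \<pi> y'" using star by blast
    have "y' \<otimes> inv d \<in> L" using \<pi>eq[OF y'(1) dP(1)] y y' by simp
    then have "y' \<otimes> inv d \<in> K" using LK by blast
    then have "(y' \<otimes> inv d) \<otimes> d \<in> K" using dP by blast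
    then have "y' \<in> K" using y' dP P.mem_carrier by (simp add: m_assoc)
    moreover have "y = inv (y' \<otimes> inv y) \<otimes> y'" using y' y P.mem_carrier by (simp add: inv_mult_group m_assoc)
    ultimately have "y \<in> K" using y'(2) by (metis K.m_closed K.m_inv_closed)
    then have "\<phi> y = \<pi> \<one>" using \<open>N = K\<close> Nmem by blast
    then have "d \<otimes> inv \<one> \<in> L" using \<pi>eq[OF dP(1) P.one_closed] y by simp
    then show False using d dP P.mem_carrier by simp
  qed
  then have "p ^ n * m = p ^ n * card K"
    using card_set_mult[OF assms(1) Ks assms(3)] assms(4,5) KP by (simp add: order_def[symmetric] D_def ac_simps)
  then have "card K = m" using p by simp
  then show thesis using Kn that by blast
qed

end

text \<open>The form in which the hypothesis on sylowizers is exploited. It mentions only one Sylow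
  subgroup and orders of subgroups, so it can be restricted to a normal subgroup containing
  P.\<close>

definition prime_index_property :: "('a, 'b) monoid_scheme \<Rightarrow> nat \<Rightarrow> 'a set \<Rightarrow> bool" where
  "prime_index_property G p P \<longleftrightarrow> cyclic_group (G\<lparr>carrier := P\<rparr>) \<or>
     (\<forall>Q. subgroup Q G \<and> Q \<subseteq> P \<and> card P = p * card Q \<longrightarrow>
        (\<exists>S. subgroup S G \<and> Q \<subseteq> S \<and> order G = p * card S))"

definition sylow_subgroup :: "('a, 'b) monoid_scheme \<Rightarrow> nat \<Rightarrow> 'a set \<Rightarrow> bool" where
  "sylow_subgroup G p P \<longleftrightarrow> subgroup P G \<and>
     (\<exists>n m. card P = p ^ n \<and> order G = p ^ n * m \<and> \<not> p dvd m)"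

section \<open>The Sylow tower\<close>

context group
begin

lemma cyclic_subgroup_nat_generator:
  assumes "finite (carrier G)" "subgroup P G" "cyclic_group (G\<lparr>carrier := P\<rparr>)"
  obtains a where "a \<in> P" "\<And>x. x \<in> P \<Longrightarrow> \<exists>k::nat. x = a [^] k"
proof -
  interpret P: group "G\<lparr>carrier := P\<rparr>" by (rule subgroup_imp_group) fact
  have fin: "finite (carrier (G\<lparr>carrier := P\<rparr>))" using subgroup_card_pos assms by simp
  obtain a where a: "a \<in> P" "P = range (\<lambda>n::int. a [^]\<^bsub>G\<lparr>carrier := P\<rparr>\<^esub> n)"
    using assms(3) P.cyclic_group by auto
  have "generate (G\<lparr>carrier := P\<rparr>) {a} = P"
    using P.generate_pow[of a] a by auto
  then have "P = {a [^]\<^bsub>G\<lparr>carrier := P\<rparr>\<^esub> k | k. k \<in> (UNIV :: nat set)}"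
    using P.generate_pow_on_finite_carrier[OF fin, of a] a(1) by simp
  then have "\<exists>k::nat. x = a [^]\<^bsub>G\<lparr>carrier := P\<rparr>\<^esub> k" if "x \<in> P" for x using that by auto
  then have "\<exists>k::nat. x = a [^] k" if "x \<in> P" for x
    using that nat_pow_consistent by metis
  then show thesis using that a(1) by blast
qed

text \<open>Minimality of p enters both cases. All primes dividing p - 1 are smaller than p, so |G|
  is coprime to p - 1 and the transfer result applies to a cyclic P; and subgroups of index p are
  normal, as the other criterion demands.\<close>

lemma smallest_prime_complement:
  assumes "finite (carrier G)" "Factorial_Ring.prime p" "subgroup P G" "card P = p ^ n"
    and "order G = p ^ n * m" "\<not> p dvd m"
    and small: "\<And>r. Factorial_Ring.prime r \<Longrightarrow> r dvd order G \<Longrightarrow> p \<le> r"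
    and "prime_index_property G p P"
  obtains N where "N \<lhd> G" "card N = m"
proof (cases "cyclic_group (G\<lparr>carrier := P\<rparr>)")
  case True
  obtain a where a: "a \<in> P" "\<And>x. x \<in> P \<Longrightarrow> \<exists>k::nat. x = a [^] k"
    by (rule cyclic_subgroup_nat_generator[OF assms(1,3) True]) blast
  have "coprime (order G) (p - 1)"
  proof (rule ccontr)
    assume "\<not> coprime (order G) (p - 1)"
    then have "gcd (order G) (p - 1) \<noteq> 1" by (simp add: coprime_iff_gcd_eq_1)
    then obtain r where r: "Factorial_Ring.prime r" "r dvd gcd (order G) (p - 1)"
      using prime_factor_nat by blast
    then have "p \<le> r" using small by simp
    moreover have "r \<le> p - 1" using r prime_gt_1_nat[OF assms(2)] by (intro dvd_imp_le) auto
    ultimately show False using prime_gt_1_nat[OF assms(2)] by simp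
  qed
  then show ?thesis using cyclic_sylow_normal_complement[OF assms(1-6) a] that by blast
next
  case False
  show ?thesis
  proof (rule frattini_normal_complement[OF assms(1-6)])
    fix Q assume Q: "subgroup Q G" "Q \<subseteq> P" "card P = p * card Q"
    then obtain S where S: "subgroup S G" "Q \<subseteq> S" "order G = p * card S"
      using assms(8) False unfolding prime_index_property_def by blast
    have "S \<lhd> G" by (rule smallest_prime_index_normal[OF assms(1) S(1) assms(2) S(3) small])
    then show "\<exists>S. S \<lhd> G \<and> Q \<subseteq> S \<and> order G = p * card S" using S by blast
  qed (rule that)
qed

text \<open>The index of N in NU divides both |U| and the index of N in G.\<close>

lemma normal_coprime_index_contains:
  assumes "finite (carrier G)" "N \<lhd> G" "subgroup U G" "order G = card N * i" "coprime (card U) i"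
  shows "U \<subseteq> N"
proof -
  have N: "subgroup N G" using assms(2) normal_imp_subgroup by blast
  have W: "subgroup (N <#> U) G" using assms(2,3) by (rule mult_norm_subgroup)
  have pos: "card N > 0" "card (N \<inter> U) > 0"
    using subgroup_card_pos(1)[OF assms(1)] N subgroups_Inter_pair[OF N assms(3)] by blast+
  have "card N dvd card (N <#> U)" using card_subgroup_dvd[OF N W set_mult_upper(1)[OF N assms(3)]] .
  then obtain e where e: "card (N <#> U) = card N * e" by (auto elim: dvdE)
  have "card (N <#> U) dvd order G" unfolding order_def
    using card_subgroup_dvd[OF W subgroup_self] subgroup.subset[OF W] by blast
  then have ei: "e dvd i" using e assms(4) pos by simp
  have "card N * (e * card (N \<inter> U)) = card N * card U"
    using card_set_mult[OF assms(1) N assms(3)] e by (simp add: mult.assoc)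
  then have eU: "e * card (N \<inter> U) = card U" using pos by simp
  then have "e dvd card U" by (metis dvd_triv_left)
  then have "e = 1" using ei assms(5) by (metis coprime_common_divisor nat_dvd_1_iff_1 is_unit_gcd)
  then have "N \<inter> U = U" using eU subgroup_card_pos(2)[OF assms(1,3)] by (simp add: card_subset_eq)
  then show ?thesis by blast
qed

lemma coprime_if_primes_disjoint:
  assumes "(a::nat) \<noteq> 0" "\<And>r. Factorial_Ring.prime r \<Longrightarrow> r dvd a \<Longrightarrow> r dvd b \<Longrightarrow> False"
  shows "coprime a b"
proof (rule ccontr)
  assume "\<not> coprime a b"
  then have "gcd a b \<noteq> 1" by (simp add: coprime_iff_gcd_eq_1)
  then obtain r where "Factorial_Ring.prime r" "r dvd gcd a b" using prime_factor_nat by blast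
  then show False using assms(2) by auto
qed

lemma prime_index_not_sylow:
  assumes "finite (carrier G)" "Factorial_Ring.prime p" "subgroup P G" "card P = p ^ n" "order G = p ^ n * m" "\<not> p dvd m"
    and "subgroup S G" "order G = p * card S"
  shows "\<not> P \<subseteq> S"
proof
  assume "P \<subseteq> S"
  then have "p ^ n dvd card S" using card_subgroup_dvd[OF assms(3,7)] assms(4) by simp
  then obtain b where "card S = p ^ n * b" by (auto elim: dvdE)
  then have "p ^ n * m = p ^ n * (p * b)" using assms(5,8) by (metis mult.left_commute)
  then have "m = p * b" using prime_gt_0_nat[OF assms(2)] by auto
  then show False using assms(6) by simp
qed

text \<open>The index |KS : S| divides p, differs from 1, and equals |K : K \<inter> S|.\<close>

lemma normal_inter_prime_index:
  assumes "finite (carrier G)" "Factorial_Ring.prime p" "K \<lhd> G" "subgroup S G" "order G = p * card S" "\<not> K \<subseteq> S"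
  shows "card K = p * card (K \<inter> S)"
proof -
  have K: "subgroup K G" using assms(3) normal_imp_subgroup by blast
  have W: "subgroup (K <#> S) G" using assms(3,4) by (rule mult_norm_subgroup)
  have Sp: "card S > 0" using subgroup_card_pos(1) assms by blast
  have "card S dvd card (K <#> S)" using card_subgroup_dvd[OF assms(4) W set_mult_upper(2)[OF K assms(4)]] .
  then obtain f where f: "card (K <#> S) = card S * f" by (auto elim: dvdE)
  have "card (K <#> S) dvd order G" unfolding order_def
    using card_subgroup_dvd[OF W subgroup_self] subgroup.subset[OF W] by blast
  then have "f dvd p" using f assms(5) Sp by (simp add: mult.commute)
  moreover have "f \<noteq> 1"
  proof
    assume "f = 1"
    then have "S = K <#> S" using f set_mult_upper(2)[OF K assms(4)] subgroup_card_pos(2)[OF assms(1) W]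
      by (simp add: card_subset_eq)
    then show False using assms(6) set_mult_upper(1)[OF K assms(4)] by simp
  qed
  ultimately have "f = p" using assms(2) by (auto simp: prime_nat_iff)
  then have "card S * (p * card (K \<inter> S)) = card S * card K"
    using card_set_mult[OF assms(1) K assms(4)] f by (simp add: ac_simps)
  then show ?thesis using Sp by simp
qed

text \<open>K is the normal Hall subgroup for the primes from n on, a term of the Sylow tower. If n
  is a prime divisor of |K|, it is the smallest one, and the normal complement in K of a Sylow
  n-subgroup is the next term.\<close>

lemma normal_subgroup_of_large_primes:
  assumes "finite (carrier G)"
    and hyp: "\<And>p. Factorial_Ring.prime p \<Longrightarrow> p dvd order G \<Longrightarrow> \<exists>P. sylow_subgroup G p P \<and> prime_index_property G p P"
  shows "\<exists>K i. K \<lhd> G \<and> order G = card K * i \<and> (\<forall>r. Factorial_Ring.prime r \<longrightarrow> r dvd card K \<longrightarrow> n \<le> r) \<and>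
    (\<forall>r. Factorial_Ring.prime r \<longrightarrow> r dvd i \<longrightarrow> r < (n::nat))"
proof (induction n)
  case 0
  have "carrier G \<lhd> G \<and> order G = card (carrier G) * 1 \<and> (\<forall>r. Factorial_Ring.prime r \<longrightarrow> r dvd card (carrier G) \<longrightarrow> (0::nat) \<le> r) \<and>
    (\<forall>r. Factorial_Ring.prime r \<longrightarrow> r dvd (1::nat) \<longrightarrow> r < 0)" using normal_self by (auto simp: order_def)
  then show ?case by blast
next
  case (Suc n)
  then obtain K i where K: "K \<lhd> G" "order G = card K * i" 
    and Kp: "\<And>r. Factorial_Ring.prime r \<Longrightarrow> r dvd card K \<Longrightarrow> n \<le> r"
    and ip: "\<And>r. Factorial_Ring.prime r \<Longrightarrow> r dvd i \<Longrightarrow> r < n" by blast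
  have Ks: "subgroup K G" using K normal_imp_subgroup by blast
  show ?case
  proof (cases "Factorial_Ring.prime n \<and> n dvd card K")
    case False
    have "Suc n \<le> r" if "Factorial_Ring.prime r" "r dvd card K" for r
      using Kp[OF that] that False by (cases "r = n") auto
    then show ?thesis using K ip less_SucI by blast
  next
    case True
    define p where "p = n"
    have p: "Factorial_Ring.prime p" "p dvd card K" using True by (auto simp: p_def)
    then have "p dvd order G" using K(2) by simp
    then obtain P where P: "sylow_subgroup G p P" "prime_index_property G p P" using hyp[OF p(1)] by blast
    then obtain a m where Pa: "subgroup P G" "card P = p ^ a" "order G = p ^ a * m" "\<not> p dvd m"
      by (auto simp: sylow_subgroup_def)
    have "coprime (p ^ a) i"
    proof (rule coprime_if_primes_disjoint)
      fix r assume r: "Factorial_Ring.prime r" "r dvd p ^ a" "r dvd i"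
      then have "r = p" using p by (metis prime_dvd_power primes_dvd_imp_eq)
      then show False using ip[OF r(1,3)] by (simp add: p_def)
    qed (use p in auto)
    then have PK: "P \<subseteq> K" using normal_coprime_index_contains[OF assms(1) K(1) Pa(1) K(2)] Pa(2) by simp
    define H where "H = G\<lparr>carrier := K\<rparr>"
    interpret H: group H unfolding H_def by (rule subgroup_imp_group) fact
    have finK: "finite K" using subgroup_card_pos assms(1) Ks by blast
    have oH: "order H = card K" by (simp add: order_def H_def)
    have "p ^ a dvd card K" using card_subgroup_dvd[OF Pa(1) Ks PK] Pa(2) by simp
    then obtain m' where m': "card K = p ^ a * m'" by (auto elim: dvdE)
    have "p ^ a * m = p ^ a * (m' * i)" using Pa(3) K(2) m' by (metis mult.assoc)
    then have mm: "m = m' * i" using prime_gt_0_nat[OF p(1)] by auto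
    then have pm': "\<not> p dvd m'" using Pa(4) by (metis dvd_mult2)
    have "prime_index_property H p P"
    proof (cases "cyclic_group (G\<lparr>carrier := P\<rparr>)")
      case False
      \<comment> \<open>The subgroup S of index p in G cannot contain P, hence not K; so K \<inter>
        S has index p in K and inherits the condition.\<close>
      have "\<exists>S. subgroup S H \<and> Q \<subseteq> S \<and> order H = p * card S" if Q: "subgroup Q H" "Q \<subseteq> P" "card P = p * card Q" for Q
      proof -
        have QG: "subgroup Q G" using Q(1) incl_subgroup[OF Ks] by (simp add: H_def)
        then obtain S where S: "subgroup S G" "Q \<subseteq> S" "order G = p * card S"
          using P(2) False Q unfolding prime_index_property_def by blast
        have "\<not> K \<subseteq> S" using prime_index_not_sylow[OF assms(1) p(1) Pa S(1,3)] PK by blast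
        then have "card K = p * card (K \<inter> S)"
          by (rule normal_inter_prime_index[OF assms(1) p(1) K(1) S(1,3)])
        moreover have "subgroup (K \<inter> S) H" unfolding H_def
          by (rule subgroup_incl[OF subgroups_Inter_pair[OF Ks S(1)] Ks]) simp
        ultimately show ?thesis using oH S(2) Q(2) PK by (intro exI[of _ "K \<inter> S"]) auto
      qed
      then show ?thesis by (auto simp: prime_index_property_def)
    qed (simp add: prime_index_property_def H_def)
    moreover have "subgroup P H" unfolding H_def by (rule subgroup_incl[OF Pa(1) Ks PK])
    moreover have "finite (carrier H)" using finK by (simp add: H_def)
    moreover have "p \<le> r" if "Factorial_Ring.prime r" "r dvd order H" for r using Kp that oH p_def by simp
    ultimately obtain L where L: "L \<lhd> H" "card L = m'"
      using H.smallest_prime_complement[of p P a m'] p(1) Pa(2) m' oH pm' by metis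
    have LH: "subgroup L H" using L normal_imp_subgroup by blast
    then have LG: "subgroup L G" using incl_subgroup[OF Ks] by (simp add: H_def)
    have LK: "L \<subseteq> K" using subgroup.subset[OF LH] by (simp add: H_def)
    have Knorm: "g \<otimes> k \<otimes> inv g \<in> K" if "g \<in> carrier G" "k \<in> K" for g k
      using K(1) that by (simp add: normal_inv_iff)
    \<comment> \<open>A conjugate of L lies in K and has order prime to |K : L|, so it lies in L. In
      effect, a normal Hall subgroup of K is characteristic in K.\<close>
    have "L \<lhd> G"
      unfolding normal_inv_iff
    proof (intro conjI ballI LG)
      fix g l assume g: "g \<in> carrier G" "l \<in> L"
      define U where "U = (\<lambda>l. g \<otimes> l \<otimes> inv g) ` L"
      have U: "subgroup U G" "card U = card L" using subgroup_conj_image[OF LG g(1)] by (auto simp: U_def)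
      have "U \<subseteq> K" using LK Knorm g by (auto simp: U_def)
      then have UH: "subgroup U H" unfolding H_def by (rule subgroup_incl[OF U(1) Ks])
      have "coprime m' (p ^ a)"
        using p(1) pm' prime_imp_coprime coprime_commute coprime_power_right_iff by metis
      then have "U \<subseteq> L"
        using H.normal_coprime_index_contains[OF _ L(1) UH, of "p ^ a"] finK U(2) L(2) m' oH
        by (simp add: H_def mult.commute)
      then show "g \<otimes> l \<otimes> inv g \<in> L" using g by (auto simp: U_def)
    qed
    moreover have "order G = card L * (p ^ a * i)" using K(2) m' L(2) by (simp add: ac_simps)
    moreover have "Suc n \<le> r" if r: "Factorial_Ring.prime r" "r dvd card L" for r
    proof -
      have "n \<le> r" using Kp[OF r(1)] r(2) m' L(2) by simp
      moreover have "r \<noteq> n" using r(2) L(2) pm' p_def by auto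
      ultimately show ?thesis by simp
    qed
    moreover have "r < Suc n" if r: "Factorial_Ring.prime r" "r dvd p ^ a * i" for r
    proof (cases "r dvd i")
      case False
      then have "r dvd p ^ a" using r prime_dvd_mult_iff by blast
      then have "r = p" using p r(1) by (metis prime_dvd_power primes_dvd_imp_eq)
      then show ?thesis by (simp add: p_def)
    qed (use ip[OF r(1)] in simp)
    ultimately show ?thesis by blast
  qed
qed

end

section \<open>Chief factors inside a normal Sylow subgroup\<close>

context comm_monoid
begin

lemma finprod_swap:
  assumes "finite S" "finite J" "\<And>s j. s \<in> S \<Longrightarrow> j \<in> J \<Longrightarrow> f s j \<in> carrier G"
  shows "finprod G (\<lambda>s. finprod G (\<lambda>j. f s j) J) S = finprod G (\<lambda>j. finprod G (\<lambda>s. f s j) S) J"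
  using assms(1,3)
proof (induction S rule: finite_induct)
  case empty
  then show ?case by (simp add: finprod_one)
next
  case (insert a S)
  have c: "f s j \<in> carrier G" if "s \<in> insert a S" "j \<in> J" for s j using insert.prems that by blast
  have "finprod G (\<lambda>s. finprod G (\<lambda>j. f s j) J) (insert a S)
    = finprod G (\<lambda>j. f a j) J \<otimes> finprod G (\<lambda>s. finprod G (\<lambda>j. f s j) J) S"
    using insert.hyps c by (intro finprod_insert) (auto intro!: finprod_closed)
  also have "finprod G (\<lambda>s. finprod G (\<lambda>j. f s j) J) S = finprod G (\<lambda>j. finprod G (\<lambda>s. f s j) S) J"
    by (rule insert.IH) (use c in auto)
  also have "finprod G (\<lambda>j. f a j) J \<otimes> finprod G (\<lambda>j. finprod G (\<lambda>s. f s j) S) J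
    = finprod G (\<lambda>j. f a j \<otimes> finprod G (\<lambda>s. f s j) S) J"
    using c by (intro finprod_multf[symmetric]) (auto intro!: finprod_closed)
  also have "\<dots> = finprod G (\<lambda>j. finprod G (\<lambda>s. f s j) (insert a S)) J"
  proof (rule finprod_cong')
    fix j assume j: "j \<in> J"
    show "f a j \<otimes> finprod G (\<lambda>s. f s j) S = finprod G (\<lambda>s. f s j) (insert a S)"
      using insert.hyps c j by (intro finprod_insert[symmetric]) auto
  qed (use c in \<open>auto intro!: finprod_closed\<close>)
  finally show ?case .
qed

lemma finprod_pow_sum:
  assumes "x \<in> carrier G" "finite S"
  shows "finprod G (\<lambda>s. x [^] (e s :: nat)) S = x [^] (\<Sum>s\<in>S. e s)"
  using assms(2)
proof (induction S rule: finite_induct)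
  case (insert a S)
  have "finprod G (\<lambda>s. x [^] e s) (insert a S) = x [^] e a \<otimes> finprod G (\<lambda>s. x [^] e s) S"
    using insert.hyps assms(1) by (intro finprod_insert) auto
  then show ?case using insert assms(1) by (simp add: nat_pow_mult)
qed simp

text \<open>A shift of the index trades F 0 for F n, so the two products agree when F n = F 0. This
  is how an operator of period n acts on a product over its iterates.\<close>

lemma finprod_shift:
  assumes "\<And>j. F j \<in> carrier G"
  shows "finprod G (\<lambda>j. F (Suc j)) {..<n} \<otimes> F 0 = finprod G F {..<n} \<otimes> F n"
proof (induction n)
  case (Suc n)
  have 1: "finprod G (\<lambda>j. F (Suc j)) {..<Suc n} = F (Suc n) \<otimes> finprod G (\<lambda>j. F (Suc j)) {..<n}"
    unfolding lessThan_Suc using assms by (intro finprod_insert) auto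
  have 2: "finprod G F {..<Suc n} = F n \<otimes> finprod G F {..<n}"
    unfolding lessThan_Suc using assms by (intro finprod_insert) auto
  have c: "finprod G (\<lambda>j. F (Suc j)) {..<n} \<in> carrier G" "finprod G F {..<n} \<in> carrier G"
    using assms by auto
  have "finprod G (\<lambda>j. F (Suc j)) {..<Suc n} \<otimes> F 0 = F (Suc n) \<otimes> (finprod G (\<lambda>j. F (Suc j)) {..<n} \<otimes> F 0)"
    unfolding 1 using assms c by (simp add: m_assoc)
  also have "\<dots> = F (Suc n) \<otimes> (finprod G F {..<n} \<otimes> F n)" by (simp only: Suc)
  also have "\<dots> = finprod G F {..<Suc n} \<otimes> F (Suc n)"
    unfolding 2 using assms c by (simp add: m_ac)
  finally show ?case .
qed simp

lemma finprod_nat_pow: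
  assumes "finite S" "\<And>j. j \<in> S \<Longrightarrow> f j \<in> carrier G"
  shows "finprod G f S [^] (k::nat) = finprod G (\<lambda>j. f j [^] k) S"
  using assms
proof (induction S rule: finite_induct)
  case (insert a S)
  have 1: "finprod G f (insert a S) = f a \<otimes> finprod G f S"
    using insert by (intro finprod_insert) auto
  have 2: "finprod G (\<lambda>j. f j [^] k) (insert a S) = f a [^] k \<otimes> finprod G (\<lambda>j. f j [^] k) S"
    using insert by (intro finprod_insert) auto
  show ?case unfolding 1 2 using insert by (simp add: nat_pow_distrib finprod_closed Pi_def)
qed simp

end

lemma finprod_hom:
  assumes "comm_group G" "comm_group H" "h \<in> hom G H" "finite S" "\<And>j. j \<in> S \<Longrightarrow> f j \<in> carrier G"
  shows "h (finprod G f S) = finprod H (\<lambda>j. h (f j)) S"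
proof -
  interpret G: comm_group G by fact
  interpret H: comm_group H by fact
  interpret group_hom G H h using assms by (simp add: group_hom_def group_hom_axioms_def G.is_group H.is_group)
  show ?thesis using assms(4,5)
  proof (induction S rule: finite_induct)
    case (insert a S)
    have 1: "finprod G f (insert a S) = f a \<otimes>\<^bsub>G\<^esub> finprod G f S"
      using insert by (intro G.finprod_insert) auto
    have 2: "finprod H (\<lambda>j. h (f j)) (insert a S) = h (f a) \<otimes>\<^bsub>H\<^esub> finprod H (\<lambda>j. h (f j)) S"
      using insert by (intro H.finprod_insert) auto
    show ?case unfolding 1 2 using insert by (simp add: G.finprod_closed Pi_def)
  qed simp
qed

text \<open>A geometric sum with ratio \<gamma>^j: its product with \<gamma>^j - 1 is 0 modulo q,
  while the ratio is not 1 modulo q because \<gamma> has order q - 1 and 0 < j < q - 1.\<close>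

lemma primroot_power_sum_dvd:
  assumes "Factorial_Ring.prime (q::nat)" "residue_primroot q \<gamma>" "0 < j" "j < q - 1"
  shows "q dvd (\<Sum>s<q-1. (\<gamma> ^ s) ^ j)"
proof -
  have co: "coprime q \<gamma>" "Pocklington.ord q \<gamma> = totient q" using assms(2) by (auto simp: residue_primroot_def)
  have tot: "totient q = q - 1" using assms(1) by (simp add: totient_prime)
  \<comment> \<open>The integers are used so that x - 1 is not truncated.\<close>
  define x where "x = int \<gamma> ^ j"
  have "(x - 1) * (\<Sum>s<q-1. x ^ s) = x ^ (q - 1) - 1"
    by (simp add: power_diff_1_eq)
  moreover have "[\<gamma> ^ (j * (q - 1)) = 1] (mod q)"
    using ord_divides[of \<gamma> "j * (q - 1)" q] co tot by simp
  then have "int q dvd x ^ (q - 1) - 1"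
    unfolding x_def power_mult[symmetric] by (metis cong_iff_dvd_diff cong_int_iff of_nat_1 of_nat_power)
  ultimately have "int q dvd (x - 1) * (\<Sum>s<q-1. x ^ s)" by simp
  moreover have "\<not> int q dvd x - 1"
  proof
    assume "int q dvd x - 1"
    then have "[\<gamma> ^ j = 1] (mod q)"
      unfolding x_def by (metis cong_iff_dvd_diff cong_int_iff of_nat_1 of_nat_power)
    then have "q - 1 dvd j" using ord_divides[of \<gamma> j q] co tot by simp
    then show False using assms(3,4) by (auto dest: dvd_imp_le)
  qed
  ultimately have "int q dvd (\<Sum>s<q-1. x ^ s)"
    using assms(1) by (metis prime_dvd_mult_iff prime_nat_int_transfer)
  also have "(\<Sum>s<q-1. x ^ s) = int (\<Sum>s<q-1. (\<gamma> ^ s) ^ j)"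
    by (simp add: x_def power_mult[symmetric] mult.commute)
  finally show ?thesis by (simp only: of_nat_dvd_iff)
qed

text \<open>A discrete Fourier transform over the \<open>q - 1\<close> nonzero residues produces the eigenvector.\<close>

lemma exponent_automorphism_eigenvector:
  assumes "comm_group A" "Factorial_Ring.prime (q::nat)" "\<And>z. z \<in> carrier A \<Longrightarrow> z [^]\<^bsub>A\<^esub> q = \<one>\<^bsub>A\<^esub>"
    and T: "T \<in> hom A A" "\<And>z. z \<in> carrier A \<Longrightarrow> (T ^^ (q - 1)) z = z"
    and z: "z \<in> carrier A" "z \<noteq> \<one>\<^bsub>A\<^esub>"
  obtains y k where "y \<in> carrier A" "y \<noteq> \<one>\<^bsub>A\<^esub>" "T y = y [^]\<^bsub>A\<^esub> (k::nat)"
proof -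
  interpret comm_group A by fact
  have q1: "q > 1" using assms(2) prime_gt_1_nat by blast
  obtain \<gamma> where \<gamma>: "residue_primroot q \<gamma>" using prime_primitive_root_exists[OF q1 assms(2)] by blast
  have Tc: "T x \<in> carrier A" if "x \<in> carrier A" for x using T(1) that by (auto simp: hom_def)
  define t where "t j = (T ^^ j) z" for j
  have tc: "t j \<in> carrier A" for j unfolding t_def by (induction j) (use z Tc in auto)
  have Tt: "T (t j) = t (Suc j)" for j by (simp add: t_def)
  have Tpow: "T (x [^]\<^bsub>A\<^esub> (k::nat)) = T x [^]\<^bsub>A\<^esub> k" if "x \<in> carrier A" for x k
    using hom_nat_pow[OF T(1) that is_group is_group] by simp
  have pc: "x [^]\<^bsub>A\<^esub> i = x [^]\<^bsub>A\<^esub> j" if "x \<in> carrier A" "[i = j] (mod q)" for x and i j :: nat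
    using nat_pow_cong[OF that(1) assms(3)[OF that(1)] that(2)] .
  \<comment> \<open>In additive notation e(s) is the sum of c^j T^j(z) with c = \<gamma>^s. T shifts
    j by one, which multiplies e(s) by the inverse k of c modulo q; the end terms match because both
    T^(q-1) and c^(q-1) are trivial.\<close>
  define e where "e s = finprod A (\<lambda>j. t j [^]\<^bsub>A\<^esub> ((\<gamma> ^ s) ^ j)) {..<q-1}" for s
  have ec: "e s \<in> carrier A" for s unfolding e_def using tc by (intro finprod_closed) auto
  have eig: "\<exists>k::nat. T (e s) = e s [^]\<^bsub>A\<^esub> k" for s
  proof -
    define c where "c = \<gamma> ^ s"
    have cc: "coprime c q" using \<gamma> by (simp add: c_def residue_primroot_def coprime_commute)
    then obtain k where k: "[c * k = Suc 0] (mod q)" using cong_solve_coprime_nat by blast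
    define F where "F = (\<lambda>j. t j [^]\<^bsub>A\<^esub> (k * c ^ j))"
    have Fc: "F j \<in> carrier A" for j using tc by (simp add: F_def)
    have F1: "T (t j [^]\<^bsub>A\<^esub> (c ^ j)) = F (Suc j)" for j
    proof -
      have "[k * c ^ Suc j = c ^ j] (mod q)"
        using cong_mult[OF k cong_refl[of "c ^ j"]] by (simp add: ac_simps)
      then have "F (Suc j) = t (Suc j) [^]\<^bsub>A\<^esub> (c ^ j)" unfolding F_def using pc tc by blast
      then show ?thesis using Tpow tc Tt by simp
    qed
    have "\<not> q dvd c" using cc assms(2) by (metis coprime_common_divisor dvd_refl not_prime_unit)
    then have "[c ^ (q - 1) = 1] (mod q)" using assms(2) by (rule_tac fermat_theorem)
    then have "[k * c ^ (q - 1) = k * c ^ 0] (mod q)" using cong_mult[OF cong_refl[of k]] by fastforce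
    moreover have "t (q - 1) = t 0" using T(2)[OF z(1)] by (simp add: t_def)
    ultimately have Fq: "F (q - 1) = F 0" unfolding F_def using pc[OF tc] by metis
    have "T (e s) = finprod A (\<lambda>j. F (Suc j)) {..<q-1}"
      unfolding e_def c_def[symmetric] using tc F1 by (subst finprod_hom[OF assms(1,1) T(1)]) auto
    moreover have "e s [^]\<^bsub>A\<^esub> k = finprod A F {..<q-1}"
      unfolding e_def c_def[symmetric]
      using tc by (subst finprod_nat_pow) (auto simp: F_def nat_pow_pow mult.commute)
    moreover have "finprod A (\<lambda>j. F (Suc j)) {..<q-1} = finprod A F {..<q-1}"
    proof -
      have "finprod A (\<lambda>j. F (Suc j)) {..<q-1} \<in> carrier A" "finprod A F {..<q-1} \<in> carrier A"
        using Fc by auto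
      then show ?thesis using finprod_shift[of F "q - 1"] Fc Fq by (metis r_cancel)
    qed
    ultimately show ?thesis by metis
  qed
  \<comment> \<open>In the product of all e(s) the exponent of T^j(z) vanishes modulo q for j > 0
    and is q - 1 for j = 0. If every e(s) were trivial, z^(q-1) would be trivial too, and with z^q =
    1 so would z.\<close>
  have "\<exists>s. e s \<noteq> \<one>\<^bsub>A\<^esub>"
  proof (rule ccontr)
    assume "\<nexists>s. e s \<noteq> \<one>\<^bsub>A\<^esub>"
    then have "\<one>\<^bsub>A\<^esub> = finprod A e {..<q-1}" by (simp add: finprod_one_eqI)
    also have "\<dots> = finprod A (\<lambda>j. finprod A (\<lambda>s. t j [^]\<^bsub>A\<^esub> ((\<gamma> ^ s) ^ j)) {..<q-1}) {..<q-1}"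
      unfolding e_def by (rule finprod_swap) (use tc in auto)
    also have "\<dots> = finprod A (\<lambda>j. if 0 = j then z [^]\<^bsub>A\<^esub> (q - 1) else \<one>\<^bsub>A\<^esub>) {..<q-1}"
    proof (rule finprod_cong')
      fix j assume j: "j \<in> {..<q-1}"
      have s: "finprod A (\<lambda>s. t j [^]\<^bsub>A\<^esub> ((\<gamma> ^ s) ^ j)) {..<q-1} = t j [^]\<^bsub>A\<^esub> (\<Sum>s<q-1. (\<gamma> ^ s) ^ j)"
        by (rule finprod_pow_sum[OF tc]) simp
      show "finprod A (\<lambda>s. t j [^]\<^bsub>A\<^esub> ((\<gamma> ^ s) ^ j)) {..<q-1} = (if 0 = j then z [^]\<^bsub>A\<^esub> (q - 1) else \<one>\<^bsub>A\<^esub>)"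
      proof (cases "j = 0")
        case True
        then show ?thesis unfolding s by (simp add: t_def)
      next
        case False
        then have "[(\<Sum>s<q-1. (\<gamma> ^ s) ^ j) = 0] (mod q)"
          using primroot_power_sum_dvd[OF assms(2) \<gamma>, of j] j by (simp add: cong_0_iff)
        then have "t j [^]\<^bsub>A\<^esub> (\<Sum>s<q-1. (\<gamma> ^ s) ^ j) = \<one>\<^bsub>A\<^esub>" using pc[OF tc] by (metis nat_pow_0)
        then show ?thesis unfolding s using False by simp
      qed
    qed (use z in auto)
    also have "\<dots> = z [^]\<^bsub>A\<^esub> (q - 1)"
      by (rule finprod_singleton[of 0 "{..<q-1}" "\<lambda>_. z [^]\<^bsub>A\<^esub> (q - 1)"]) (use q1 z in auto)
    finally have "z [^]\<^bsub>A\<^esub> (q - 1) = \<one>\<^bsub>A\<^esub>" by simp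
    moreover have "z [^]\<^bsub>A\<^esub> q = z [^]\<^bsub>A\<^esub> (q - 1) \<otimes>\<^bsub>A\<^esub> z" using q1 by (metis Suc_diff_1 nat_pow_Suc less_trans zero_less_one)
    ultimately have "z = \<one>\<^bsub>A\<^esub>" using assms(3)[OF z(1)] z(1) by simp
    then show False using z by simp
  qed
  then show thesis using eig ec that by blast
qed

section \<open>Conjugation on chief factors\<close>

context group
begin

lemma card_image_rcosets:
  assumes "finite (carrier G)" "subgroup M G" "subgroup U G" "M \<subseteq> U"
  shows "card ((\<lambda>x. M #> x) ` U) * card M = card U"
proof -
  interpret U: group "G\<lparr>carrier := U\<rparr>" by (rule subgroup_imp_group) fact
  have "rcosets\<^bsub>G\<lparr>carrier := U\<rparr>\<^esub> M = (\<lambda>x. M #> x) ` U" by (auto simp: RCOSETS_def)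
  then show ?thesis
    using U.lagrange[of M] subgroup_incl[OF assms(2,3,4)] by (simp add: order_def)
qed

lemma prime_order_subgroup_generator:
  assumes "finite (carrier G)" "Factorial_Ring.prime q" "subgroup R G" "card R = q"
  obtains x where "x \<in> R" "x \<noteq> \<one>" "\<And>y. y \<in> R \<Longrightarrow> \<exists>i::nat. y = x [^] i" "generate G {x} = R"
proof -
  interpret R: subgroup R G by fact
  have "\<not> R \<subseteq> {\<one>}"
  proof
    assume "R \<subseteq> {\<one>}"
    then have "card R \<le> 1" using card_mono[of "{\<one>}" R] by simp
    then show False using prime_gt_1_nat[OF assms(2)] assms(4) by simp
  qed
  then obtain x where x: "x \<in> R" "x \<noteq> \<one>" by blast
  have xc: "x \<in> carrier G" using x by simp
  have gR: "generate G {x} \<subseteq> R" by (rule generate_subgroup_incl) (use x assms in auto)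
  have "ord x dvd q" using pow_card_subgroup[OF assms(1,3) x(1)] assms(4) pow_eq_id[OF xc] by simp
  moreover have "ord x \<noteq> 1" using ord_eq_1[OF xc] x by simp
  ultimately have "ord x = q" using assms(2) by (auto simp: prime_nat_iff)
  then have "card (generate G {x}) = card R" using generate_pow_card[OF xc] assms(4) by simp
  then have eq: "generate G {x} = R" using gR subgroup_card_pos(2)[OF assms(1,3)] by (metis card_subset_eq)
  have "\<exists>i::nat. y = x [^] i" if "y \<in> R" for y
    using that generate_pow_on_finite_carrier[OF assms(1) xc] eq by auto
  then show thesis using that x eq by blast
qed

lemma conj_nat_pow':
  assumes "x \<in> carrier G" "t \<in> carrier G"
  shows "t \<otimes> x [^] (k::nat) \<otimes> inv t = (t \<otimes> x \<otimes> inv t) [^] k"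
  using conj_nat_pow[of x "inv t" k] assms by simp

text \<open>Conjugation acts on a group of prime order by power maps y -> y^k. These commute with
  each other, and k^(q-1) = 1 modulo q.\<close>

lemma prime_order_normal_action:
  assumes "finite (carrier G)" "Factorial_Ring.prime q" "R \<lhd> G" "card R = q" "g \<in> carrier G" "y \<in> R"
  shows "h \<in> carrier G \<Longrightarrow> (g \<otimes> h) \<otimes> y \<otimes> inv (g \<otimes> h) = (h \<otimes> g) \<otimes> y \<otimes> inv (h \<otimes> g)"
    and "g [^] (q - 1) \<otimes> y \<otimes> inv (g [^] (q - 1)) = y"
proof -
  have R: "subgroup R G" using assms(3) normal_imp_subgroup by blast
  interpret R: subgroup R G by fact
  have Rc: "g \<otimes> y \<otimes> inv g \<in> R" if "g \<in> carrier G" "y \<in> R" for g y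
    using assms(3) that by (simp add: normal_inv_iff)
  obtain x where x: "x \<in> R" "x \<noteq> \<one>" "\<And>y. y \<in> R \<Longrightarrow> \<exists>i::nat. y = x [^] i"
    using prime_order_subgroup_generator[OF assms(1,2) R assms(4)] by metis
  have xc: "x \<in> carrier G" using x by simp
  have scal: "\<exists>k::nat. \<forall>y\<in>R. g \<otimes> y \<otimes> inv g = y [^] k" if g: "g \<in> carrier G" for g
  proof -
    obtain k :: nat where k: "g \<otimes> x \<otimes> inv g = x [^] k" using x(3) Rc[OF g x(1)] by blast
    have "g \<otimes> y \<otimes> inv g = y [^] k" if y: "y \<in> R" for y
    proof -
      obtain i :: nat where "y = x [^] i" using x(3) y by blast
      then show ?thesis using conj_nat_pow'[OF xc g, of i] k xc by (simp add: nat_pow_pow mult.commute)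
    qed
    then show ?thesis by blast
  qed
  obtain k :: nat where k: "\<And>y. y \<in> R \<Longrightarrow> g \<otimes> y \<otimes> inv g = y [^] k" using scal[OF assms(5)] by blast
  have yc: "y \<in> carrier G" using assms(6) by simp
  have pR: "y [^] (i::nat) \<in> R" if "y \<in> R" for y i using subgroup_nat_pow_closed[OF R that] .
  show "(g \<otimes> h) \<otimes> y \<otimes> inv (g \<otimes> h) = (h \<otimes> g) \<otimes> y \<otimes> inv (h \<otimes> g)" if h: "h \<in> carrier G"
  proof -
    obtain l :: nat where l: "\<And>y. y \<in> R \<Longrightarrow> h \<otimes> y \<otimes> inv h = y [^] l" using scal[OF h] by blast
    have "(g \<otimes> h) \<otimes> y \<otimes> inv (g \<otimes> h) = g \<otimes> (h \<otimes> y \<otimes> inv h) \<otimes> inv g"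
      using assms(5) h yc by (simp add: m_assoc inv_mult_group)
    also have "\<dots> = y [^] (l * k)" using k l pR assms(6) yc by (simp add: nat_pow_pow)
    also have "\<dots> = h \<otimes> (g \<otimes> y \<otimes> inv g) \<otimes> inv h" using k l pR assms(6) yc by (simp add: nat_pow_pow mult.commute)
    also have "\<dots> = (h \<otimes> g) \<otimes> y \<otimes> inv (h \<otimes> g)"
      using assms(5) h yc by (simp add: m_assoc inv_mult_group)
    finally show ?thesis .
  qed
  have it: "g [^] j \<otimes> y \<otimes> inv (g [^] j) = y [^] (k ^ j)" for j :: nat
  proof (induction j)
    case (Suc j)
    have "g [^] Suc j \<otimes> y \<otimes> inv (g [^] Suc j) = g [^] j \<otimes> (g \<otimes> y \<otimes> inv g) \<otimes> inv (g [^] j)"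
      using assms(5) yc by (simp add: m_assoc inv_mult_group)
    also have "\<dots> = (g [^] j \<otimes> y \<otimes> inv (g [^] j)) [^] k" using k[OF assms(6)] conj_nat_pow'[of y "g [^] j" k] yc assms(5) by simp
    finally show ?case using Suc yc by (simp add: nat_pow_pow mult.commute)
  qed (use yc in auto)
  show "g [^] (q - 1) \<otimes> y \<otimes> inv (g [^] (q - 1)) = y"
  proof (cases "y = \<one>")
    case False
    have yq: "y [^] q = \<one>" using pow_card_subgroup[OF assms(1) R assms(6)] assms(4) by simp
    have "\<not> q dvd k"
    proof
      assume "q dvd k"
      then have "[k = 0] (mod q)" by (simp add: cong_0_iff)
      then have "y [^] k = y [^] (0::nat)" by (rule nat_pow_cong[OF yc yq])
      then have "g \<otimes> y \<otimes> inv g = \<one>" using k[OF assms(6)] by simp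
      then have "y = inv g \<otimes> \<one> \<otimes> g" using assms(5) yc by (metis inv_mult_cancel(2) inv_solve_right' m_assoc m_closed inv_closed r_one l_one)
      then show False using False assms(5) by simp
    qed
    then have "[k ^ (q - 1) = 1] (mod q)" using assms(2) by (rule_tac fermat_theorem)
    then have "y [^] (k ^ (q - 1)) = y [^] (1::nat)" by (rule nat_pow_cong[OF yc yq])
    then show ?thesis using it[of "q - 1"] yc by simp
  qed (use assms(5) in simp)
qed

text \<open>This is the previous lemma in G/M for the normal subgroup Q/M of order q. The commutator
  of g and h is written (gh)(hg)^-1 because it comes from comparing the actions of gh and
  hg.\<close>

lemma prime_factor_action:
  assumes "finite (carrier G)" "Factorial_Ring.prime q" "Q \<lhd> G" "M \<lhd> G" "M \<subseteq> Q" "card Q = q * card M"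
    and "g \<in> carrier G" "x \<in> Q"
  shows "h \<in> carrier G \<Longrightarrow> c = (g \<otimes> h) \<otimes> inv (h \<otimes> g) \<Longrightarrow> c \<otimes> x \<otimes> inv c \<otimes> inv x \<in> M"
    and "c = g [^] (q - 1) \<Longrightarrow> c \<otimes> x \<otimes> inv c \<otimes> inv x \<in> M"
proof -
  have Q: "subgroup Q G" and M: "subgroup M G" using assms normal_imp_subgroup by blast+
  interpret Q: subgroup Q G by fact
  define B where "B = G Mod M"
  interpret B: group B unfolding B_def by (rule normal.factorgroup_is_group) fact
  define \<pi> where "\<pi> = (\<lambda>x. M #> x)"
  have ph: "\<pi> \<in> hom G B" unfolding \<pi>_def B_def by (rule normal.r_coset_hom_Mod) fact
  interpret \<pi>: group_hom G B \<pi> using ph by (simp add: group_hom_def group_hom_axioms_def B.is_group is_group)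
  have surj: "\<pi> ` carrier G = carrier B" by (simp add: \<pi>_def B_def carrier_FactGroup)
  have R: "\<pi> ` Q \<lhd> B"
    using normal.surj_hom_normal_subgroup[OF assms(3) \<pi>.group_hom_axioms surj] .
  have cR: "card (\<pi> ` Q) = q"
    using card_image_rcosets[OF assms(1) M Q assms(5)] assms(6) subgroup_card_pos(1)[OF assms(1) M] by (simp add: \<pi>_def)
  have finB: "finite (carrier B)" using surj assms(1) by (metis finite_imageI)
  note act = B.prime_order_normal_action[OF finB assms(2) R cR]
  have eq: "\<pi> a = \<pi> b \<Longrightarrow> a \<otimes> inv b \<in> M" if "a \<in> carrier G" "b \<in> carrier G" for a b
    using rcoset_eq_iff[OF M that] by (simp add: \<pi>_def)
  have xc: "x \<in> carrier G" using assms(8) by simp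
  show "c \<otimes> x \<otimes> inv c \<otimes> inv x \<in> M" if h: "h \<in> carrier G" and c: "c = (g \<otimes> h) \<otimes> inv (h \<otimes> g)"
  proof -
    define a b where "a = g \<otimes> h" and "b = h \<otimes> g"
    have ab: "a \<in> carrier G" "b \<in> carrier G" using h assms(7) by (auto simp: a_def b_def)
    \<comment> \<open>This y is chosen so that b y b^-1 = x and a y a^-1 = c x c^-1.\<close>
    define y where "y = inv b \<otimes> x \<otimes> inv (inv b)"
    have "inv b \<in> carrier G" using ab by simp
    then have y: "y \<in> Q" unfolding y_def using assms(3,8) unfolding normal_inv_iff by blast
    have yc: "y \<in> carrier G" using y by simp
    have "\<pi> g \<otimes>\<^bsub>B\<^esub> \<pi> h \<otimes>\<^bsub>B\<^esub> \<pi> y \<otimes>\<^bsub>B\<^esub> inv\<^bsub>B\<^esub> (\<pi> g \<otimes>\<^bsub>B\<^esub> \<pi> h) = \<pi> h \<otimes>\<^bsub>B\<^esub> \<pi> g \<otimes>\<^bsub>B\<^esub> \<pi> y \<otimes>\<^bsub>B\<^esub> inv\<^bsub>B\<^esub> (\<pi> h \<otimes>\<^bsub>B\<^esub> \<pi> g)"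
      by (rule act(1)) (use assms(7) h y in auto)
    then have "\<pi> (a \<otimes> y \<otimes> inv a) = \<pi> (b \<otimes> y \<otimes> inv b)"
      using assms(7) h yc ab by (simp add: a_def b_def)
    moreover have "b \<otimes> y \<otimes> inv b = x" using ab xc by (simp add: y_def m_assoc inv_mult_cancel)
    moreover have "a \<otimes> y \<otimes> inv a = c \<otimes> x \<otimes> inv c"
      unfolding c y_def a_def[symmetric] b_def[symmetric] using ab xc by (simp add: m_assoc inv_mult_group)
    ultimately show ?thesis using eq[of "c \<otimes> x \<otimes> inv c" x] xc c ab a_def b_def by simp
  qed
  show "c \<otimes> x \<otimes> inv c \<otimes> inv x \<in> M" if c: "c = g [^] (q - 1)"
  proof -
    have cc: "c \<in> carrier G" using c assms(7) by simp
    have "\<pi> g [^]\<^bsub>B\<^esub> (q - 1) \<otimes>\<^bsub>B\<^esub> \<pi> x \<otimes>\<^bsub>B\<^esub> inv\<^bsub>B\<^esub> (\<pi> g [^]\<^bsub>B\<^esub> (q - 1)) = \<pi> x"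
      by (rule act(2)) (use assms(7,8) in auto)
    then have "\<pi> (c \<otimes> x \<otimes> inv c) = \<pi> x" using assms(7) xc cc c by (simp add: \<pi>.hom_nat_pow)
    then show ?thesis using eq[of "c \<otimes> x \<otimes> inv c" x] xc cc by simp
  qed
qed

lemma conj_funpow:
  assumes "t \<in> carrier G" "x \<in> carrier G"
  shows "((\<lambda>y. t \<otimes> y \<otimes> inv t) ^^ k) x = t [^] k \<otimes> x \<otimes> inv (t [^] k)"
proof (induction k)
  case (Suc k)
  have "t [^] Suc k = t \<otimes> t [^] k" using assms(1) by (rule nat_pow_Suc2)
  then show ?case using Suc assms by (simp add: m_assoc inv_mult_group)
qed (use assms in simp)

text \<open>An automorphism of prime order \<open>r \<noteq> q\<close> that fixes every coset of a subgroup of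
  \<open>q\<close>-power order fixes an element of each coset.\<close>

lemma coprime_action_trivial:
  assumes "finite (carrier G)" "Factorial_Ring.prime q" "subgroup Q G" "card Q = q ^ n"
  shows "\<lbrakk>t \<in> carrier G; \<And>x. x \<in> Q \<Longrightarrow> t \<otimes> x \<otimes> inv t \<in> Q;
      \<And>M x. \<lbrakk>subgroup M G; M \<subseteq> Q; card Q = q * card M; x \<in> Q\<rbrakk> \<Longrightarrow> t \<otimes> x \<otimes> inv t \<otimes> inv x \<in> M;
      \<And>x. x \<in> Q \<Longrightarrow> t [^] m \<otimes> x \<otimes> inv (t [^] m) = x; \<not> q dvd m\<rbrakk>
    \<Longrightarrow> \<forall>x\<in>Q. t \<otimes> x \<otimes> inv t = x"
proof (induction m arbitrary: t rule: less_induct)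
  case (less m)
  interpret Q: subgroup Q G by fact
  note t = less.prems(1)
  show ?case
  proof (cases "m = 1")
    case True then show ?thesis using less.prems(4) t by simp
  next
    case False
    then obtain r where r: "Factorial_Ring.prime r" "r dvd m" using prime_factor_nat by blast
    then obtain m' where m': "m = r * m'" by (auto elim: dvdE)
    have m0: "m \<noteq> 0" using less.prems(5) by (metis dvd_0_right)
    have r1: "r > 1" using r prime_gt_1_nat by blast
    have nz: "t [^] k \<otimes> x \<otimes> inv (t [^] k) \<in> Q" if "x \<in> Q" for k :: nat and x
    proof -
      have "((\<lambda>y. t \<otimes> y \<otimes> inv t) ^^ k) x \<in> Q" by (induction k) (use that less.prems(2) in auto)
      then show ?thesis using conj_funpow[OF t, of x k] that by simp
    qed
    have triv: "t [^] k \<otimes> x \<otimes> inv (t [^] k) \<otimes> inv x \<in> M"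
      if M: "subgroup M G" "M \<subseteq> Q" "card Q = q * card M" "x \<in> Q" for k :: nat and x M
    proof (induction k)
      case 0 then show ?case using M subgroup.one_closed by fastforce
    next
      case (Suc k)
      define y where "y = t [^] k \<otimes> x \<otimes> inv (t [^] k)"
      have y: "y \<in> Q" using nz M(4) by (simp add: y_def)
      have c: "x \<in> carrier G" "y \<in> carrier G" using y M(4) by auto
      have "t [^] Suc k = t \<otimes> t [^] k" using t by (rule nat_pow_Suc2)
      then have "t [^] Suc k \<otimes> x \<otimes> inv (t [^] Suc k) \<otimes> inv x = (t \<otimes> y \<otimes> inv t \<otimes> inv y) \<otimes> (y \<otimes> inv x)"
        using t c by (simp add: m_assoc inv_mult_group inv_mult_cancel y_def)
      moreover have "t \<otimes> y \<otimes> inv t \<otimes> inv y \<in> M" using less.prems(3) M y by blast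
      moreover have "y \<otimes> inv x \<in> M" using Suc by (simp add: y_def)
      ultimately show ?case using M(1) by (simp add: subgroup.m_closed)
    qed
    \<comment> \<open>The power t^r satisfies the assumptions with the smaller exponent m / r, so by
      induction t acts on Q with order dividing the prime r.\<close>
    have rt: "\<forall>x\<in>Q. t [^] r \<otimes> x \<otimes> inv (t [^] r) = x"
    proof (rule less.IH)
      show "m' < m" using m' r1 m0 by simp
      show "\<not> q dvd m'" using less.prems(5) m' by (metis dvd_mult)
      show "(t [^] r) [^] m' \<otimes> x \<otimes> inv ((t [^] r) [^] m') = x" if "x \<in> Q" for x
        using less.prems(4)[OF that] t m' by (simp add: nat_pow_pow)
    qed (use nz triv t in auto)
    define C where "C = {x \<in> Q. t \<otimes> x \<otimes> inv t = x}"
    have C: "subgroup C G"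
    proof (rule finite_subgroupI)
      fix x y assume xy: "x \<in> C" "y \<in> C"
      then have "x \<in> carrier G" "y \<in> carrier G" by (auto simp: C_def)
      then have "t \<otimes> (x \<otimes> y) \<otimes> inv t = (t \<otimes> x \<otimes> inv t) \<otimes> (t \<otimes> y \<otimes> inv t)"
        using t by (simp add: m_assoc inv_mult_cancel)
      then show "x \<otimes> y \<in> C" using xy by (simp add: C_def)
    qed (use assms(1) t Q.subset in \<open>auto simp: C_def\<close>)
    show ?thesis
    proof (rule ccontr)
      assume "\<not> (\<forall>x\<in>Q. t \<otimes> x \<otimes> inv t = x)"
      then have "C \<subset> Q" by (auto simp: C_def)
      then obtain M where M: "subgroup M G" "C \<subseteq> M" "M \<subseteq> Q" "card Q = q * card M"
        by (rule p_subgroup_below_index_p[OF assms C])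
      interpret M: subgroup M G by (rule M)
      have finM: "finite M" "card M > 0" using subgroup_card_pos[OF assms(1) M(1)] by auto
      have "M \<noteq> Q" using M(4) finM prime_gt_1_nat[OF assms(2)] by auto
      then obtain x where x: "x \<in> Q" "x \<notin> M" using M(3) by blast
      have xc: "x \<in> carrier G" using x by simp
      \<comment> \<open>The fixed points of t lie in C and so in M, which this coset does not meet.
        But r does not divide the size |M| of the coset, so the count gives a fixed point in
        it.\<close>
      define E where "E = M #> x"
      have EQ: "E \<subseteq> Q" using x M(3) by (auto simp: E_def r_coset_def)
      have cE: "card E = card M"
        unfolding E_def using card_rcosets_equal[OF rcosetsI[OF M.subset xc] M.subset] by simp
      have "r dvd card E \<longleftrightarrow> r dvd card {y \<in> E. t \<otimes> y \<otimes> inv t = y}"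
      proof (rule prime_order_permutation_fixed_points)
        show "finite E" using finite_subset[OF EQ] subgroup_card_pos(2)[OF assms(1,3)] by simp
        show "(\<lambda>y. t \<otimes> y \<otimes> inv t) ` E \<subseteq> E"
        proof
          fix w assume "w \<in> (\<lambda>y. t \<otimes> y \<otimes> inv t) ` E"
          then obtain y where y: "y \<in> E" "w = t \<otimes> y \<otimes> inv t" by blast
          then obtain m1 where m1: "m1 \<in> M" "y = m1 \<otimes> x" by (auto simp: E_def r_coset_def)
          have yQ: "y \<in> Q" "y \<in> carrier G" using y EQ by auto
          have "w = ((t \<otimes> y \<otimes> inv t \<otimes> inv y) \<otimes> m1) \<otimes> x"
            using y m1 t yQ xc by (simp add: m_assoc inv_mult_cancel inv_mult_group)
          moreover have "(t \<otimes> y \<otimes> inv t \<otimes> inv y) \<otimes> m1 \<in> M" using less.prems(3)[OF M(1,3,4) yQ(1)] m1 by simp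
          ultimately show "w \<in> E" by (auto simp: E_def r_coset_def)
        qed
        show "((\<lambda>y. t \<otimes> y \<otimes> inv t) ^^ r) y = y" if "y \<in> E" for y
          using conj_funpow[OF t, of y r] rt that EQ by auto
      qed (rule r)
      moreover have "{y \<in> E. t \<otimes> y \<otimes> inv t = y} = {}"
      proof -
        have False if y: "y \<in> E" "t \<otimes> y \<otimes> inv t = y" for y
        proof -
          have yM: "y \<in> M" using y EQ M(2) by (auto simp: C_def)
          obtain m1 where m1: "m1 \<in> M" "y = m1 \<otimes> x" using y by (auto simp: E_def r_coset_def)
          then have xe: "inv m1 \<otimes> y = x" using xc by (simp add: inv_mult_cancel)
          have "inv m1 \<otimes> y \<in> M" using yM m1(1) by simp
          then show False using x(2) unfolding xe by simp
        qed
        then show ?thesis by blast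
      qed
      ultimately have "r dvd card M" using cE by simp
      then have "r dvd q ^ n" using M(4) assms(4) by simp
      then have "r = q" using r assms(2) by (metis prime_dvd_power primes_dvd_imp_eq)
      then show False using less.prems(5) r by simp
    qed
  qed
qed

text \<open>N is a smallest nontrivial normal subgroup of G inside Q, and its minimality is used
  through \<open>whole\<close>: a nontrivial subgroup of N that is invariant under G is N. This
  yields in turn that Q centralises N, that N has exponent q, that each g acts on N as a single
  power map, and that N is generated by one element.\<close>

lemma normal_sylow_chief_factor:
  assumes "finite (carrier G)" "Factorial_Ring.prime q" "Q \<lhd> G" "card Q = q ^ a" "order G = q ^ a * m" "\<not> q dvd m"
    and "Q \<noteq> {\<one>}"
    and max: "\<And>M. subgroup M G \<Longrightarrow> M \<subseteq> Q \<Longrightarrow> card Q = q * card M \<Longrightarrow> M \<lhd> G"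
  obtains N where "N \<lhd> G" "N \<subseteq> Q" "card N = q"
proof -
  have q1: "q > 1" using assms(2) prime_gt_1_nat by blast
  have Q: "subgroup Q G" using assms(3) normal_imp_subgroup by blast
  interpret Q: subgroup Q G by fact
  have Qc: "g \<otimes> x \<otimes> inv g \<in> Q" if "g \<in> carrier G" "x \<in> Q" for g x
    using assms(3) that unfolding normal_inv_iff by blast
  define F where "F = {N. N \<lhd> G \<and> N \<subseteq> Q \<and> N \<noteq> {\<one>}}"
  have "Q \<in> F" using assms(3,7) by (simp add: F_def)
  then obtain N where NF: "N \<in> F" and Nmin: "\<And>N'. N' \<in> F \<Longrightarrow> card N \<le> card N'"
    using ex_has_least_nat[of "\<lambda>N. N \<in> F" _ card] by blast
  then have N: "N \<lhd> G" "N \<subseteq> Q" "N \<noteq> {\<one>}" by (auto simp: F_def)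
  have Ns: "subgroup N G" using N(1) normal_imp_subgroup by blast
  interpret N: subgroup N G by fact
  have Nc: "g \<otimes> x \<otimes> inv g \<in> N" if "g \<in> carrier G" "x \<in> N" for g x
    using N(1) that unfolding normal_inv_iff by blast
  have finN: "finite N" using subgroup_card_pos assms(1) Ns by blast
  have whole: "E = N" if E: "subgroup E G" "E \<subseteq> N" "E \<noteq> {\<one>}" "\<And>g x. g \<in> carrier G \<Longrightarrow> x \<in> E \<Longrightarrow> g \<otimes> x \<otimes> inv g \<in> E" for E
  proof -
    have "E \<in> F" using E N(2) by (auto simp: F_def normal_inv_iff)
    then show ?thesis using Nmin E(2) finN by (metis card_seteq)
  qed
  have "card N dvd q ^ a" using card_subgroup_dvd[OF Ns Q N(2)] assms(4) by simp
  then obtain k where k: "card N = q ^ k" using assms(2) divides_primepow_nat by blast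
  define C where "C = {z \<in> N. \<forall>x\<in>Q. x \<otimes> z \<otimes> inv x \<otimes> inv z \<in> {\<one>}}"
  have C: "subgroup C G" unfolding C_def
    by (rule central_mod_subgroup) (use assms(1) Q Ns N(2) triv_subgroup in auto)
  have one: "{\<one>} \<subset> N" using N(3) N.one_closed by blast
  obtain z0 where z0: "z0 \<in> N - {\<one>}" "\<And>x. x \<in> Q \<Longrightarrow> x \<otimes> z0 \<otimes> inv x \<otimes> inv z0 \<in> {\<one>}"
    by (rule p_group_central_element_mod[OF assms(1,2) Q assms(4) Ns k triv_subgroup one]) (use Nc in auto)
  have "C = N"
  proof (rule whole[OF C])
    show "C \<subseteq> N" by (auto simp: C_def)
    have "z0 \<in> C" using z0 by (auto simp: C_def)
    then show "C \<noteq> {\<one>}" using z0 by blast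
    fix g z assume g: "g \<in> carrier G" "z \<in> C"
    then have z: "z \<in> N" "z \<in> carrier G" by (auto simp: C_def)
    have "x \<otimes> (g \<otimes> z \<otimes> inv g) \<otimes> inv x \<otimes> inv (g \<otimes> z \<otimes> inv g) = \<one>" if x: "x \<in> Q" for x
    proof -
      have xc: "x \<in> carrier G" using x by simp
      define y where "y = inv g \<otimes> x \<otimes> inv (inv g)"
      have y: "y \<in> Q" unfolding y_def by (rule Qc) (use g x in auto)
      have yc: "y \<in> carrier G" using y by simp
      have xy: "x = g \<otimes> y \<otimes> inv g" using g xc by (simp add: y_def m_assoc inv_mult_cancel)
      have "x \<otimes> (g \<otimes> z \<otimes> inv g) \<otimes> inv x \<otimes> inv (g \<otimes> z \<otimes> inv g) = g \<otimes> (y \<otimes> z \<otimes> inv y \<otimes> inv z) \<otimes> inv g"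
        unfolding xy using g(1) yc z by (simp add: m_assoc inv_mult_group inv_mult_cancel)
      also have "y \<otimes> z \<otimes> inv y \<otimes> inv z = \<one>" using g(2) y by (simp add: C_def)
      finally show ?thesis using g(1) by simp
    qed
    then show "g \<otimes> z \<otimes> inv g \<in> C" using Nc[OF g(1) z(1)] by (simp add: C_def)
  qed
  then have Ncent: "x \<otimes> z \<otimes> inv x = z" if "x \<in> Q" "z \<in> N" for x z
  proof -
    have "x \<otimes> z \<otimes> inv x \<otimes> inv z = \<one>" using that \<open>C = N\<close> by (auto simp: C_def)
    then show ?thesis using that by (metis N.mem_carrier Q.mem_carrier inv_closed inv_equality inv_inv m_closed)
  qed
  have Ncomm: "x \<otimes> y = y \<otimes> x" if "x \<in> N" "y \<in> N" for x y
  proof -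
    have xc: "x \<in> carrier G" "y \<in> carrier G" using that by auto
    have "x \<otimes> y \<otimes> inv x = y" using Ncent that N(2) by blast
    then show ?thesis using xc by (metis inv_solve_right' inv_closed m_closed)
  qed
  define A where "A = G\<lparr>carrier := N\<rparr>"
  have Am[simp]: "x \<otimes>\<^bsub>A\<^esub> y = x \<otimes> y" "carrier A = N" "\<one>\<^bsub>A\<^esub> = \<one>" for x y by (simp_all add: A_def)
  have Apow: "x [^]\<^bsub>A\<^esub> k = x [^] k" for x and k :: nat unfolding A_def by (rule nat_pow_consistent[symmetric])
  interpret A: group A unfolding A_def by (rule subgroup_imp_group) fact
  interpret A: comm_group A by (rule A.group_comm_groupI) (use Ncomm in auto)
  have powN: "z [^] (i::nat) \<in> N" if "z \<in> N" for z i using subgroup_nat_pow_closed[OF Ns that] .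
  have Nq: "z [^] q = \<one>" if "z \<in> N" for z
  proof -
    define E where "E = {z \<in> N. z [^] q = \<one>}"
    have "E = N"
    proof (rule whole)
      show "subgroup E G"
      proof (rule finite_subgroupI)
        fix x y assume xy: "x \<in> E" "y \<in> E"
        then have "(x \<otimes> y) [^] q = x [^] q \<otimes> y [^] q"
          using A.nat_pow_distrib[of x y q] by (simp add: E_def Apow)
        then show "x \<otimes> y \<in> E" using xy by (simp add: E_def)
      qed (use assms(1) N.subset in \<open>auto simp: E_def\<close>)
      show "E \<subseteq> N" by (auto simp: E_def)
      have z0c: "z0 \<in> carrier G" "z0 \<in> N" "z0 \<noteq> \<one>" using z0 by auto
      have "z0 [^] (q ^ k) = \<one>" using pow_card_subgroup[OF assms(1) Ns z0c(2)] k by simp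
      then obtain i where i: "z0 [^] (q ^ i) \<noteq> \<one>" "(z0 [^] (q ^ i)) [^] q = \<one>"
        using p_element_prime_order_power[OF z0c(1) _ z0c(3)] by blast
      then have "z0 [^] (q ^ i) \<in> E" using powN z0c by (simp add: E_def)
      then show "E \<noteq> {\<one>}" using i(1) by blast
      show "g \<otimes> x \<otimes> inv g \<in> E" if "g \<in> carrier G" "x \<in> E" for g x
        using that Nc conj_nat_pow'[of x g q] by (auto simp: E_def)
    qed
    then show ?thesis using that by (auto simp: E_def)
  qed
  \<comment> \<open>Here c acts trivially on every quotient of Q of order q. The power t = c^(q^a)
    satisfies t^m = 1, so the coprime action argument makes it centralise Q. The power u = c^m has
    q-power order, hence lies in Q and centralises N. By Bezout c is a product of powers of t and
    u.\<close>
  have triv: "c \<otimes> z \<otimes> inv c = z"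
    if c: "c \<in> carrier G" and cM: "\<And>M x. \<lbrakk>subgroup M G; M \<subseteq> Q; card Q = q * card M; x \<in> Q\<rbrakk> \<Longrightarrow> c \<otimes> x \<otimes> inv c \<otimes> inv x \<in> M"
      and z: "z \<in> N" for c z
  proof -
    have zc: "z \<in> carrier G" using z by simp
    define S where "S = {g \<in> carrier G. g \<otimes> z \<otimes> inv g = z}"
    have S: "subgroup S G"
    proof (rule finite_subgroupI)
      fix x y assume xy: "x \<in> S" "y \<in> S"
      then have c: "x \<in> carrier G" "y \<in> carrier G" "y \<otimes> z \<otimes> inv y = z" "x \<otimes> z \<otimes> inv x = z" by (auto simp: S_def)
      have "(x \<otimes> y) \<otimes> z \<otimes> inv (x \<otimes> y) = x \<otimes> (y \<otimes> z \<otimes> inv y) \<otimes> inv x"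
        using c(1,2) zc by (simp add: m_assoc inv_mult_group)
      then show "x \<otimes> y \<in> S" using c by (simp add: S_def)
    qed (use assms(1) zc in \<open>auto simp: S_def\<close>)
    have QS: "Q \<subseteq> S" using Ncent z by (auto simp: S_def)
    define t where "t = c [^] (q ^ a)"
    have tc: "t \<in> carrier G" using c by (simp add: t_def)
    have "\<forall>x\<in>Q. t \<otimes> x \<otimes> inv t = x"
    proof (rule coprime_action_trivial[OF assms(1,2) Q assms(4), where m = m])
      show "t \<otimes> x \<otimes> inv t \<in> Q" if "x \<in> Q" for x using Qc tc that by blast
      have "t [^] m = \<one>" using pow_order_eq_1[OF c] assms(5) c by (simp add: t_def nat_pow_pow)
      then show "t [^] m \<otimes> x \<otimes> inv (t [^] m) = x" if "x \<in> Q" for x using that by simp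
      show "t \<otimes> x \<otimes> inv t \<otimes> inv x \<in> M" if M: "subgroup M G" "M \<subseteq> Q" "card Q = q * card M" "x \<in> Q" for M x
      proof -
        have "c [^] k \<otimes> x \<otimes> inv (c [^] k) \<otimes> inv x \<in> M" for k :: nat
        proof (induction k)
          case 0 then show ?case using M subgroup.one_closed[OF M(1)] by simp
        next
          case (Suc k)
          define y where "y = c [^] k \<otimes> x \<otimes> inv (c [^] k)"
          have y: "y \<in> Q" using Qc M(4) c by (simp add: y_def)
          have cc: "x \<in> carrier G" "y \<in> carrier G" using y M(4) by auto
          have "c [^] Suc k = c \<otimes> c [^] k" using c by (rule nat_pow_Suc2)
          then have "c [^] Suc k \<otimes> x \<otimes> inv (c [^] Suc k) \<otimes> inv x = (c \<otimes> y \<otimes> inv c \<otimes> inv y) \<otimes> (y \<otimes> inv x)"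
            using c cc by (simp add: m_assoc inv_mult_group inv_mult_cancel y_def)
          moreover have "c \<otimes> y \<otimes> inv c \<otimes> inv y \<in> M" using cM M y by blast
          moreover have "y \<otimes> inv x \<in> M" using Suc by (simp add: y_def)
          ultimately show ?case using M(1) by (simp add: subgroup.m_closed)
        qed
        then show ?thesis by (simp add: t_def)
      qed
    qed (use tc assms(6) in auto)
    then have tS: "t \<in> S" using tc z N(2) by (auto simp: S_def)
    define u where "u = c [^] m"
    have uc: "u \<in> carrier G" using c by (simp add: u_def)
    have cop: "coprime (q ^ a) m" using assms(2,6) prime_imp_coprime coprime_power_left_iff by blast
    have "generate G {u} \<subseteq> Q"
    proof (rule normal_coprime_index_contains[OF assms(1,3)])
      show "subgroup (generate G {u}) G" using uc by (intro generate_is_subgroup) auto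
      show "order G = card Q * m" using assms(4,5) by simp
      have "u [^] (q ^ a) = \<one>" using pow_order_eq_1[OF c] assms(5) c by (simp add: u_def nat_pow_pow mult.commute)
      then have "ord u dvd q ^ a" using pow_eq_id[OF uc] by simp
      then show "coprime (card (generate G {u})) m"
        using cop generate_pow_card[OF uc] coprime_divisors[of "ord u" "q ^ a" m m] by simp
    qed
    then have uS: "u \<in> S" using QS generate.incl[of u "{u}" G] by blast
    obtain i j where ij: "(q ^ a) * i = m * j + 1" using bezout_nat[of "q ^ a" m] cop q1 by auto
    have "c [^] (q ^ a * i) = c [^] (m * j) \<otimes> c" unfolding ij using c by simp
    then have "t [^] i = u [^] j \<otimes> c" using c by (simp add: t_def u_def nat_pow_pow)
    then have "c = inv (u [^] j) \<otimes> t [^] i" using uc tc c by (simp add: inv_mult_cancel)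
    moreover have "inv (u [^] j) \<otimes> t [^] i \<in> S"
      using S subgroup_nat_pow_closed[OF S uS] subgroup_nat_pow_closed[OF S tS]
      by (intro subgroup.m_closed subgroup.m_inv_closed)
    ultimately have "c \<in> S" by simp
    then show ?thesis by (simp add: S_def)
  qed
  have comm: "(g \<otimes> h) \<otimes> z \<otimes> inv (g \<otimes> h) = (h \<otimes> g) \<otimes> z \<otimes> inv (h \<otimes> g)"
    if gh: "g \<in> carrier G" "h \<in> carrier G" and z: "z \<in> N" for g h z
  proof -
    have zc: "z \<in> carrier G" using z by simp
    define a b where "a = g \<otimes> h" and "b = h \<otimes> g"
    have ab: "a \<in> carrier G" "b \<in> carrier G" using gh by (auto simp: a_def b_def)
    have "(a \<otimes> inv b) \<otimes> (b \<otimes> z \<otimes> inv b) \<otimes> inv (a \<otimes> inv b) = b \<otimes> z \<otimes> inv b"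
    proof (rule triv)
      show "a \<otimes> inv b \<otimes> x \<otimes> inv (a \<otimes> inv b) \<otimes> inv x \<in> M"
        if M: "subgroup M G" "M \<subseteq> Q" "card Q = q * card M" "x \<in> Q" for M x
        using prime_factor_action(1)[OF assms(1,2,3) max[OF M(1-3)] M(2,3) gh(1) M(4) gh(2)] by (simp add: a_def b_def)
    qed (use ab Nc[OF ab(2) z] in auto)
    then show ?thesis using ab zc unfolding a_def[symmetric] b_def[symmetric]
      by (simp add: m_assoc inv_mult_group inv_mult_cancel)
  qed
  have exp: "g [^] (q - 1) \<otimes> z \<otimes> inv (g [^] (q - 1)) = z" if g: "g \<in> carrier G" "z \<in> N" for g z
  proof (rule triv)
    show "g [^] (q - 1) \<otimes> x \<otimes> inv (g [^] (q - 1)) \<otimes> inv x \<in> M"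
      if M: "subgroup M G" "M \<subseteq> Q" "card Q = q * card M" "x \<in> Q" for M x
      using prime_factor_action(2)[OF assms(1,2,3) max[OF M(1-3)] M(2,3) g(1) M(4) refl] .
  qed (use g in auto)
  have z0N: "z0 \<in> N" "z0 \<noteq> \<one>" using z0 by auto
  have scal: "\<exists>k::nat. \<forall>y\<in>N. g \<otimes> y \<otimes> inv g = y [^] k" if g: "g \<in> carrier G" for g
  proof -
    define T where "T = (\<lambda>y. g \<otimes> y \<otimes> inv g)"
    have "T \<in> hom A A"
    proof (rule homI)
      fix x y assume "x \<in> carrier A" "y \<in> carrier A"
      then have "x \<in> carrier G" "y \<in> carrier G" by auto
      then show "T (x \<otimes>\<^bsub>A\<^esub> y) = T x \<otimes>\<^bsub>A\<^esub> T y" using g by (simp add: T_def m_assoc inv_mult_cancel)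
    qed (use Nc g in \<open>auto simp: T_def\<close>)
    moreover have "(T ^^ (q - 1)) z = z" if "z \<in> carrier A" for z
      using conj_funpow[OF g, of z "q - 1"] exp[OF g, of z] that by (simp add: T_def)
    ultimately obtain y k where y: "y \<in> N" "y \<noteq> \<one>" "T y = y [^] (k::nat)"
      using exponent_automorphism_eigenvector[of A q T z0] Nq z0N A.comm_group_axioms assms(2) by (auto simp: Apow)
    \<comment> \<open>This is the eigenspace of g for the scalar k. It is invariant under every h
      because g and h act on N by commuting maps.\<close>
    define E where "E = {y \<in> N. g \<otimes> y \<otimes> inv g = y [^] k}"
    have "E = N"
    proof (rule whole)
      show "subgroup E G"
      proof (rule finite_subgroupI)
        fix x y assume xy: "x \<in> E" "y \<in> E"
        then have c: "x \<in> N" "y \<in> N" "x \<in> carrier G" "y \<in> carrier G" by (auto simp: E_def)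
        have "(x \<otimes> y) [^] k = x [^] k \<otimes> y [^] k"
          using A.nat_pow_distrib[of x y k] c by (simp add: Apow)
        moreover have "g \<otimes> (x \<otimes> y) \<otimes> inv g = (g \<otimes> x \<otimes> inv g) \<otimes> (g \<otimes> y \<otimes> inv g)"
          using c g by (simp add: m_assoc inv_mult_cancel)
        ultimately show "x \<otimes> y \<in> E" using xy by (simp add: E_def)
      qed (use assms(1) N.subset g in \<open>auto simp: E_def\<close>)
      show "E \<subseteq> N" by (auto simp: E_def)
      have "y \<in> E" using y by (simp add: E_def T_def)
      then show "E \<noteq> {\<one>}" using y by blast
      show "h \<otimes> x \<otimes> inv h \<in> E" if h: "h \<in> carrier G" "x \<in> E" for h x
      proof -
        have x: "x \<in> N" "x \<in> carrier G" using h by (auto simp: E_def)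
        have "g \<otimes> (h \<otimes> x \<otimes> inv h) \<otimes> inv g = (g \<otimes> h) \<otimes> x \<otimes> inv (g \<otimes> h)"
          using g h(1) x by (simp add: m_assoc inv_mult_group)
        also have "\<dots> = (h \<otimes> g) \<otimes> x \<otimes> inv (h \<otimes> g)" by (rule comm[OF g h(1) x(1)])
        also have "\<dots> = h \<otimes> (g \<otimes> x \<otimes> inv g) \<otimes> inv h"
          using g h(1) x by (simp add: m_assoc inv_mult_group)
        also have "g \<otimes> x \<otimes> inv g = x [^] k" using h(2) by (simp add: E_def)
        also have "h \<otimes> x [^] k \<otimes> inv h = (h \<otimes> x \<otimes> inv h) [^] k" by (rule conj_nat_pow'[OF x(2) h(1)])
        finally show ?thesis using Nc[OF h(1) x(1)] by (simp add: E_def)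
      qed
    qed
    then show ?thesis by (auto simp: E_def)
  qed
  have z0c: "z0 \<in> carrier G" using z0N by simp
  \<comment> \<open>Every g acts by a power map, so the cyclic group generated by z0 is invariant
    under G.\<close>
  have "generate G {z0} = N"
  proof (rule whole)
    show sub: "subgroup (generate G {z0}) G" using z0c by (intro generate_is_subgroup) auto
    show "generate G {z0} \<subseteq> N" by (rule generate_subgroup_incl) (use z0N Ns in auto)
    show "generate G {z0} \<noteq> {\<one>}" using z0N generate.incl[of z0 "{z0}" G] by blast
    fix g x assume g: "g \<in> carrier G" "x \<in> generate G {z0}"
    obtain k :: nat where "g \<otimes> x \<otimes> inv g = x [^] k"
      using scal[OF g(1)] g(2) \<open>generate G {z0} \<subseteq> N\<close> by blast
    then show "g \<otimes> x \<otimes> inv g \<in> generate G {z0}" using subgroup_nat_pow_closed[OF sub g(2)] by simp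
  qed
  moreover have "ord z0 = q" using Nq[OF z0N(1)] z0N(2) assms(2) pow_eq_id[OF z0c, of q] ord_eq_1[OF z0c] by (auto simp: prime_nat_iff)
  ultimately have "card N = q" using generate_pow_card[OF z0c] by simp
  then show thesis using that N by blast
qed

end

section \<open>Supersolubility from subgroups of prime index\<close>

context group
begin

lemma quotient_preimage:
  assumes "finite (carrier G)" "A \<lhd> G" "subgroup M' (G Mod A)"
  defines "M \<equiv> {x \<in> carrier G. A #> x \<in> M'}"
  shows "subgroup M G" "A \<subseteq> M" "(\<lambda>x. A #> x) ` M = M'" "card M = card M' * card A"
    and "M' \<lhd> G Mod A \<Longrightarrow> M \<lhd> G"
proof -
  have A: "subgroup A G" using assms(2) normal_imp_subgroup by blast
  interpret A: subgroup A G by fact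
  interpret B: group "G Mod A" by (rule normal.factorgroup_is_group) fact
  interpret \<pi>: group_hom G "G Mod A" "\<lambda>x. A #> x"
    using normal.r_coset_hom_Mod[OF assms(2)] by (simp add: group_hom_def group_hom_axioms_def B.is_group is_group)
  interpret M': subgroup M' "G Mod A" by fact
  show M: "subgroup M G"
  proof (rule finite_subgroupI)
    show "\<one> \<in> M" using M'.one_closed A.subset by (simp add: M_def)
    show "x \<otimes> y \<in> M" if "x \<in> M" "y \<in> M" for x y
      using that M'.m_closed[of "A #> x" "A #> y"] \<pi>.hom_mult[of x y] by (simp add: M_def)
  qed (use assms(1) in \<open>auto simp: M_def\<close>)
  show AM: "A \<subseteq> M"
    using coset_join2[OF _ A] M'.one_closed by (auto simp: M_def)
  show im: "(\<lambda>x. A #> x) ` M = M'"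
  proof
    show "M' \<subseteq> (\<lambda>x. A #> x) ` M"
    proof
      fix y assume y: "y \<in> M'"
      then have "y \<in> carrier (G Mod A)" by simp
      then obtain x where "x \<in> carrier G" "y = A #> x" by (auto simp: carrier_FactGroup)
      then show "y \<in> (\<lambda>x. A #> x) ` M" using y by (auto simp: M_def)
    qed
  qed (auto simp: M_def)
  show "card M = card M' * card A" using card_image_rcosets[OF assms(1) A M AM] im by simp
  show "M \<lhd> G" if n: "M' \<lhd> G Mod A"
    unfolding normal_inv_iff
  proof (intro conjI ballI M)
    fix g x assume g: "g \<in> carrier G" "x \<in> M"
    then have xc: "x \<in> carrier G" "A #> x \<in> M'" by (auto simp: M_def)
    have "(A #> g) \<otimes>\<^bsub>G Mod A\<^esub> (A #> x) \<otimes>\<^bsub>G Mod A\<^esub> inv\<^bsub>G Mod A\<^esub> (A #> g) \<in> M'"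
      using n xc \<pi>.hom_closed[OF g(1)] unfolding B.normal_inv_iff by blast
    moreover have "(A #> g) \<otimes>\<^bsub>G Mod A\<^esub> (A #> x) \<otimes>\<^bsub>G Mod A\<^esub> inv\<^bsub>G Mod A\<^esub> (A #> g) = A #> (g \<otimes> x \<otimes> inv g)"
      using g xc \<pi>.hom_mult \<pi>.hom_inv by (metis inv_closed m_closed)
    ultimately show "g \<otimes> x \<otimes> inv g \<in> M" using g xc by (simp add: M_def)
  qed
qed

text \<open>Conjugation by g acts on the cyclic group R as a power map, and power maps preserve
  every subgroup.\<close>

lemma cyclic_normal_subgroup:
  assumes "finite (carrier G)" "R \<lhd> G" "b \<in> R" "\<And>y. y \<in> R \<Longrightarrow> \<exists>i::nat. y = b [^] i" "subgroup M G" "M \<subseteq> R"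
  shows "M \<lhd> G"
  unfolding normal_inv_iff
proof (intro conjI ballI assms(5))
  fix g x assume g: "g \<in> carrier G" "x \<in> M"
  have bc: "b \<in> carrier G" by (rule subgroup.mem_carrier[OF normal_imp_subgroup[OF assms(2)] assms(3)])
  obtain i :: nat where i: "x = b [^] i" using g(2) assms(4,6) by blast
  have "g \<otimes> b \<otimes> inv g \<in> R" using assms(2,3) g(1) unfolding normal_inv_iff by blast
  then obtain l :: nat where l: "g \<otimes> b \<otimes> inv g = b [^] l" using assms(4) by blast
  have "g \<otimes> x \<otimes> inv g = x [^] l"
    using conj_nat_pow'[OF bc g(1), of i] i l bc by (simp add: nat_pow_pow mult.commute)
  then show "g \<otimes> x \<otimes> inv g \<in> M" using subgroup_nat_pow_closed[OF assms(5) g(2)] by simp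
qed

lemma index_p_normal_in_p_subgroup:
  assumes "finite (carrier G)" "Factorial_Ring.prime p" "subgroup P G" "card P = p ^ n"
    and "subgroup Q G" "Q \<subseteq> P" "card P = p * card Q" "x \<in> P" "y \<in> Q"
  shows "x \<otimes> y \<otimes> inv x \<in> Q"
proof -
  define H where "H = G\<lparr>carrier := P\<rparr>"
  interpret H: group H unfolding H_def by (rule subgroup_imp_group) fact
  have "Q \<lhd> H"
  proof (rule H.smallest_prime_index_normal[OF _ _ assms(2)])
    show "finite (carrier H)" using subgroup_card_pos[OF assms(1,3)] by (simp add: H_def)
    show "subgroup Q H" unfolding H_def by (rule subgroup_incl) fact+
    show "order H = p * card Q" using assms(7) by (simp add: order_def H_def)
    show "p \<le> r" if "Factorial_Ring.prime r" "r dvd order H" for r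
    proof -
      have "r dvd p ^ n" using that(2) assms(4) by (simp add: order_def H_def)
      then have "r = p" using that(1) assms(2) by (metis prime_dvd_power primes_dvd_imp_eq)
      then show ?thesis by simp
    qed
  qed
  then have "x \<otimes>\<^bsub>H\<^esub> y \<otimes>\<^bsub>H\<^esub> inv\<^bsub>H\<^esub> x \<in> Q" using assms(8,9) unfolding H.normal_inv_iff by (simp add: H_def)
  then show ?thesis using m_inv_consistent[OF assms(3,8)] by (simp add: H_def)
qed

text \<open>Let P0 = M \<inter> P, of index q in P, and let S contain P0 and have index q in G. Then
  M = S \<inter> AP is normalised by S since AP is normal, and M = A P0 is normalised by P since P0
  has index q in the q-group P. Finally SP = G.\<close>

lemma index_q_over_normal_is_normal:
  assumes "finite (carrier G)" "Factorial_Ring.prime q" "subgroup P G" "card P = q ^ n" "order G = q ^ n * m" "\<not> q dvd m"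
    and "prime_index_property G q P" "\<not> cyclic_group (G\<lparr>carrier := P\<rparr>)"
    and A: "A \<lhd> G" and W: "A <#> P \<lhd> G"
    and M: "subgroup M G" "A \<subseteq> M" "M \<subseteq> A <#> P" "card (A <#> P) = q * card M"
  shows "M \<lhd> G"
proof -
  have As: "subgroup A G" using A normal_imp_subgroup by blast
  have Ws: "subgroup (A <#> P) G" using W normal_imp_subgroup by blast
  interpret A: subgroup A G by fact
  interpret P: subgroup P G by fact
  interpret M: subgroup M G by fact
  have q0: "q > 0" using assms(2) prime_gt_0_nat by blast
  have PW: "P \<subseteq> A <#> P" using set_mult_upper(2)[OF As assms(3)] .
  have Ac: "g \<otimes> a \<otimes> inv g \<in> A" if "g \<in> carrier G" "a \<in> A" for g a
    using A that unfolding normal_inv_iff by blast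
  have Wc: "g \<otimes> a \<otimes> inv g \<in> A <#> P" if "g \<in> carrier G" "a \<in> A <#> P" for g a
    using W that unfolding normal_inv_iff by blast
  define P0 where "P0 = M \<inter> P"
  have P0: "subgroup P0 G" unfolding P0_def using M(1) assms(3) by (rule subgroups_Inter_pair)
  have "M <#> P = A <#> P"
    using mono_set_mult[OF M(2) order_refl[of P], of G] set_mult_least[OF Ws M(3) PW] by blast
  then have "card M * (q * card P0) = card M * card P"
    using card_set_mult[OF assms(1) M(1) assms(3)] M(4) by (simp add: P0_def ac_simps)
  then have cP0: "card P = q * card P0" using subgroup_card_pos(1)[OF assms(1) M(1)] by simp
  have P0P: "P0 \<subseteq> P" by (auto simp: P0_def)
  obtain S where S: "subgroup S G" "P0 \<subseteq> S" "order G = q * card S"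
    using assms(7,8) P0 P0P cP0 unfolding prime_index_property_def by blast
  interpret S: subgroup S G by (rule S)
  have PS: "\<not> P \<subseteq> S" by (rule prime_index_not_sylow[OF assms(1-6) S(1,3)])
  have cAP: "card (A <#> P) * card (A \<inter> P) = card A * card P" by (rule card_set_mult[OF assms(1) As assms(3)])
  \<comment> \<open>Otherwise q divides |A : A \<inter> S|, and therefore also |A : A \<inter> P| =
    |AP : P|. The latter is prime to q because P is a Sylow subgroup.\<close>
  have AS: "A \<subseteq> S"
  proof (rule ccontr)
    assume "\<not> A \<subseteq> S"
    then have cA: "card A = q * card (A \<inter> S)"
      by (rule normal_inter_prime_index[OF assms(1,2) A S(1,3)])
    have "card P dvd card (A <#> P)" by (rule card_subgroup_dvd[OF assms(3) Ws PW])
    then obtain b where b: "card (A <#> P) = card P * b" by (auto elim: dvdE)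
    have "card (A <#> P) dvd order G" unfolding order_def
      using card_subgroup_dvd[OF Ws subgroup_self] subgroup.subset[OF Ws] by blast
    then have "q ^ n * b dvd q ^ n * m" using b assms(4,5) by simp
    then have "b dvd m" using q0 by simp
    then have qb: "\<not> q dvd b" using assms(6) dvd_trans by blast
    have "card P * (b * card (A \<inter> P)) = card P * card A" using cAP b by (simp add: ac_simps)
    then have cA2: "card A = b * card (A \<inter> P)" using subgroup_card_pos(1)[OF assms(1,3)] by simp
    have "A \<inter> P \<subseteq> A \<inter> S" using M(2) S(2) by (auto simp: P0_def)
    then have "card (A \<inter> P) dvd card (A \<inter> S)"
      by (intro card_subgroup_dvd subgroups_Inter_pair As assms(3) S(1))
    then have "q * card (A \<inter> P) dvd b * card (A \<inter> P)" using cA cA2 by (metis mult_dvd_mono dvd_refl)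
    then show False using qb subgroup_card_pos(1)[OF assms(1) subgroups_Inter_pair[OF As assms(3)]]
      by (simp add: nat_mult_dvd_cancel_disj mult.commute[of _ "card (A \<inter> P)"] del: card_gt_0_iff)
  qed
  have dedekind: "\<exists>a\<in>A. \<exists>y\<in>P0. x = a \<otimes> y" if x: "x \<in> M" for x
  proof -
    have "x \<in> A <#> P" using x M(3) by blast
    then obtain a y where ay: "a \<in> A" "y \<in> P" "x = a \<otimes> y" unfolding set_mult_def by blast
    then have "y = inv a \<otimes> x" by (simp add: inv_mult_cancel)
    moreover have "inv a \<otimes> x \<in> M" using ay(1) M(2) x by blast
    ultimately show ?thesis using ay by (auto simp: P0_def)
  qed
  have MS: "M \<subseteq> S"
  proof
    fix x assume "x \<in> M"
    then obtain a y where "a \<in> A" "y \<in> P0" "x = a \<otimes> y" using dedekind by blast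
    then show "x \<in> S" using AS S(2) by auto
  qed
  have SW: "subgroup (S \<inter> (A <#> P)) G" by (rule subgroups_Inter_pair[OF S(1) Ws])
  have "card (A <#> P) = q * card ((A <#> P) \<inter> S)"
    by (rule normal_inter_prime_index[OF assms(1,2) W S(1,3)]) (use PS PW in blast)
  then have "card M = card (S \<inter> (A <#> P))" using M(4) q0 by (simp add: Int_commute)
  then have Meq: "M = S \<inter> (A <#> P)"
    using MS M(3) subgroup_card_pos(2)[OF assms(1) SW] by (intro card_subset_eq) auto
  have Sn: "s \<otimes> x \<otimes> inv s \<in> M" if "s \<in> S" "x \<in> M" for s x
    unfolding Meq using that MS M(3) Wc[of s x] by auto
  have Pn: "y \<otimes> x \<otimes> inv y \<in> M" if y: "y \<in> P" and x: "x \<in> M" for y x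
  proof -
    obtain a z where az: "a \<in> A" "z \<in> P0" "x = a \<otimes> z" using dedekind[OF x] by blast
    have c: "y \<in> carrier G" "a \<in> carrier G" "z \<in> carrier G" using y az P0P by auto
    have "y \<otimes> x \<otimes> inv y = (y \<otimes> a \<otimes> inv y) \<otimes> (y \<otimes> z \<otimes> inv y)"
      using az(3) c by (simp add: m_assoc inv_mult_cancel)
    moreover have "y \<otimes> a \<otimes> inv y \<in> M" using Ac[OF c(1) az(1)] M(2) by blast
    moreover have "y \<otimes> z \<otimes> inv y \<in> M"
      using index_p_normal_in_p_subgroup[OF assms(1-4) P0 P0P cP0 y az(2)] by (simp add: P0_def)
    ultimately show ?thesis by simp
  qed
  have "S \<inter> P = P0"
    unfolding Meq P0_def using PW by blast
  then have "card (S <#> P) * card P0 = card S * (q * card P0)"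
    using card_set_mult[OF assms(1) S(1) assms(3)] cP0 by simp
  then have "card P0 * card (S <#> P) = card P0 * order G" using S(3) by (simp add: ac_simps)
  then have "card (S <#> P) = order G" using subgroup_card_pos(1)[OF assms(1) P0] by simp
  then have SPG: "S <#> P = carrier G"
    using set_mult_closed[OF S.subset P.subset] assms(1) by (simp add: order_def card_subset_eq)
  show ?thesis unfolding normal_inv_iff
  proof (intro conjI ballI M(1))
    fix g x assume g: "g \<in> carrier G" "x \<in> M"
    then have "g \<in> S <#> P" using SPG by simp
    then obtain s y where sy: "s \<in> S" "y \<in> P" "g = s \<otimes> y" unfolding set_mult_def by blast
    have c: "s \<in> carrier G" "y \<in> carrier G" "x \<in> carrier G" using sy g by auto
    have "g \<otimes> x \<otimes> inv g = s \<otimes> (y \<otimes> x \<otimes> inv y) \<otimes> inv s"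
      using sy(3) c by (simp add: m_assoc inv_mult_group)
    then show "g \<otimes> x \<otimes> inv g \<in> M" using Sn[OF sy(1) Pn[OF sy(2) g(2)]] by simp
  qed
qed

text \<open>Taking q as the largest prime divisor of |G : A| makes AP normal: for U the normal Hall
  subgroup of the primes from q on, AU/A is a q-group, and so AU = AP. A normal subgroup of order q
  in G/A is then found inside AP/A and pulled back to B.\<close>

lemma normal_prime_step:
  assumes "finite (carrier G)"
    and hyp: "\<And>p. Factorial_Ring.prime p \<Longrightarrow> p dvd order G \<Longrightarrow> \<exists>P. sylow_subgroup G p P \<and> prime_index_property G p P"
    and A: "A \<lhd> G" "A \<noteq> carrier G"
  obtains B q where "B \<lhd> G" "A \<subseteq> B" "Factorial_Ring.prime q" "card B = q * card A"
proof -
  have As: "subgroup A G" using A normal_imp_subgroup by blast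
  interpret A: subgroup A G by fact
  have Apos: "card A > 0" using subgroup_card_pos(1)[OF assms(1) As] .
  have "card A dvd order G" unfolding order_def
    using card_subgroup_dvd[OF As subgroup_self] A.subset by blast
  then obtain i where i: "order G = card A * i" by (auto elim: dvdE)
  have "i \<noteq> 1"
  proof
    assume "i = 1"
    then have "A = carrier G" using i A.subset assms(1) by (simp add: order_def card_subset_eq)
    then show False using A by simp
  qed
  then have ex: "\<exists>r. Factorial_Ring.prime r \<and> r dvd i" using prime_factor_nat by blast
  have ordpos: "order G > 0" using assms(1) by (simp add: order_gt_0_iff_finite)
  then have i0: "i > 0" using i by simp
  have fin: "finite {r. Factorial_Ring.prime r \<and> r dvd i}"
    by (rule finite_subset[of _ "{..i}"]) (use i0 in \<open>auto dest: dvd_imp_le\<close>)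
  define q where "q = Max {r. Factorial_Ring.prime r \<and> r dvd i}"
  have q: "Factorial_Ring.prime q" "q dvd i" using Max_in[OF fin] ex by (auto simp: q_def)
  have qmax: "r \<le> q" if "Factorial_Ring.prime r" "r dvd i" for r
    unfolding q_def by (rule Max_ge[OF fin]) (use that in auto)
  have q0: "q > 0" using q prime_gt_0_nat by blast
  have "q dvd order G" using q(2) i by simp
  then obtain P where P: "sylow_subgroup G q P" "prime_index_property G q P" using hyp[OF q(1)] by blast
  then obtain n m where Pa: "subgroup P G" "card P = q ^ n" "order G = q ^ n * m" "\<not> q dvd m"
    by (auto simp: sylow_subgroup_def)
  interpret P: subgroup P G by (rule Pa)
  obtain U j where U: "U \<lhd> G" "order G = card U * j"
    and Up: "\<And>r. Factorial_Ring.prime r \<Longrightarrow> r dvd card U \<Longrightarrow> q \<le> r"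
    and jp: "\<And>r. Factorial_Ring.prime r \<Longrightarrow> r dvd j \<Longrightarrow> r < q"
    using normal_subgroup_of_large_primes[OF assms(1) hyp, of q] by blast
  have Us: "subgroup U G" using U normal_imp_subgroup by blast
  have "coprime (card P) j"
  proof (rule coprime_if_primes_disjoint)
    fix r assume r: "Factorial_Ring.prime r" "r dvd card P" "r dvd j"
    then have "r = q" using q Pa(2) by (metis prime_dvd_power primes_dvd_imp_eq)
    then show False using jp[OF r(1,3)] by simp
  qed (use Pa(2) q0 in auto)
  then have PU: "P \<subseteq> U" using normal_coprime_index_contains[OF assms(1) U(1) Pa(1) U(2)] by simp
  have AU: "A <#> U \<lhd> G" using A(1) U(1) by (rule normal_subgroup_set_mult_closed)
  have AUs: "subgroup (A <#> U) G" using AU normal_imp_subgroup by blast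
  have AP: "subgroup (A <#> P) G" using A(1) Pa(1) by (rule mult_norm_subgroup)
  have APU: "A <#> P \<subseteq> A <#> U" using PU by (intro mono_set_mult) auto
  have "card (A <#> P) dvd card (A <#> U)" using card_subgroup_dvd[OF AP AUs APU] .
  then obtain f where f: "card (A <#> U) = card (A <#> P) * f" by (auto elim: dvdE)
  have "card A dvd card (A <#> P)" using card_subgroup_dvd[OF As AP set_mult_upper(1)[OF As Pa(1)]] .
  then obtain e where e: "card (A <#> P) = card A * e" by (auto elim: dvdE)
  have AUdvd: "card (A <#> U) dvd order G" unfolding order_def
    using card_subgroup_dvd[OF AUs subgroup_self] subgroup.subset[OF AUs] by blast
  \<comment> \<open>A prime r dividing |AU : AP| divides |G : A|, so r \<le> q, and divides |U|, so
    q \<le> r. But q does not divide |G : AP|, as AP contains the Sylow subgroup P.\<close>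
  have "f = 1"
  proof (rule ccontr)
    assume "f \<noteq> 1"
    then obtain r where r: "Factorial_Ring.prime r" "r dvd f" using prime_factor_nat by blast
    have "card A * (e * f) dvd card A * i" using AUdvd f e i by (simp add: mult.assoc)
    then have "e * f dvd i" using Apos by simp
    then have "r dvd i" using r(2) by (meson dvd_mult dvd_trans)
    then have rq: "r \<le> q" using qmax r by simp
    have "card A * (e * f * card (A \<inter> U)) = card A * card U"
      using card_set_mult[OF assms(1) As Us] f e by (simp add: ac_simps)
    then have "e * f * card (A \<inter> U) = card U" using Apos by simp
    then have "f dvd card U" by (metis dvd_triv_left dvd_mult_left mult.assoc mult.commute)
    then have "q \<le> r" using Up r dvd_trans by blast
    then have "r = q" using rq by simp
    have "card P dvd card (A <#> P)" using card_subgroup_dvd[OF Pa(1) AP set_mult_upper(2)[OF As Pa(1)]] .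
    then obtain b where b: "card (A <#> P) = card P * b" by (auto elim: dvdE)
    have "q ^ n * (b * f) dvd q ^ n * m" using AUdvd f b Pa(2,3) by (simp add: mult.assoc)
    then have "b * f dvd m" using q0 by simp
    then have "q dvd m" using r(2) \<open>r = q\<close> by (meson dvd_mult dvd_trans)
    then show False using Pa(4) by simp
  qed
  then have "A <#> P = A <#> U" using f APU subgroup_card_pos(2)[OF assms(1) AUs] by (simp add: card_subset_eq)
  then have W: "A <#> P \<lhd> G" using AU by simp
  \<comment> \<open>If AP = A, then U lies in A, so q divides |G : U|, whose prime divisors are all
    smaller than q.\<close>
  have e1: "e \<noteq> 1"
  proof
    assume "e = 1"
    then have "A = A <#> P" using e set_mult_upper(1)[OF As Pa(1)] subgroup_card_pos(2)[OF assms(1) AP]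
      by (simp add: card_subset_eq)
    then have "U \<subseteq> A" using \<open>A <#> P = A <#> U\<close> set_mult_upper(2)[OF As Us] by simp
    then have "card U dvd card A" by (rule card_subgroup_dvd[OF Us As])
    then obtain c where c: "card A = card U * c" by (auto elim: dvdE)
    then have "card U * (c * i) = card U * j" using i U(2) by (metis mult.assoc)
    then have "c * i = j" using subgroup_card_pos(1)[OF assms(1) Us] by auto
    then have "q dvd j" using q(2) by (metis dvd_mult)
    then show False using jp q(1) by blast
  qed
  have "card A * (e * card (A \<inter> P)) = card A * q ^ n"
    using card_set_mult[OF assms(1) As Pa(1)] e Pa(2) by (simp add: ac_simps)
  then have "e * card (A \<inter> P) = q ^ n" using Apos by simp
  then have "e dvd q ^ n" by (metis dvd_triv_left)
  then obtain a where a: "e = q ^ a" using q(1) divides_primepow_nat by blast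
  define Gb where "Gb = G Mod A"
  interpret Gb: group Gb unfolding Gb_def by (rule normal.factorgroup_is_group[OF A(1)])
  define \<pi> where "\<pi> = (\<lambda>x. A #> x)"
  have ph: "\<pi> \<in> hom G Gb" unfolding \<pi>_def Gb_def by (rule normal.r_coset_hom_Mod[OF A(1)])
  interpret \<pi>: group_hom G Gb \<pi> using ph by (simp add: group_hom_def group_hom_axioms_def Gb.is_group is_group)
  have surj: "\<pi> ` carrier G = carrier Gb" by (simp add: \<pi>_def Gb_def carrier_FactGroup)
  have finB: "finite (carrier Gb)" using surj assms(1) by (metis finite_imageI)
  define Q where "Q = \<pi> ` (A <#> P)"
  have Q: "Q \<lhd> Gb" unfolding Q_def
    using normal.surj_hom_normal_subgroup[OF W \<pi>.group_hom_axioms surj] .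
  have "card Q * card A = card (A <#> P)"
    unfolding Q_def \<pi>_def by (rule card_image_rcosets[OF assms(1) As AP set_mult_upper(1)[OF As Pa(1)]])
  then have cQ: "card Q = e" using e Apos by (simp add: mult.commute)
  have "order Gb * card A = order G"
    using card_image_rcosets[OF assms(1) As subgroup_self A.subset] surj by (simp add: \<pi>_def order_def)
  then have oG: "order Gb = i" using i Apos by (simp add: mult.commute)
  have "card (A <#> P) dvd order G" using AUdvd \<open>A <#> P = A <#> U\<close> by simp
  then have "card A * e dvd card A * i" using e i by simp
  then have "e dvd i" using Apos by simp
  then obtain m'' where m'': "i = e * m''" by (auto elim: dvdE)
  have qm'': "\<not> q dvd m''"
  proof
    assume "q dvd m''"
    have "card P dvd card (A <#> P)" using card_subgroup_dvd[OF Pa(1) AP set_mult_upper(2)[OF As Pa(1)]] .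
    then obtain b where b: "card (A <#> P) = card P * b" by (auto elim: dvdE)
    have "q ^ n * m = q ^ n * (b * m'')" using i m'' e b Pa(2,3) by (metis mult.assoc)
    then have "m = b * m''" using q0 by simp
    then show False using Pa(4) \<open>q dvd m''\<close> by simp
  qed
  have pre: "subgroup M G" "A \<subseteq> M" "\<pi> ` M = M'" "card M = card M' * card A" "M' \<lhd> Gb \<Longrightarrow> M \<lhd> G"
    if "subgroup M' Gb" "M = {x \<in> carrier G. \<pi> x \<in> M'}" for M M'
    using quotient_preimage[OF assms(1) A(1), of M'] that unfolding Gb_def \<pi>_def by simp_all
  \<comment> \<open>For cyclic P the group AP/A is generated by the image of a generator of P, and
    all its subgroups are normal. Otherwise normality is proved for the preimage in G and
    transported back.\<close>
  have "M' \<lhd> Gb" if M': "subgroup M' Gb" "M' \<subseteq> Q" "card Q = q * card M'" for M'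
  proof (cases "cyclic_group (G\<lparr>carrier := P\<rparr>)")
    case True
    obtain b where b: "b \<in> P" "\<And>x. x \<in> P \<Longrightarrow> \<exists>k::nat. x = b [^] k"
      by (rule cyclic_subgroup_nat_generator[OF assms(1) Pa(1) True]) blast
    show ?thesis
    proof (rule Gb.cyclic_normal_subgroup[OF finB Q _ _ M'(1,2)])
      show "\<pi> b \<in> Q" using b(1) set_mult_upper(2)[OF As Pa(1)] by (auto simp: Q_def)
      fix y assume "y \<in> Q"
      then obtain x where x: "x \<in> A <#> P" "y = \<pi> x" by (auto simp: Q_def)
      then obtain c z where cz: "c \<in> A" "z \<in> P" "x = c \<otimes> z" unfolding set_mult_def by blast
      have cc: "c \<in> carrier G" "z \<in> carrier G" "b \<in> carrier G" using cz b by auto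
      have "c \<otimes> z \<otimes> inv z \<in> A" using cz cc by (simp add: m_assoc)
      then have "\<pi> x = \<pi> z" using rcoset_eq_iff[OF As, of x z] cz cc by (simp add: \<pi>_def)
      moreover obtain k :: nat where "z = b [^] k" using b(2) cz by blast
      ultimately have "y = \<pi> b [^]\<^bsub>Gb\<^esub> k" using x(2) cc \<pi>.hom_nat_pow by simp
      then show "\<exists>i::nat. y = \<pi> b [^]\<^bsub>Gb\<^esub> i" by blast
    qed
  next
    case False
    define M where "M = {x \<in> carrier G. \<pi> x \<in> M'}"
    note pM = pre[OF M'(1) M_def]
    have "M \<lhd> G"
    proof (rule index_q_over_normal_is_normal[OF assms(1) q(1) Pa P(2) False A(1) W pM(1,2)])
      show "M \<subseteq> A <#> P"
      proof
        fix x assume x: "x \<in> M"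
        then have xc: "x \<in> carrier G" "\<pi> x \<in> Q" using M'(2) by (auto simp: M_def)
        then obtain w where w: "w \<in> A <#> P" "\<pi> x = \<pi> w" by (auto simp: Q_def)
        have wc: "w \<in> carrier G" using w(1) subgroup.mem_carrier[OF AP] by blast
        have "x \<otimes> inv w \<in> A" using rcoset_eq_iff[OF As xc(1) wc] w(2) by (simp add: \<pi>_def)
        then have "x \<otimes> inv w \<in> A <#> P" using set_mult_upper(1)[OF As Pa(1)] by blast
        then have "x \<otimes> inv w \<otimes> w \<in> A <#> P" using w(1) AP by (simp add: subgroup.m_closed)
        then show "x \<in> A <#> P" using xc wc by (simp add: m_assoc)
      qed
      show "card (A <#> P) = q * card M" using e cQ M'(3) pM(4) by (simp add: mult.commute mult.left_commute)
    qed
    then have "\<pi> ` M \<lhd> Gb" using normal.surj_hom_normal_subgroup \<pi>.group_hom_axioms surj by blast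
    then show ?thesis using pM(3) by simp
  qed
  moreover have "card Q = q ^ a" "order Gb = q ^ a * m''" using cQ a oG m'' by simp_all
  moreover have "Q \<noteq> {\<one>\<^bsub>Gb\<^esub>}" using cQ e1 by auto
  ultimately obtain N' where N': "N' \<lhd> Gb" "N' \<subseteq> Q" "card N' = q"
    using Gb.normal_sylow_chief_factor[OF finB q(1) Q, of a m''] qm'' by metis
  define B where "B = {x \<in> carrier G. \<pi> x \<in> N'}"
  have N's: "subgroup N' Gb" using N' normal_imp_subgroup by blast
  show thesis
  proof (rule that)
    show "B \<lhd> G" by (rule pre(5)[OF N's B_def N'(1)])
    show "A \<subseteq> B" by (rule pre(2)[OF N's B_def])
    show "card B = q * card A" using pre(4)[OF N's B_def] N'(3) by simp
  qed (rule q)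
qed

lemma prime_order_cyclic:
  assumes "finite (carrier G)" "Factorial_Ring.prime (order G)"
  shows "cyclic_group G"
proof -
  obtain x where x: "x \<in> carrier G" "generate G {x} = carrier G"
    by (rule prime_order_subgroup_generator[OF assms subgroup_self order_def[symmetric]]) blast
  have "carrier G = range (\<lambda>n::int. x [^] n)" using generate_pow[OF x(1)] x(2) by auto
  then show ?thesis using cyclic_group x(1) by blast
qed

text \<open>The conclusion is the body of \<open>supersoluble\<close>. The series is built upwards
  from an arbitrary normal A, by induction on |G| - |A|; each step has prime order and is therefore
  cyclic.\<close>

lemma supersoluble_if_prime_index_property:
  assumes "finite (carrier G)"
    and hyp: "\<And>p. Factorial_Ring.prime p \<Longrightarrow> p dvd order G \<Longrightarrow> \<exists>P. sylow_subgroup G p P \<and> prime_index_property G p P"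
  shows "\<exists>(n::nat) N. N 0 = {\<one>} \<and> N n = carrier G \<and> (\<forall>i\<le>n. N i \<lhd> G) \<and>
        (\<forall>i<n. N i \<subseteq> N (Suc i) \<and> cyclic_group ((G\<lparr>carrier := N (Suc i)\<rparr>) Mod (N i)))"
proof -
  have "\<exists>(n::nat) N. N 0 = A \<and> N n = carrier G \<and> (\<forall>i\<le>n. N i \<lhd> G) \<and>
        (\<forall>i<n. N i \<subseteq> N (Suc i) \<and> cyclic_group ((G\<lparr>carrier := N (Suc i)\<rparr>) Mod (N i)))" if "A \<lhd> G" for A
    using that
  proof (induction "order G - card A" arbitrary: A rule: less_induct)
    case less
    show ?case
    proof (cases "A = carrier G")
      case True
      then show ?thesis using less.prems by (intro exI[of _ 0] exI[of _ "\<lambda>_. A"]) auto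
    next
      case False
      obtain B q where B: "B \<lhd> G" "A \<subseteq> B" "Factorial_Ring.prime q" "card B = q * card A"
        by (rule normal_prime_step[OF assms less.prems False])
      have As: "subgroup A G" and Bs: "subgroup B G" using less.prems B normal_imp_subgroup by blast+
      have "card A < card B" using B(4) prime_gt_1_nat[OF B(3)] subgroup_card_pos(1)[OF assms(1) As] by simp
      moreover have "card B \<le> order G" unfolding order_def using subgroup.subset[OF Bs] assms(1) by (rule_tac card_mono)
      ultimately have "order G - card B < order G - card A" by simp
      from less.hyps[OF this B(1)] obtain n :: nat and N where N: "N 0 = B" "N n = carrier G" "\<forall>i\<le>n. N i \<lhd> G"
        "\<forall>i<n. N i \<subseteq> N (Suc i) \<and> cyclic_group ((G\<lparr>carrier := N (Suc i)\<rparr>) Mod (N i))" by blast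
      have cyc: "cyclic_group ((G\<lparr>carrier := B\<rparr>) Mod A)"
      proof -
        interpret H: group "G\<lparr>carrier := B\<rparr>" by (rule subgroup_imp_group) fact
        have AB: "A \<lhd> G\<lparr>carrier := B\<rparr>"
          using normal_restrict_supergroup[OF Bs less.prems B(2)] .
        interpret F: group "(G\<lparr>carrier := B\<rparr>) Mod A" by (rule normal.factorgroup_is_group) fact
        have im: "carrier ((G\<lparr>carrier := B\<rparr>) Mod A) = (\<lambda>x. A #> x) ` B"
          by (simp add: carrier_FactGroup)
        have "card ((\<lambda>x. A #> x) ` B) * card A = q * card A"
          using card_image_rcosets[OF assms(1) As Bs B(2)] B(4) by simp
        then have "order ((G\<lparr>carrier := B\<rparr>) Mod A) = q"
          using im subgroup_card_pos(1)[OF assms(1) As] by (simp add: order_def)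
        moreover have "finite (carrier ((G\<lparr>carrier := B\<rparr>) Mod A))"
          unfolding im using subgroup_card_pos(2)[OF assms(1) Bs] by simp
        ultimately show ?thesis using B(3) F.prime_order_cyclic by simp
      qed
      define N' where "N' = (\<lambda>i. case i of 0 \<Rightarrow> A | Suc j \<Rightarrow> N j)"
      have "N' 0 = A" "N' (Suc n) = carrier G" using N by (auto simp: N'_def)
      moreover have "\<forall>i\<le>Suc n. N' i \<lhd> G" using N less.prems by (auto simp: N'_def split: nat.split)
      moreover have "\<forall>i<Suc n. N' i \<subseteq> N' (Suc i) \<and> cyclic_group ((G\<lparr>carrier := N' (Suc i)\<rparr>) Mod (N' i))"
        using N B(2) cyc by (auto simp: N'_def split: nat.split)
      ultimately show ?thesis by blast
    qed
  qed
  then show ?thesis using one_is_normal by blast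
qed

end

section \<open>Nilpotent Hall subgroups and sylowizers\<close>

context group
begin

text \<open>Conjugation by x turns y into cy, so (cy)^n = 1 and c^n = 1. Conjugation by the inverse
  of y turns x into cx, so c^m = 1 as well.\<close>

lemma commuting_commutator_trivial:
  assumes "x \<in> carrier G" "y \<in> carrier G" "c \<in> carrier G" "x \<otimes> y = c \<otimes> (y \<otimes> x)"
    and cent: "c \<otimes> x = x \<otimes> c" "c \<otimes> y = y \<otimes> c"
    and "x [^] (m::nat) = \<one>" "y [^] (n::nat) = \<one>" "coprime m n"
  shows "c = \<one>"
proof -
  have "x \<otimes> y \<otimes> inv x = c \<otimes> y" using assms(1-4) by (simp add: m_assoc)
  then have "(c \<otimes> y) [^] n = \<one>" using conj_nat_pow'[OF assms(2,1), of n] assms(1,8) by simp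
  then have 1: "c [^] n = \<one>" using pow_mult_distrib[OF cent(2) assms(3,2), of n] assms(3,8) by simp
  have "x \<otimes> y = (c \<otimes> y) \<otimes> x" using assms(1-4) by (simp add: m_assoc)
  also have "\<dots> = y \<otimes> (c \<otimes> x)" unfolding cent(2) using assms(1-3) by (simp add: m_assoc)
  finally have "inv y \<otimes> (x \<otimes> y) = c \<otimes> x" using assms(1-3) by (simp add: inv_mult_cancel)
  then have "inv y \<otimes> x \<otimes> y = c \<otimes> x" using assms(1-3) by (simp add: m_assoc)
  then have "(c \<otimes> x) [^] m = \<one>" using conj_nat_pow[OF assms(1,2), of m] assms(2,7) by simp
  then have 2: "c [^] m = \<one>" using pow_mult_distrib[OF cent(1) assms(3,1), of m] assms(3,7) by simp
  have "ord c dvd n" "ord c dvd m" using 1 2 pow_eq_id[OF assms(3)] by auto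
  then have "ord c = 1" using assms(9) by (metis coprime_common_divisor_nat)
  then show ?thesis using ord_eq_1[OF assms(3)] by simp
qed

lemma lower_central_step:
  assumes "N \<lhd> G"
  shows "commutator_subgroup G N (carrier G) \<lhd> G"
    and "c \<in> N \<Longrightarrow> h \<in> carrier G \<Longrightarrow> c \<otimes> h \<otimes> inv c \<otimes> inv h \<in> commutator_subgroup G N (carrier G)"
proof -
  have Ns: "subgroup N G" using assms normal_imp_subgroup by blast
  interpret N: subgroup N G by fact
  show "commutator_subgroup G N (carrier G) \<lhd> G"
    unfolding commutator_subgroup_def
  proof (rule normal_generateI)
    fix w g assume "w \<in> {h \<otimes> k \<otimes> inv h \<otimes> inv k |h k. h \<in> N \<and> k \<in> carrier G}" and g: "g \<in> carrier G"
    then obtain h k where hk: "w = h \<otimes> k \<otimes> inv h \<otimes> inv k" "h \<in> N" "k \<in> carrier G" by blast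
    have hc: "h \<in> carrier G" using hk by simp
    have "g \<otimes> w \<otimes> inv g = (g \<otimes> h \<otimes> inv g) \<otimes> (g \<otimes> k \<otimes> inv g) \<otimes> inv (g \<otimes> h \<otimes> inv g) \<otimes> inv (g \<otimes> k \<otimes> inv g)"
      unfolding hk(1) using hc hk(3) g by (simp add: m_assoc inv_mult_group inv_mult_cancel)
    moreover have "g \<otimes> h \<otimes> inv g \<in> N" using assms g hk(2) unfolding normal_inv_iff by blast
    moreover have "g \<otimes> k \<otimes> inv g \<in> carrier G" using g hk by simp
    ultimately show "g \<otimes> w \<otimes> inv g \<in> {h \<otimes> k \<otimes> inv h \<otimes> inv k |h k. h \<in> N \<and> k \<in> carrier G}" by blast
  qed auto
  show "c \<in> N \<Longrightarrow> h \<in> carrier G \<Longrightarrow> c \<otimes> h \<otimes> inv c \<otimes> inv h \<in> commutator_subgroup G N (carrier G)"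
    unfolding commutator_subgroup_def by (rule generate.incl) blast
qed

text \<open>The commutator c of x and y descends the lower central series: if it lies in one term,
  it is central modulo the next one, and there coprimality of m and n makes it trivial.\<close>

lemma nilpotent_coprime_commute:
  assumes "nilpotent_group G" "x \<in> carrier G" "y \<in> carrier G" "x [^] (m::nat) = \<one>" "y [^] (n::nat) = \<one>" "coprime m n"
  shows "x \<otimes> y = y \<otimes> x"
proof -
  define \<gamma> where "\<gamma> i = ((\<lambda>N. commutator_subgroup G N (carrier G)) ^^ i) (carrier G)" for i
  have \<gamma>Suc: "\<gamma> (Suc i) = commutator_subgroup G (\<gamma> i) (carrier G)" for i by (simp add: \<gamma>_def)
  have \<gamma>n: "\<gamma> i \<lhd> G" for i
  proof (induction i)
    case (Suc i) then show ?case unfolding \<gamma>Suc by (rule lower_central_step(1))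
  qed (simp add: \<gamma>_def normal_self)
  define c where "c = x \<otimes> y \<otimes> inv x \<otimes> inv y"
  have cc: "c \<in> carrier G" using assms by (simp add: c_def)
  have "c \<in> \<gamma> i" for i
  proof (induction i)
    case 0 then show ?case using cc by (simp add: \<gamma>_def)
  next
    case (Suc i)
    define N where "N = \<gamma> (Suc i)"
    have N: "N \<lhd> G" unfolding N_def by (rule \<gamma>n)
    have Ns: "subgroup N G" using N normal_imp_subgroup by blast
    interpret B: group "G Mod N" by (rule normal.factorgroup_is_group[OF N])
    interpret \<pi>: group_hom G "G Mod N" "\<lambda>x. N #> x"
      using normal.r_coset_hom_Mod[OF N] by (simp add: group_hom_def group_hom_axioms_def B.is_group is_group)
    have comm: "(N #> c) \<otimes>\<^bsub>G Mod N\<^esub> (N #> h) = (N #> h) \<otimes>\<^bsub>G Mod N\<^esub> (N #> c)" if h: "h \<in> carrier G" for h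
    proof -
      have "c \<otimes> h \<otimes> inv c \<otimes> inv h \<in> N" unfolding N_def \<gamma>Suc by (rule lower_central_step(2)[OF \<gamma>n Suc h])
      moreover have "(c \<otimes> h) \<otimes> inv (h \<otimes> c) = c \<otimes> h \<otimes> inv c \<otimes> inv h"
        using cc h by (simp add: m_assoc inv_mult_group)
      ultimately have "N #> (c \<otimes> h) = N #> (h \<otimes> c)" using rcoset_eq_iff[OF Ns, of "c \<otimes> h" "h \<otimes> c"] cc h by simp
      then show ?thesis using \<pi>.hom_mult cc h by metis
    qed
    have "N #> c = \<one>\<^bsub>G Mod N\<^esub>"
    proof (rule B.commuting_commutator_trivial)
      show "N #> x \<in> carrier (G Mod N)" "N #> y \<in> carrier (G Mod N)" "N #> c \<in> carrier (G Mod N)"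
        using \<pi>.hom_closed assms cc by blast+
      have "x \<otimes> y = c \<otimes> (y \<otimes> x)" using assms(2,3) by (simp add: c_def m_assoc inv_mult_cancel)
      then show "(N #> x) \<otimes>\<^bsub>G Mod N\<^esub> (N #> y) = (N #> c) \<otimes>\<^bsub>G Mod N\<^esub> ((N #> y) \<otimes>\<^bsub>G Mod N\<^esub> (N #> x))"
        using \<pi>.hom_mult assms(2,3) cc by (metis m_closed)
      show "(N #> x) [^]\<^bsub>G Mod N\<^esub> m = \<one>\<^bsub>G Mod N\<^esub>" "(N #> y) [^]\<^bsub>G Mod N\<^esub> n = \<one>\<^bsub>G Mod N\<^esub>"
        using \<pi>.hom_nat_pow[OF assms(2), of m] \<pi>.hom_nat_pow[OF assms(3), of n] assms(4,5) \<pi>.hom_one by metis+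
    qed (use comm assms in auto)
    then show ?case using rcos_self[OF cc Ns] by (simp add: N_def)
  qed
  moreover obtain k where "\<gamma> k = {\<one>}" using assms(1) by (auto simp: nilpotent_group_def \<gamma>_def)
  ultimately have "c = \<one>" by blast
  then have "x \<otimes> y \<otimes> inv x \<otimes> inv y = \<one>" by (simp add: c_def)
  then have "x \<otimes> y \<otimes> inv x = y" using assms(2,3) by (metis inv_closed inv_equality inv_inv m_closed)
  then show ?thesis using assms(2,3) by (metis inv_solve_right' inv_closed m_closed)
qed

lemma sylow_exists:
  assumes "finite (carrier G)" "Factorial_Ring.prime p"
  obtains P m where "subgroup P G" "card P = p ^ multiplicity p (order G)" "order G = p ^ multiplicity p (order G) * m" "\<not> p dvd m"
proof -
  have o: "order G \<noteq> 0" using assms(1) order_gt_0_iff_finite by simp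
  have np: "\<not> is_unit p" using assms(2) not_prime_unit by blast
  obtain m where m: "order G = p ^ multiplicity p (order G) * m" "\<not> p dvd m"
    using multiplicity_decompose'[OF o np] by blast
  obtain P where "subgroup P G" "card P = p ^ multiplicity p (order G)"
    using sylow_thm[OF assms(2) is_group m(1) assms(1)] by blast
  then show thesis using that m by blast
qed

text \<open>The normaliser of Q contains a Sylow r-subgroup for every prime r: Q itself for r = q,
  and for r \<noteq> q any one, since its elements commute with those of Q.\<close>

lemma nilpotent_sylow_normal:
  assumes "finite (carrier G)" "nilpotent_group G" "Factorial_Ring.prime q" "subgroup Q G" "card Q = q ^ multiplicity q (order G)"
  shows "Q \<lhd> G"
proof -
  interpret Q: subgroup Q G by fact
  define S where "S = {g \<in> carrier G. \<forall>x\<in>Q. g \<otimes> x \<otimes> inv g \<in> Q}"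
  have S: "subgroup S G"
  proof (rule finite_subgroupI)
    fix g h assume gh: "g \<in> S" "h \<in> S"
    then have c: "g \<in> carrier G" "h \<in> carrier G" by (auto simp: S_def)
    have "(g \<otimes> h) \<otimes> x \<otimes> inv (g \<otimes> h) \<in> Q" if x: "x \<in> Q" for x
    proof -
      have "(g \<otimes> h) \<otimes> x \<otimes> inv (g \<otimes> h) = g \<otimes> (h \<otimes> x \<otimes> inv h) \<otimes> inv g"
        using c x by (simp add: m_assoc inv_mult_group)
      then show ?thesis using gh x by (simp add: S_def)
    qed
    then show "g \<otimes> h \<in> S" using c by (simp add: S_def)
  qed (use assms(1) in \<open>auto simp: S_def\<close>)
  have o: "order G \<noteq> 0" using assms(1) order_gt_0_iff_finite by simp
  have "order G dvd card S"
  proof (rule multiplicity_le_imp_dvd[OF o])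
    fix r :: nat assume r: "Factorial_Ring.prime r"
    have ru: "\<not> is_unit r" using r not_prime_unit by blast
    obtain R where R: "subgroup R G" "card R = r ^ multiplicity r (order G)"
      using sylow_exists[OF assms(1) r] by metis
    have "\<exists>R'. subgroup R' G \<and> R' \<subseteq> S \<and> card R' = r ^ multiplicity r (order G)"
    proof (cases "r = q")
      case True
      have "Q \<subseteq> S" by (auto simp: S_def)
      then show ?thesis using True assms(4,5) by blast
    next
      case False
      have "R \<subseteq> S"
      proof
        fix g assume g: "g \<in> R"
        have gc: "g \<in> carrier G" using g R(1) subgroup.mem_carrier by metis
        have "g \<otimes> x \<otimes> inv g \<in> Q" if x: "x \<in> Q" for x
        proof -
          have "coprime r q" using False r assms(3) by (rule_tac primes_coprime)
          then have co: "coprime (card R) (card Q)" using R(2) assms(5) by simp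
          have "g \<otimes> x = x \<otimes> g"
            by (rule nilpotent_coprime_commute[OF assms(2) gc _ pow_card_subgroup[OF assms(1) R(1) g] pow_card_subgroup[OF assms(1,4) x] co])
              (use x in simp)
          then have "g \<otimes> x \<otimes> inv g = x" using gc x by (simp add: m_assoc)
          then show ?thesis using x by simp
        qed
        then show "g \<in> S" using gc by (simp add: S_def)
      qed
      then show ?thesis using R by blast
    qed
    then obtain R' where R': "subgroup R' G" "R' \<subseteq> S" "card R' = r ^ multiplicity r (order G)" by blast
    have "r ^ multiplicity r (order G) dvd card S" using card_subgroup_dvd[OF R'(1) S R'(2)] R'(3) by simp
    moreover have "card S \<noteq> 0" using subgroup_card_pos(1)[OF assms(1) S] by simp
    ultimately show "multiplicity r (order G) \<le> multiplicity r (card S)" using ru by (intro multiplicity_geI) auto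
  qed
  then have "order G \<le> card S" using subgroup_card_pos(1)[OF assms(1) S] by (rule_tac dvd_imp_le)
  then have "S = carrier G" using subgroup.subset[OF S] assms(1) unfolding order_def by (rule_tac card_seteq)
  then show ?thesis unfolding normal_inv_iff using assms(4) by (auto simp: S_def)
qed

text \<open>A maximal normal subgroup of order prime to q absorbs the Sylow r-subgroups for all r
  \<noteq> q, as these are normal.\<close>

lemma nilpotent_normal_complement:
  assumes "finite (carrier G)" "nilpotent_group G" "Factorial_Ring.prime q" "order G = q ^ a * m" "\<not> q dvd m"
  obtains N where "N \<lhd> G" "card N = m"
proof -
  define F where "F = {N. N \<lhd> G \<and> \<not> q dvd card N}"
  have "F \<subseteq> Pow (carrier G)" using subgroup.subset normal_imp_subgroup by (fastforce simp: F_def)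
  then have "finite F" using assms(1) by (meson finite_Pow_iff finite_subset)
  moreover have "{\<one>} \<in> F" using one_is_normal assms(3) not_prime_unit by (auto simp: F_def)
  ultimately obtain N where NF: "N \<in> F" and Nmax: "\<And>Y. Y \<in> F \<Longrightarrow> N \<subseteq> Y \<Longrightarrow> Y = N"
    by (rule obtain_maximal_set) blast
  then have N: "N \<lhd> G" "\<not> q dvd card N" by (auto simp: F_def)
  have Ns: "subgroup N G" using N normal_imp_subgroup by blast
  have o: "order G \<noteq> 0" using assms(1) order_gt_0_iff_finite by simp
  then have m0: "m \<noteq> 0" using assms(4) by auto
  have Npos: "card N \<noteq> 0" using subgroup_card_pos(1)[OF assms(1) Ns] by simp
  have "m dvd card N"
  proof (rule multiplicity_le_imp_dvd[OF m0])
    fix r :: nat assume r: "Factorial_Ring.prime r"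
    show "multiplicity r m \<le> multiplicity r (card N)"
    proof (cases "r = q")
      case True then show ?thesis using assms(5) by (simp add: not_dvd_imp_multiplicity_0)
    next
      case False
      obtain R where R: "subgroup R G" "card R = r ^ multiplicity r (order G)"
        using sylow_exists[OF assms(1) r] by metis
      have Rn: "R \<lhd> G" by (rule nilpotent_sylow_normal[OF assms(1,2) r R])
      have NR: "N <#> R \<lhd> G" using N(1) Rn by (rule normal_subgroup_set_mult_closed)
      have "\<not> q dvd card (N <#> R)"
      proof
        assume "q dvd card (N <#> R)"
        then have "q dvd card N * card R" using card_set_mult[OF assms(1) Ns R(1)] by (metis dvd_mult2)
        then have "q dvd r ^ multiplicity r (order G)" using N(2) assms(3) R(2) prime_dvd_mult_iff by metis
        then show False using False assms(3) r by (metis prime_dvd_power primes_dvd_imp_eq)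
      qed
      then have "N <#> R = N" using Nmax set_mult_upper(1)[OF Ns R(1)] NR by (auto simp: F_def)
      then have RN: "R \<subseteq> N" using set_mult_upper(2)[OF Ns R(1)] by simp
      have "r ^ multiplicity r (order G) dvd card N" using card_subgroup_dvd[OF R(1) Ns RN] R(2) by simp
      then have "multiplicity r (order G) \<le> multiplicity r (card N)"
        using Npos r not_prime_unit by (intro multiplicity_geI) auto
      moreover have "multiplicity r m \<le> multiplicity r (order G)"
        using assms(4) o by (intro dvd_imp_multiplicity_le) auto
      ultimately show ?thesis by simp
    qed
  qed
  moreover have "card N dvd m"
  proof -
    have "card N dvd q ^ a * m" using card_subgroup_dvd[OF Ns subgroup_self subgroup.subset[OF Ns]] assms(4) by (simp add: order_def)
    moreover have "coprime (card N) (q ^ a)" using N(2) assms(3) prime_imp_coprime coprime_commute coprime_power_right_iff by metis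
    ultimately show ?thesis by (simp add: coprime_dvd_mult_right_iff)
  qed
  ultimately have "card N = m" by (rule dvd_antisym[rotated])
  then show thesis using that N by blast
qed

text \<open>The witness is NQ with N the normal complement of a Sylow q-subgroup. It turns a
  subgroup of index q in a Sylow subgroup into a maximal subgroup of the whole group, to which the
  hypothesis on sylowizers can be applied.\<close>

lemma nilpotent_index_prime_extension:
  assumes "finite (carrier G)" "nilpotent_group G" "Factorial_Ring.prime q" "order G = q ^ a * m" "\<not> q dvd m"
    and "subgroup Q G" "q ^ a = q * card Q"
  obtains M where "subgroup M G" "Q \<subseteq> M" "order G = q * card M"
proof -
  obtain N where N: "N \<lhd> G" "card N = m" by (rule nilpotent_normal_complement[OF assms(1-5)])
  have Ns: "subgroup N G" using N normal_imp_subgroup by blast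
  have M: "subgroup (N <#> Q) G" using N(1) assms(6) by (rule mult_norm_subgroup)
  have NQ: "subgroup (N \<inter> Q) G" using Ns assms(6) by (rule subgroups_Inter_pair)
  have "card (N \<inter> Q) dvd m" using card_subgroup_dvd[OF NQ Ns] N(2) by simp
  moreover have "card (N \<inter> Q) dvd q ^ a" using card_subgroup_dvd[OF NQ assms(6)] assms(7) by simp
  moreover have "coprime m (q ^ a)" using assms(3,5) prime_imp_coprime coprime_commute coprime_power_right_iff by metis
  ultimately have "card (N \<inter> Q) = 1" by (metis coprime_common_divisor_nat)
  then have "card (N <#> Q) = m * card Q" using card_set_mult[OF assms(1) Ns assms(6)] N(2) by simp
  then have "order G = q * card (N <#> Q)" using assms(4,7) by simp
  then show thesis using that[OF M set_mult_upper(2)[OF Ns assms(6)]] by blast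
qed

lemma cyclic_subgroup_of_cyclic:
  assumes "finite (carrier G)" "cyclic_group G" "subgroup P G"
  shows "cyclic_group (G\<lparr>carrier := P\<rparr>)"
proof -
  obtain a where a: "a \<in> carrier G" "\<And>x. x \<in> carrier G \<Longrightarrow> \<exists>k::nat. x = a [^] k"
    using cyclic_subgroup_nat_generator[OF assms(1) subgroup_self] assms(2) by auto
  have "generate G {a} = carrier G"
    using a generate_pow_on_finite_carrier[OF assms(1) a(1)] by auto
  then have oa: "ord a = order G" using generate_pow_card[OF a(1)] by (simp add: order_def)
  have Ppos: "card P > 0" using subgroup_card_pos(1)[OF assms(1,3)] .
  have "card P dvd order G" unfolding order_def by (rule card_subgroup_dvd[OF assms(3) subgroup_self subgroup.subset[OF assms(3)]])
  then obtain d where d: "order G = card P * d" by (auto elim: dvdE)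
  \<comment> \<open>With d = |G : P|, the group generated by a^d contains P and has order dividing
    |P|.\<close>
  define b where "b = a [^] d"
  have bc: "b \<in> carrier G" using a by (simp add: b_def)
  have sub: "P \<subseteq> generate G {b}"
  proof
    fix x assume x: "x \<in> P"
    then have "x \<in> carrier G" using subgroup.mem_carrier[OF assms(3)] by blast
    then obtain k :: nat where k: "x = a [^] k" using a by blast
    have "a [^] (k * card P) = \<one>" using pow_card_subgroup[OF assms(1,3) x] k a by (simp add: nat_pow_pow)
    then have "card P * d dvd card P * k" using pow_eq_id[OF a(1)] oa d by (simp add: mult.commute)
    then have "d dvd k" using Ppos by simp
    then obtain l where "k = d * l" by (auto elim: dvdE)
    then have "x = b [^] l" using k a by (simp add: b_def nat_pow_pow)
    then show "x \<in> generate G {b}" using generate_pow_on_finite_carrier[OF assms(1) bc] by auto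
  qed
  have gb: "subgroup (generate G {b}) G" using bc by (intro generate_is_subgroup) auto
  have "b [^] card P = \<one>" using a oa d pow_ord_eq_1[OF a(1)] by (simp add: b_def nat_pow_pow mult.commute)
  then have "ord b dvd card P" using pow_eq_id[OF bc] by simp
  then have "card (generate G {b}) \<le> card P" using generate_pow_card[OF bc] Ppos by (metis dvd_imp_le)
  then have eq: "P = generate G {b}" using sub subgroup_card_pos(2)[OF assms(1) gb] by (metis card_seteq)
  interpret P: group "G\<lparr>carrier := P\<rparr>" by (rule subgroup_imp_group) fact
  have bP: "b \<in> P" unfolding eq by (rule generate.incl) simp
  have "generate (G\<lparr>carrier := P\<rparr>) {b} = P"
    using generate_consistent[of "{b}" P] bP assms(3) eq by simp
  then have "P = range (\<lambda>n::int. b [^]\<^bsub>G\<lparr>carrier := P\<rparr>\<^esub> n)" using P.generate_pow[of b] bP by (simp add: full_SetCompr_eq)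
  then show ?thesis using P.cyclic_group bP by auto
qed

lemma subgroup_set_mult_commute:
  assumes "finite (carrier G)" "subgroup A G" "subgroup B G" "A <#> B = B <#> A"
  shows "subgroup (A <#> B) G"
proof (rule finite_subgroupI[OF assms(1)])
  interpret A: subgroup A G by fact
  interpret B: subgroup B G by fact
  show "A <#> B \<subseteq> carrier G" using A.subset B.subset by (rule set_mult_closed)
  show "\<one> \<in> A <#> B" using set_mult_upper(1)[OF assms(2,3)] A.one_closed by blast
  fix x y assume "x \<in> A <#> B" "y \<in> A <#> B"
  then obtain a b c d where abcd: "a \<in> A" "b \<in> B" "x = a \<otimes> b" "c \<in> A" "d \<in> B" "y = c \<otimes> d"
    unfolding set_mult_def by blast
  have "b \<otimes> c \<in> A <#> B" unfolding assms(4) using abcd unfolding set_mult_def by blast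
  then obtain e f where ef: "e \<in> A" "f \<in> B" "b \<otimes> c = e \<otimes> f" unfolding set_mult_def by blast
  have "x \<otimes> y = a \<otimes> (b \<otimes> c) \<otimes> d" using abcd by (simp add: m_assoc)
  also have "\<dots> = (a \<otimes> e) \<otimes> (f \<otimes> d)" unfolding ef(3) using abcd ef by (simp add: m_assoc)
  finally show "x \<otimes> y \<in> A <#> B" using abcd ef A.m_closed B.m_closed unfolding set_mult_def by blast
qed

section \<open>Hall subgroups and the index of a sylowizer\<close>

lemma conj_set_subgroup:
  assumes "subgroup K G" "x \<in> carrier G"
  shows "subgroup (conj_set G K x) G" "card (conj_set G K x) = card K"
proof -
  have "conj_set G K x = (\<lambda>k. inv x \<otimes> k \<otimes> inv (inv x)) ` K"
    using assms(2) by (auto simp: conj_set_def l_coset_def r_coset_def)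
  then show "subgroup (conj_set G K x) G" "card (conj_set G K x) = card K"
    using subgroup_conj_image[OF assms(1), of "inv x"] assms(2) by simp_all
qed

lemma hall_subgroupD:
  assumes "hall_subgroup G \<pi> H"
  shows "subgroup H G" "order G = card (rcosets H) * card H"
    "Factorial_Ring.prime p \<Longrightarrow> p dvd card H \<Longrightarrow> p \<in> \<pi>"
    "Factorial_Ring.prime p \<Longrightarrow> p \<in> \<pi> \<Longrightarrow> \<not> p dvd card (rcosets H)"
proof -
  show H: "subgroup H G" using assms by (simp add: hall_subgroup_def pi_subgroup_def)
  show "order G = card (rcosets H) * card H" using lagrange[OF H] by simp
  show "Factorial_Ring.prime p \<Longrightarrow> p dvd card H \<Longrightarrow> p \<in> \<pi>"
    using assms by (auto simp: hall_subgroup_def pi_subgroup_def pi_number_def prime_factors_dvd)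
  show "Factorial_Ring.prime p \<Longrightarrow> p \<in> \<pi> \<Longrightarrow> \<not> p dvd card (rcosets H)"
    using assms by (auto simp: hall_subgroup_def)
qed

lemma hall_subgroup_restrictI:
  assumes "subgroup T G" "subgroup M G" "M \<subseteq> T" "pi_number \<pi> (card M)" "card T = i * card M"
    and "\<And>p. Factorial_Ring.prime p \<Longrightarrow> p \<in> \<pi> \<Longrightarrow> \<not> p dvd i" "finite (carrier G)"
  shows "hall_subgroup (G\<lparr>carrier := T\<rparr>) \<pi> M"
proof -
  interpret T: group "G\<lparr>carrier := T\<rparr>" by (rule subgroup_imp_group) fact
  have MT: "subgroup M (G\<lparr>carrier := T\<rparr>)" by (rule subgroup_incl) fact+
  have "card (rcosets\<^bsub>G\<lparr>carrier := T\<rparr>\<^esub> M) * card M = card T" using T.lagrange[OF MT] by (simp add: order_def)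
  then have "card (rcosets\<^bsub>G\<lparr>carrier := T\<rparr>\<^esub> M) = i"
    using assms(5) subgroup_card_pos(1)[OF assms(7,2)] by simp
  then show ?thesis using MT assms(4,6) by (simp add: hall_subgroup_def pi_subgroup_def)
qed

text \<open>Only the order of the conjugate of K inside S is recorded, because the index of S is
  computed one prime at a time.\<close>

lemma sylowizer_contains_conjugate:
  assumes "finite (carrier G)" "sylowizer G \<pi> M S" "hall_subgroup G \<pi>' K" "\<pi> \<inter> \<pi>' = {}" "c_permutable G S K"
  shows "card K dvd card S"
proof -
  have S: "subgroup S G" and SM: "hall_subgroup (G\<lparr>carrier := S\<rparr>) \<pi> M"
    and Smax: "\<And>T. subgroup T G \<Longrightarrow> hall_subgroup (G\<lparr>carrier := T\<rparr>) \<pi> M \<Longrightarrow> S \<subseteq> T \<Longrightarrow> T = S"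
    using assms(2) by (auto simp: sylowizer_def)
  interpret SS: group "G\<lparr>carrier := S\<rparr>" by (rule subgroup_imp_group) fact
  define i where "i = card (rcosets\<^bsub>G\<lparr>carrier := S\<rparr>\<^esub> M)"
  have MS: "subgroup M (G\<lparr>carrier := S\<rparr>)" using SS.hall_subgroupD(1)[OF SM] .
  have M: "subgroup M G" using incl_subgroup[OF S MS] .
  have MsubS: "M \<subseteq> S" using subgroup.subset[OF MS] by simp
  have cS: "card S = i * card M" using SS.hall_subgroupD(2)[OF SM] by (simp add: order_def i_def)
  have K: "subgroup K G" using hall_subgroupD(1)[OF assms(3)] .
  obtain x where x: "x \<in> carrier G" "S <#> conj_set G K x = conj_set G K x <#> S"
    using assms(5) by (auto simp: c_permutable_def)
  define L where "L = conj_set G K x"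
  have L: "subgroup L G" "card L = card K" using conj_set_subgroup[OF K x(1)] by (auto simp: L_def)
  have T: "subgroup (S <#> L) G" by (rule subgroup_set_mult_commute[OF assms(1) S L(1)]) (use x in \<open>simp add: L_def\<close>)
  have ST: "S \<subseteq> S <#> L" and LT: "L \<subseteq> S <#> L" using set_mult_upper[OF S L(1)] by auto
  have MT: "M \<subseteq> S <#> L" using MsubS ST by blast
  obtain j where j: "card (S <#> L) = j * card M"
    using card_subgroup_dvd[OF M T MT] by (metis dvd_def mult.commute)
  have Mpos: "card M > 0" using subgroup_card_pos(1)[OF assms(1) M] .
  have "card M * (j * card (S \<inter> L)) = card M * (i * card K)"
    using card_set_mult[OF assms(1) S L(1)] L(2) cS j by (simp add: ac_simps)
  \<comment> \<open>This says |SL : M| |S \<inter> L| = |S : M| |K|. No prime of \<pi> divides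
    either factor on the right, so M remains a Hall \<pi>-subgroup of SL.\<close>
  then have e: "j * card (S \<inter> L) = i * card K" using Mpos by simp
  have "hall_subgroup (G\<lparr>carrier := S <#> L\<rparr>) \<pi> M"
  proof (rule hall_subgroup_restrictI[OF T M MT _ j _ assms(1)])
    show "pi_number \<pi> (card M)" using SM by (simp add: hall_subgroup_def pi_subgroup_def)
    fix p assume p: "Factorial_Ring.prime p" "p \<in> \<pi>"
    show "\<not> p dvd j"
    proof
      assume "p dvd j"
      then have "p dvd i * card K" using e by (metis dvd_mult2)
      moreover have "\<not> p dvd i" using SS.hall_subgroupD(4)[OF SM p] by (simp add: i_def)
      ultimately have "p dvd card K" using p(1) prime_dvd_mult_iff by blast
      then have "p \<in> \<pi>'" using hall_subgroupD(3)[OF assms(3) p(1)] by blast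
      then show False using p(2) assms(4) by blast
    qed
  qed
  then have "S <#> L = S" using Smax[OF T _ ST] by blast
  then have "L \<subseteq> S" using LT by simp
  then show ?thesis using card_subgroup_dvd[OF L(1) S] L(2) by simp
qed

text \<open>For every prime r dividing |G : H|, a member of \<H> carries the full r-part of |G| and
  its order divides |S|; so |G : H| divides |S|, and so does |M|, which is coprime to it. This
  determines |S| up to a factor d dividing q. The case d = q would make |S : M| divisible by q,
  although M is a Hall \<pi>-subgroup of S and q lies in \<pi>.\<close>

lemma sylowizer_index:
  assumes "finite (carrier G)" "prime_partition \<sigma>" "complete_hall_set \<sigma> G \<H>"
    and "\<pi> \<in> \<sigma>" "hall_subgroup G \<pi> H" "subgroup M G" "M \<subseteq> H" "Factorial_Ring.prime q" "card H = q * card M"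
    and S: "sylowizer G \<pi> M S" "\<And>K. K \<in> \<H> \<Longrightarrow> c_permutable G S K"
  shows "order G = q * card S"
proof -
  have Ss: "subgroup S G" and SM: "hall_subgroup (G\<lparr>carrier := S\<rparr>) \<pi> M"
    using S(1) by (auto simp: sylowizer_def)
  interpret SS: group "G\<lparr>carrier := S\<rparr>" by (rule subgroup_imp_group) fact
  define i where "i = card (rcosets H)"
  have oi: "order G = i * card H" using hall_subgroupD(2)[OF assms(5)] by (simp add: i_def)
  have o: "order G \<noteq> 0" using assms(1) order_gt_0_iff_finite by simp
  have i0: "i \<noteq> 0" using oi o by auto
  have Spos: "card S \<noteq> 0" using subgroup_card_pos(1)[OF assms(1) Ss] by simp
  have MS: "M \<subseteq> S" using subgroup.subset[OF SS.hall_subgroupD(1)[OF SM]] by simp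
  have Mpos: "card M > 0" using subgroup_card_pos(1)[OF assms(1,6)] .
  have q\<pi>: "q \<in> \<pi>" using hall_subgroupD(3)[OF assms(5,8)] assms(9) by simp
  have "i dvd card S"
  proof (rule multiplicity_le_imp_dvd[OF i0])
    fix r :: nat assume r: "Factorial_Ring.prime r"
    show "multiplicity r i \<le> multiplicity r (card S)"
    proof (cases "r dvd i")
      case False then show ?thesis by (simp add: not_dvd_imp_multiplicity_0)
    next
      case True
      have rn: "r \<notin> \<pi>" using hall_subgroupD(4)[OF assms(5) r] True by (auto simp: i_def)
      have part: "partition_on {p. Factorial_Ring.prime p} \<sigma>" using assms(2) by (simp add: prime_partition_def)
      then have "r \<in> \<Union>\<sigma>" using r by (auto simp: partition_on_def)
      then obtain \<pi>' where \<pi>': "\<pi>' \<in> \<sigma>" "r \<in> \<pi>'" by blast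
      have "\<pi> \<noteq> \<pi>'" using rn \<pi>' by auto
      then have disj: "\<pi> \<inter> \<pi>' = {}" using part assms(4) \<pi>'(1) by (auto simp: partition_on_def disjoint_def)
      have "r dvd order G" using True oi by simp
      then have "r \<in> prime_factors (order G)" using r o by (simp add: prime_factors_dvd)
      then have "\<pi>' \<in> sigma_of \<sigma> G" using \<pi>' by (auto simp: sigma_of_def)
      then obtain K where K: "K \<in> \<H>" "hall_subgroup G \<pi>' K" using assms(3) by (auto simp: complete_hall_set_def)
      have KS: "card K dvd card S"
        by (rule sylowizer_contains_conjugate[OF assms(1) S(1) K(2) disj S(2)[OF K(1)]])
      have oK: "order G = card (rcosets K) * card K" using hall_subgroupD(2)[OF K(2)] .
      have rK: "\<not> r dvd card (rcosets K)" using hall_subgroupD(4)[OF K(2) r \<pi>'(2)] .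
      have "multiplicity r i \<le> multiplicity r (order G)" using oi o by (intro dvd_imp_multiplicity_le) auto
      also have "\<dots> = multiplicity r (card (rcosets K)) + multiplicity r (card K)"
        using oK o r by (metis mult_zero_left mult_zero_right prime_elem_multiplicity_mult_distrib prime_imp_prime_elem)
      also have "\<dots> = multiplicity r (card K)" using rK by (simp add: not_dvd_imp_multiplicity_0)
      also have "\<dots> \<le> multiplicity r (card S)" using KS Spos by (intro dvd_imp_multiplicity_le)
      finally show ?thesis .
    qed
  qed
  moreover have "card M dvd card S" using card_subgroup_dvd[OF assms(6) Ss MS] .
  moreover have "coprime (card M) i"
  proof (rule coprime_if_primes_disjoint)
    fix r assume r: "Factorial_Ring.prime r" "r dvd card M" "r dvd i"
    have "r \<in> \<pi>" using hall_subgroupD(3)[OF assms(5) r(1)] r(2) assms(9) by simp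
    then show False using hall_subgroupD(4)[OF assms(5) r(1)] r(3) by (simp add: i_def)
  qed (use Mpos in simp)
  ultimately have "card M * i dvd card S" by (simp add: divides_mult)
  then obtain d where d: "card S = card M * i * d" by (auto elim: dvdE)
  have oM: "order G = (card M * i) * q" using oi assms(9) by simp
  have "card S dvd order G" unfolding order_def
    by (rule card_subgroup_dvd[OF Ss subgroup_self subgroup.subset[OF Ss]])
  then have "d dvd q" using d oM Mpos i0 by simp
  moreover have "d \<noteq> q"
  proof
    assume "d = q"
    have "order (G\<lparr>carrier := S\<rparr>) = card M * i * q" using d \<open>d = q\<close> by (simp add: order_def)
    then have "card (rcosets\<^bsub>G\<lparr>carrier := S\<rparr>\<^esub> M) * card M = card M * i * q"
      using SS.hall_subgroupD(2)[OF SM] by metis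
    then have "card M * card (rcosets\<^bsub>G\<lparr>carrier := S\<rparr>\<^esub> M) = card M * (i * q)" by (metis mult.assoc mult.commute)
    then have "card (rcosets\<^bsub>G\<lparr>carrier := S\<rparr>\<^esub> M) = i * q" using Mpos by (metis mult_cancel1 less_irrefl)
    then show False using SS.hall_subgroupD(4)[OF SM assms(8) q\<pi>] by simp
  qed
  ultimately have "d = 1" using assms(8) by (auto simp: prime_nat_iff)
  then show ?thesis using d oM by simp
qed

lemma prime_index_maximal_subgroup:
  assumes "finite (carrier G)" "subgroup M G" "Factorial_Ring.prime q" "order G = q * card M"
  shows "maximal_subgroup G M"
proof -
  have Mpos: "card M > 0" using subgroup_card_pos(1)[OF assms(1,2)] .
  have "M \<noteq> carrier G" using assms(4) Mpos prime_gt_1_nat[OF assms(3)] by (auto simp: order_def)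
  moreover have "K = M \<or> K = carrier G" if K: "subgroup K G" "M \<subseteq> K" for K
  proof -
    obtain d where d: "card K = card M * d" using card_subgroup_dvd[OF assms(2) K] by (auto elim: dvdE)
    have "card K dvd order G" unfolding order_def
      by (rule card_subgroup_dvd[OF K(1) subgroup_self subgroup.subset[OF K(1)]])
    then have "card M * d dvd card M * q" using d assms(4) by (simp add: mult.commute)
    then have "d dvd q" using Mpos by simp
    then have "d = 1 \<or> d = q" using assms(3) by (auto simp: prime_nat_iff)
    then show ?thesis
    proof
      assume "d = 1"
      then have "M = K" using d K(2) subgroup_card_pos(2)[OF assms(1) K(1)] by (simp add: card_subset_eq)
      then show ?thesis by simp
    next
      assume "d = q"
      then have "card K = card (carrier G)" using d assms(4) by (simp add: order_def mult.commute)
      then have "K = carrier G" using subgroup.subset[OF K(1)] assms(1) by (simp add: card_subset_eq)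
      then show ?thesis by simp
    qed
  qed
  ultimately show ?thesis using assms(2) by (simp add: maximal_subgroup_def)
qed

end

theorem theorem2p5:
  fixes G :: "('a, 'b) monoid_scheme"
    and \<sigma> :: "nat set set"
    and \<H> :: "'a set set"
  assumes "group G"
    and "finite (carrier G)"
    and "prime_partition \<sigma>"
    and "sigma_full_sylow_type \<sigma> G"
    and "complete_hall_set \<sigma> G \<H>"
    and "\<And>\<pi> H. \<lbrakk>\<pi> \<in> sigma_of \<sigma> G; H \<in> \<H>; hall_subgroup G \<pi> H\<rbrakk>
           \<Longrightarrow> nilpotent_group (G\<lparr>carrier := H\<rparr>)"
    and "\<And>\<pi> H M. \<lbrakk>\<pi> \<in> sigma_of \<sigma> G; H \<in> \<H>; hall_subgroup G \<pi> H;
             \<not> cyclic_group (G\<lparr>carrier := H\<rparr>); maximal_subgroup (G\<lparr>carrier := H\<rparr>) M\<rbrakk>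
           \<Longrightarrow> \<exists>S. sylowizer G \<pi> M S \<and> (\<forall>K\<in>\<H>. c_permutable G S K)"
  shows "supersoluble G"
proof -
  interpret group G by fact
  show ?thesis unfolding supersoluble_def
  proof (rule supersoluble_if_prime_index_property[OF assms(2)])
    fix p :: nat assume p: "Factorial_Ring.prime p" "p dvd order G"
    have o: "order G \<noteq> 0" using assms(2) order_gt_0_iff_finite by simp
    have "p \<in> \<Union>\<sigma>" using assms(3) p(1) by (auto simp: prime_partition_def partition_on_def)
    then obtain \<pi> where \<pi>: "\<pi> \<in> \<sigma>" "p \<in> \<pi>" by blast
    have "p \<in> prime_factors (order G)" using p o by (simp add: prime_factors_dvd)
    then have \<pi>G: "\<pi> \<in> sigma_of \<sigma> G" using \<pi> by (auto simp: sigma_of_def)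
    then obtain H where H: "H \<in> \<H>" "hall_subgroup G \<pi> H" using assms(5) by (auto simp: complete_hall_set_def)
    note HD = hall_subgroupD[OF H(2)]
    define GH where "GH = G\<lparr>carrier := H\<rparr>"
    interpret H: group GH unfolding GH_def by (rule subgroup_imp_group[OF HD(1)])
    have finH: "finite (carrier GH)" using subgroup_card_pos(2)[OF assms(2) HD(1)] by (simp add: GH_def)
    have oH: "order GH = card H" by (simp add: order_def GH_def)
    define a where "a = multiplicity p (order GH)"
    obtain P m where P: "subgroup P GH" "card P = p ^ a" "order GH = p ^ a * m" "\<not> p dvd m"
      unfolding a_def by (rule H.sylow_exists[OF finH p(1)])
    have PG: "subgroup P G" using incl_subgroup[OF HD(1)] P(1) by (simp add: GH_def)
    \<comment> \<open>H is a Hall subgroup for the class of p, so a Sylow p-subgroup of H is one of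
      G.\<close>
    have "order G = p ^ a * (m * card (rcosets\<^bsub>G\<^esub> H))" using HD(2) P(3) oH by simp
    moreover have "\<not> p dvd m * card (rcosets\<^bsub>G\<^esub> H)" using P(4) HD(4)[OF p(1) \<pi>(2)] p(1) prime_dvd_mult_iff by blast
    ultimately have "sylow_subgroup G p P" using PG P(2) unfolding sylow_subgroup_def by blast
    moreover have "prime_index_property G p P"
    proof (cases "cyclic_group GH")
      case True
      then have "cyclic_group (GH\<lparr>carrier := P\<rparr>)" by (rule H.cyclic_subgroup_of_cyclic[OF finH _ P(1)])
      then show ?thesis by (simp add: prime_index_property_def GH_def)
    next
      case False
      have "\<exists>S. subgroup S G \<and> Q \<subseteq> S \<and> order G = p * card S"
        if Q: "subgroup Q G" "Q \<subseteq> P" "card P = p * card Q" for Q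
      proof -
        have PH: "P \<subseteq> H" using subgroup.subset[OF P(1)] by (simp add: GH_def)
        have QH: "subgroup Q GH" unfolding GH_def by (rule subgroup_incl[OF Q(1) HD(1)]) (use Q(2) PH in blast)
        have nil: "nilpotent_group GH" unfolding GH_def by (rule assms(6)[OF \<pi>G H])
        \<comment> \<open>Q has index p in P but is in general too small to be maximal in H; M
          enlarges it to a subgroup of index p in H.\<close>
        obtain M where M: "subgroup M GH" "Q \<subseteq> M" "order GH = p * card M"
          by (rule H.nilpotent_index_prime_extension[OF finH nil p(1) P(3,4) QH]) (use P(2) Q(3) in auto)
        have "maximal_subgroup GH M" by (rule H.prime_index_maximal_subgroup[OF finH M(1) p(1) M(3)])
        then obtain S where S: "sylowizer G \<pi> M S" "\<And>K. K \<in> \<H> \<Longrightarrow> c_permutable G S K"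
          using assms(7)[OF \<pi>G H] False unfolding GH_def by blast
        have MG: "subgroup M G" using incl_subgroup[OF HD(1)] M(1) by (simp add: GH_def)
        have MH: "M \<subseteq> H" using subgroup.subset[OF M(1)] by (simp add: GH_def)
        have "order G = p * card S"
          by (rule sylowizer_index[OF assms(2,3,5) \<pi>(1) H(2) MG MH p(1) _ S]) (use M(3) oH in simp)
        moreover have "subgroup S G" "subgroup M (G\<lparr>carrier := S\<rparr>)"
          using S(1) by (simp_all add: sylowizer_def hall_subgroup_def pi_subgroup_def)
        moreover from this(2) have "M \<subseteq> S" using subgroup.subset by fastforce
        ultimately show ?thesis using M(2) by blast
      qed
      then show ?thesis by (auto simp: prime_index_property_def)
    qed
    ultimately show "\<exists>P. sylow_subgroup G p P \<and> prime_index_property G p P" by blast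
  qed
qed

end
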